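(* Let $X=\{X_n, n\in\mathbb{Z}\}$ be a centered stationary Gaussian family of random variables with unit variance and covariance function $\rho(k)=\mathbb{E}(X_0X_k)$. Let $g\in\mathbb{D}^{2,4}(\mathbb{R},\gamma)$ have Hermite rank $d=1$, suppose that $\sum_{j\in\mathbb{Z}}|\rho(j)|<\infty$, and suppose that $\sigma^2>0$, where $\sigma^2=\sum_{m=1}^\infty m!\,c_m^2\sum_{k\in\mathbb{Z}}\rho(k)^m$ and $g=\sum_{m\ge 1}c_mH_m$. Set $Y_n=\frac{1}{\sqrt n}\sum_{j=1}^n g(X_j)$ and $\sigma_n^2=\mathbb{E}(Y_n^2)$, and let $Z$ be a standard normal random variable. Then there is a constant $C$, not depending on $n$, such that for all $n\ge1$ $$d_{\rm TV}(Y_n/\sigma_n,Z)\le C\,n^{-\frac12}.$$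
   Context: $\gamma$ is the standard Gaussian measure on $\mathbb{R}$. $H_m(x)=(-1)^m e^{x^2/2}\frac{d^m}{dx^m}e^{-x^2/2}$ ($H_0=1$) is the $m$-th Hermite polynomial. A function $g\in L^2(\mathbb{R},\gamma)$ has Hermite rank $d\ge1$ if $g=\sum_{m=d}^\infty c_mH_m$ in $L^2(\mathbb{R},\gamma)$ with $c_d\ne0$. For an integer $k\ge 0$ and $p\ge1$, $\mathbb{D}^{k,p}(\mathbb{R},\gamma)$ is the Gaussian Sobolev space of functions having weak derivatives up to order $k$ in $L^p(\mathbb{R},\gamma)$ (the closure of $C_b^\infty(\mathbb{R})$ under the norm $(\sum_{i=0}^k\|g^{(i)}\|_{L^p(\gamma)}^p)^{1/p}$). $d_{\rm TV}(F,G)=\sup_{B}|P(F\in B)-P(G\in B)|$, the supremum being over Borel sets $B\subset\mathbb{R}$. *)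

theory Defs
  imports "HOL-Probability.Probability"
begin

definition gauss :: "real measure" where
  "gauss = density lborel std_normal_density"

definition hermite :: "nat \<Rightarrow> real \<Rightarrow> real" where
  "hermite m x = (-1) ^ m * exp (x\<^sup>2 / 2) * (deriv ^^ m) (\<lambda>t. exp (- (t\<^sup>2) / 2)) x"

definition Lp_fun :: "'a measure \<Rightarrow> real \<Rightarrow> ('a \<Rightarrow> real) \<Rightarrow> bool" where
  "Lp_fun M p f \<longleftrightarrow> f \<in> borel_measurable M \<and> integrable M (\<lambda>x. \<bar>f x\<bar> powr p)"

definition Lp_norm :: "'a measure \<Rightarrow> real \<Rightarrow> ('a \<Rightarrow> real) \<Rightarrow> real" where
  "Lp_norm M p f = (\<integral>x. \<bar>f x\<bar> powr p \<partial>M) powr (1 / p)"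

(* g = sum_{m >= d} c_m H_m in L^2(gauss); the values c m for m < d are irrelevant. *)
definition hermite_expansion :: "nat \<Rightarrow> (nat \<Rightarrow> real) \<Rightarrow> (real \<Rightarrow> real) \<Rightarrow> bool" where
  "hermite_expansion d c g \<longleftrightarrow>
     Lp_fun gauss 2 g \<and>
     (\<lambda>n. Lp_norm gauss 2 (\<lambda>x. g x - (\<Sum>m=d..n. c m * hermite m x))) \<longlonglongrightarrow> 0"

definition has_hermite_rank :: "(real \<Rightarrow> real) \<Rightarrow> nat \<Rightarrow> bool" where
  "has_hermite_rank g d \<longleftrightarrow> d \<ge> 1 \<and> (\<exists>c. hermite_expansion d c g \<and> c d \<noteq> 0)"

(* Smooth functions that are bounded together with all their derivatives. *)
definition Cb_infinity :: "(real \<Rightarrow> real) set" where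
  "Cb_infinity =
     {u. \<forall>i. (deriv ^^ i) u differentiable_on UNIV \<and> bounded (range ((deriv ^^ i) u))}"

(* The closure of Cb_infinity under (sum_{i <= k} ||u^(i)||_p^p)^(1/p).
   The function h i is the L^p-limit of the i-th derivatives of the approximating
   sequence, i.e. the i-th weak derivative of g; integration by parts shows that it
   depends (up to null sets) only on g. *)
definition gauss_sobolev :: "nat \<Rightarrow> real \<Rightarrow> (real \<Rightarrow> real) set" where
  "gauss_sobolev k p =
     {g. \<exists>h :: nat \<Rightarrow> real \<Rightarrow> real. h 0 = g \<and> (\<forall>i\<le>k. Lp_fun gauss p (h i)) \<and>
        (\<exists>u :: nat \<Rightarrow> real \<Rightarrow> real. (\<forall>n. u n \<in> Cb_infinity) \<and>
           (\<lambda>n. (\<Sum>i\<le>k. Lp_norm gauss p (\<lambda>x. h i x - (deriv ^^ i) (u n) x) powr p) powr (1 / p))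
             \<longlonglongrightarrow> 0)}"

(* The point mass is the degenerate Gaussian law N(m, 0). *)
definition gaussian_law :: "real measure \<Rightarrow> bool" where
  "gaussian_law D \<longleftrightarrow>
     (\<exists>m s. s > 0 \<and> D = density lborel (normal_density m s)) \<or> (\<exists>m. D = return borel m)"

(* Joint Gaussianity: every finite linear combination is a (possibly degenerate)
   Gaussian random variable. *)
definition gaussian_family :: "'a measure \<Rightarrow> ('i \<Rightarrow> 'a \<Rightarrow> real) \<Rightarrow> bool" where
  "gaussian_family M X \<longleftrightarrow>
     (\<forall>i. X i \<in> borel_measurable M) \<and>
     (\<forall>J a. finite J \<longrightarrow> gaussian_law (distr M borel (\<lambda>\<omega>. \<Sum>i\<in>J. a i * X i \<omega>)))"

(* Strict stationarity: the law of the process on the product space is shift-invariant. *)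
definition stationary_family :: "'a measure \<Rightarrow> (int \<Rightarrow> 'a \<Rightarrow> real) \<Rightarrow> bool" where
  "stationary_family M X \<longleftrightarrow>
     (\<forall>h. distr M (Pi\<^sub>M UNIV (\<lambda>_. borel)) (\<lambda>\<omega> n. X (n + h) \<omega>)
        = distr M (Pi\<^sub>M UNIV (\<lambda>_. borel)) (\<lambda>\<omega> n. X n \<omega>))"

(* F and G may live on different probability spaces. *)
definition tv_dist ::
    "'a measure \<Rightarrow> ('a \<Rightarrow> real) \<Rightarrow> 'b measure \<Rightarrow> ('b \<Rightarrow> real) \<Rightarrow> real" where
  "tv_dist M F N G =
     (SUP B\<in>sets (borel :: real measure).
        \<bar>measure M {\<omega> \<in> space M. F \<omega> \<in> B} - measure N {\<omega> \<in> space N. G \<omega> \<in> B}\<bar>)"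

end

theory Submission
  imports Defs "HOL-Real_Asymp.Real_Asymp"
begin

text \<open>
  Let \<open>h\<close> be a Lipschitz function with values in \<open>{0..1}\<close>, let \<open>f\<close> solve Stein's equation
  \<open>f' x - x * f x = h x - E (h Z)\<close>, and let \<open>G\<close> be the normalised sum. Then
  \<open>E (h G) - E (h Z)\<close> equals \<open>E (f' G) - E (G * f G)\<close>, and such functions \<open>h\<close> determine the
  total variation distance (\<open>stein_equation\<close>, \<open>tv_from_lipschitz\<close>).

  The main tool is a covariance inequality (\<open>gaussian_covariance_bound\<close>). For a Gaussian vector \<open>V\<close> with unit variances and
  covariances \<open>r\<close>, and an independent copy \<open>V'\<close>, the covariance of \<open>F V\<close> and \<open>G V\<close> is an
  integral over rotations \<open>(c, s)\<close> of the expectations of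
  \<open>r i j * D\<^sub>j G (V) * D\<^sub>i F (c * V - s * V')\<close>, summed over \<open>i\<close> and \<open>j\<close>. Its
  proof uses only that Gaussian vectors with the same covariances have the same joint law, a
  consequence of \<open>joint_law_determined_by_char\<close>: this yields the independence of regression residuals, hence integration by
  parts, and the invariance of \<open>(V, V')\<close> under rotations. The inequality is used twice.

  First, it compares \<open>E (G * f G)\<close> with \<open>E (f' G)\<close>. For a sum
  \<open>G = a * (\<Sum>i. u (V i))\<close> with \<open>a\<^sup>2\<close> of order \<open>1 / n\<close>, the difference is bounded by a constant times
  \<open>a\<^sup>2\<close> times the standard deviation of
  \<open>T = (\<Sum>i j. r i j * u' (V i) * u' (c * V j - s * V' j))\<close>, up to the deviation of \<open>E (G\<^sup>2)\<close> from 1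
  (\<open>stein_bound_smooth\<close>). The independent copy is kept in \<open>T\<close> instead of
  being integrated out, so that \<open>T\<close> is an explicit function of a Gaussian vector.

  Secondly, it bounds the variance of \<open>T\<close>, which is a quadratic functional of a Gaussian vector with
  \<open>2 * n\<close> coordinates (\<open>mixed_quadratic_variance\<close>). The sum over four indices of products of three covariances
  is at most a constant times \<open>n * S ^ 3\<close>, where \<open>S\<close> is the sum of all \<open>\<bar>\<rho> j\<bar>\<close>, and every summand carries the expectation of a product of
  two values of \<open>u'\<close> and two values of \<open>u''\<close>, which fourth moments control. So the standard deviation of \<open>T\<close> is
  of order \<open>sqrt n\<close>, and the product with \<open>a\<^sup>2\<close> has order \<open>1 / sqrt n\<close>.

  The bound depends on \<open>u\<close> only through the fourth moments of \<open>u'\<close> and \<open>u''\<close>, so it extends from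
  smooth functions to their limits in the Sobolev space (\<open>stein_bound_limit\<close>).
  Finally, \<open>a\<^sup>2\<close> has the right order because the variances converge to a positive limit: orthogonality
  of the Hermite polynomials gives \<open>E (g (X i) * g (X j)) = (\<Sum>m. m! * (c m)\<^sup>2 * \<rho> (j - i) ^ m)\<close>, and the averages
  of these numbers over \<open>i\<close> and \<open>j\<close> converge to the sum over all lags
  (\<open>hermite_expansion_covariance\<close>, \<open>toeplitz_average_tendsto\<close>, \<open>infsum_power_series_swap\<close>).
\<close>

section \<open>Joint laws are determined by characteristic functions\<close>

lemma (in prob_space) char_weighted:
  fixes Y w :: "'a \<Rightarrow> real"
  assumes [measurable]: "Y \<in> borel_measurable M" "w \<in> borel_measurable M"
    and w: "\<And>x. 0 \<le> w x" "integrable M w" and c: "c = (\<integral>x. w x \<partial>M)" "c > 0"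
  defines "D \<equiv> distr (density M (\<lambda>x. ennreal (w x / c))) borel Y"
  shows "real_distribution D"
    and "char D t = (1/c) *\<^sub>R (\<integral>x. w x *\<^sub>R iexp (t * Y x) \<partial>M)"
    and "B \<in> sets borel \<Longrightarrow> (\<integral>x. w x * indicator B (Y x) \<partial>M) = c * measure D B"
proof -
  define P where "P = density M (\<lambda>x. ennreal (w x / c))"
  have "emeasure P (space P) = (\<integral>\<^sup>+x. ennreal (w x / c) \<partial>M)"
    unfolding P_def by (subst emeasure_density) (auto simp: P_def intro!: nn_integral_cong)
  also have "\<dots> = ennreal (\<integral>x. w x / c \<partial>M)"
    using w c by (intro nn_integral_eq_integral) auto
  also have "\<dots> = 1" using c by simp
  finally have P: "prob_space P" by (rule prob_spaceI)
  have [measurable]: "Y \<in> borel_measurable P" by (simp add: P_def)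
  show "real_distribution D"
    using P unfolding D_def P_def[symmetric] by (auto intro!: prob_space.real_distribution_distr)
  have "char D t = (\<integral>x. iexp (t * Y x) \<partial>P)"
    unfolding D_def P_def[symmetric] char_def by (subst integral_distr) auto
  also have "\<dots> = (\<integral>x. (w x / c) *\<^sub>R iexp (t * Y x) \<partial>M)"
    unfolding P_def using w c by (subst integral_density) auto
  also have "\<dots> = (\<integral>x. (1/c) *\<^sub>R (w x *\<^sub>R iexp (t * Y x)) \<partial>M)"
    by (intro Bochner_Integration.integral_cong) auto
  also have "\<dots> = (1/c) *\<^sub>R (\<integral>x. w x *\<^sub>R iexp (t * Y x) \<partial>M)" by (rule integral_scaleR_right)
  finally show "char D t = (1/c) *\<^sub>R (\<integral>x. w x *\<^sub>R iexp (t * Y x) \<partial>M)" .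
  assume B[measurable]: "B \<in> sets borel"
  have "measure D B = (\<integral>x. indicator B x \<partial>D)" using B by (simp add: D_def)
  also have "\<dots> = (\<integral>x. indicator B (Y x) \<partial>P)"
    unfolding D_def P_def[symmetric] by (subst integral_distr) auto
  also have "\<dots> = (\<integral>x. w x / c * indicator B (Y x) \<partial>M)"
    unfolding P_def using w c by (simp add: integral_density)
  finally show "(\<integral>x. w x * indicator B (Y x) \<partial>M) = c * measure D B" using c(2) by simp
qed

text \<open>A bounded nonnegative weight turns the underlying measure, after normalisation, into another
  probability measure, so the one-dimensional uniqueness theorem applies to weighted laws as well.\<close>

lemma weighted_law_determined_by_char:
  fixes Y :: "'a \<Rightarrow> real" and Z :: "'b \<Rightarrow> real"
  assumes M: "prob_space M" and N: "prob_space N"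
    and m[measurable]: "Y \<in> borel_measurable M" "w \<in> borel_measurable M"
      "Z \<in> borel_measurable N" "v \<in> borel_measurable N" and B: "B \<in> sets borel"
    and w: "\<And>x. 0 \<le> w x" "\<And>x. w x \<le> (K::real)"
    and v: "\<And>x. 0 \<le> v x" "\<And>x. v x \<le> (K::real)"
    and eq: "\<And>t. (\<integral>x. w x *\<^sub>R iexp (t * Y x) \<partial>M) = (\<integral>x. v x *\<^sub>R iexp (t * Z x) \<partial>N)"
  shows "(\<integral>x. w x * indicator B (Y x) \<partial>M) = (\<integral>x. v x * indicator B (Z x) \<partial>N)"
proof -
  interpret M: prob_space M by fact
  interpret N: prob_space N by fact
  have iw: "integrable M w" using w by (intro M.integrable_const_bound[where B=K]) auto
  have iv: "integrable N v" using v by (intro N.integrable_const_bound[where B=K]) auto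
  define c where "c = (\<integral>x. w x \<partial>M)"
  have cv: "c = (\<integral>x. v x \<partial>N)"
    using eq[of 0] by (simp add: c_def scaleR_conv_of_real)
  show ?thesis
  proof (cases "c = 0")
    case True
    have "AE x in M. w x = 0" using True iw w c_def by (simp add: integral_nonneg_eq_0_iff_AE)
    moreover have "AE x in N. v x = 0" using True iv v cv by (simp add: integral_nonneg_eq_0_iff_AE)
    ultimately have "(\<integral>x. w x * indicator B (Y x) \<partial>M) = 0" "(\<integral>x. v x * indicator B (Z x) \<partial>N) = 0"
      by (auto intro!: integral_eq_zero_AE)
    then show ?thesis by simp
  next
    case False
    then have c: "c > 0" using w by (simp add: c_def order_less_le)
    note D = M.char_weighted[OF m(1,2) w(1) iw c_def c] N.char_weighted[OF m(3,4) v(1) iv cv c]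
    show ?thesis
      unfolding D(3)[OF B] D(6)[OF B] using D(2,5) eq by (subst Levy_uniqueness[OF D(1,4)]) auto
  qed
qed

text \<open>Complex weights are reduced to nonnegative ones: the real part of a weight of modulus at most
  1 becomes nonnegative after adding 1, and the law for the weight 1 is already known.\<close>

lemma weighted_law_Re:
  fixes Y :: "'a \<Rightarrow> real" and Z :: "'b \<Rightarrow> real"
  assumes M: "prob_space M" and N: "prob_space N"
    and m[measurable]: "Y \<in> borel_measurable M" "w \<in> borel_measurable M"
      "Z \<in> borel_measurable N" "v \<in> borel_measurable N" and B[measurable]: "B \<in> sets borel"
    and w: "\<And>x. cmod (w x) \<le> 1" and v: "\<And>x. cmod (v x) \<le> 1"
    and eq1: "\<And>t. (\<integral>x. iexp (t * Y x) \<partial>M) = (\<integral>x. iexp (t * Z x) \<partial>N)"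
    and eq: "\<And>t. (\<integral>x. w x * iexp (t * Y x) \<partial>M) = (\<integral>x. v x * iexp (t * Z x) \<partial>N)"
  shows "(\<integral>x. Re (w x) * indicator B (Y x) \<partial>M) = (\<integral>x. Re (v x) * indicator B (Z x) \<partial>N)"
proof -
  have split: "(\<integral>x. (Re (h x) + 1) *\<^sub>R iexp (t * U x) \<partial>L)
      = ((\<integral>x. h x * iexp (t * U x) \<partial>L) + cnj (\<integral>x. h x * iexp (- t * U x) \<partial>L)) / 2 + (\<integral>x. iexp (t * U x) \<partial>L)"
    and int: "integrable L (\<lambda>x. Re (h x) * indicator B (U x))" "integrable L (\<lambda>x. indicator B (U x) :: real)"
    if L: "prob_space L" and [measurable]: "h \<in> borel_measurable L" "U \<in> borel_measurable L" and h: "\<And>x. cmod (h x) \<le> 1"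
    for L :: "'c measure" and h U t
  proof -
    interpret prob_space L by fact
    have i: "integrable L (\<lambda>x. iexp (t * U x))" "integrable L (\<lambda>x. h x * iexp (t * U x))" for t
      by (rule integrable_const_bound[where B=1]; use h in \<open>auto simp: norm_mult\<close>)+
    have lin: "(\<integral>x. (f x + cnj (g x)) / 2 + k x \<partial>L) = ((\<integral>x. f x \<partial>L) + cnj (\<integral>x. g x \<partial>L)) / 2 + (\<integral>x. k x \<partial>L)"
      if "integrable L f" "integrable L g" "integrable L k" for f g k using that by simp
    have e: "(Re (h x) + 1) *\<^sub>R iexp (t * U x)
        = (h x * iexp (t * U x) + cnj (h x * iexp (- t * U x))) / 2 + iexp (t * U x)" for x
    proof -
      have "complex_of_real (Re (h x)) = (h x + cnj (h x)) / 2" by (simp add: complex_add_cnj)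
      then show ?thesis by (simp add: scaleR_conv_of_real exp_cnj algebra_simps add_divide_distrib)
    qed
    show "(\<integral>x. (Re (h x) + 1) *\<^sub>R iexp (t * U x) \<partial>L)
      = ((\<integral>x. h x * iexp (t * U x) \<partial>L) + cnj (\<integral>x. h x * iexp (- t * U x) \<partial>L)) / 2 + (\<integral>x. iexp (t * U x) \<partial>L)"
      unfolding e by (rule lin[OF i(2) i(2) i(1)])
    show "integrable L (\<lambda>x. Re (h x) * indicator B (U x))" "integrable L (\<lambda>x. indicator B (U x) :: real)"
      by (rule integrable_const_bound[where B=1];
          use h order_trans[OF abs_Re_le_cmod h] in \<open>auto simp: indicator_def\<close>)+
  qed
  have Re1: "0 \<le> Re z + 1" "Re z + 1 \<le> 2" if "cmod z \<le> 1" for z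
    using abs_Re_le_cmod[of z] that by linarith+
  have "(\<integral>x. (Re (w x) + 1) * indicator B (Y x) \<partial>M) = (\<integral>x. (Re (v x) + 1) * indicator B (Z x) \<partial>N)"
  proof (rule weighted_law_determined_by_char[OF M N, where K=2])
    show "(\<integral>x. (Re (w x) + 1) *\<^sub>R iexp (t * Y x) \<partial>M) = (\<integral>x. (Re (v x) + 1) *\<^sub>R iexp (t * Z x) \<partial>N)" for t
      unfolding split[OF M m(2,1) w] split[OF N m(4,3) v] eq eq1 ..
  qed (use Re1[OF w] Re1[OF v] in auto)
  moreover have "(\<integral>x. 1 * indicator B (Y x) \<partial>M) = (\<integral>x. 1 * indicator B (Z x) \<partial>N :: real)"
    by (rule weighted_law_determined_by_char[OF M N, where K=1]) (use eq1 in auto)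
  ultimately show ?thesis
    using int[OF M m(2,1) w] int[OF N m(4,3) v] by (simp add: distrib_right)
qed

lemma weighted_law_complex:
  fixes Y :: "'a \<Rightarrow> real" and Z :: "'b \<Rightarrow> real"
  assumes M: "prob_space M" and N: "prob_space N"
    and m[measurable]: "Y \<in> borel_measurable M" "w \<in> borel_measurable M"
      "Z \<in> borel_measurable N" "v \<in> borel_measurable N" and B[measurable]: "B \<in> sets borel"
    and w: "\<And>x. cmod (w x) \<le> 1" and v: "\<And>x. cmod (v x) \<le> 1"
    and eq1: "\<And>t. (\<integral>x. iexp (t * Y x) \<partial>M) = (\<integral>x. iexp (t * Z x) \<partial>N)"
    and eq: "\<And>t. (\<integral>x. w x * iexp (t * Y x) \<partial>M) = (\<integral>x. v x * iexp (t * Z x) \<partial>N)"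
  shows "(\<integral>x. w x * of_bool (Y x \<in> B) \<partial>M) = (\<integral>x. v x * of_bool (Z x \<in> B) \<partial>N)"
proof (rule complex_eqI)
  have int: "integrable L (\<lambda>x. h x * of_bool (U x \<in> B))"
    if L: "prob_space L" and [measurable]: "h \<in> borel_measurable L" "U \<in> borel_measurable L" and h: "\<And>x. cmod (h x) \<le> 1"
    for L :: "'c measure" and h :: "'c \<Rightarrow> complex" and U
  proof -
    interpret prob_space L by fact
    show ?thesis by (rule integrable_const_bound[where B=1]) (use h in \<open>auto simp: norm_mult\<close>)
  qed
  note iM = int[OF M m(2,1) w] and iN = int[OF N m(4,3) v]
  have Re: "Re (a * of_bool P) = Re a * of_bool P" and Im: "Im (a * of_bool P) = Re (- \<i> * a) * of_bool P"
    for a :: complex and P by (simp_all add: of_bool_def)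
  show "Re (\<integral>x. w x * of_bool (Y x \<in> B) \<partial>M) = Re (\<integral>x. v x * of_bool (Z x \<in> B) \<partial>N)"
    using weighted_law_Re[OF M N m B w v eq1 eq] iM iN
    by (simp only: integral_Re[symmetric] Re indicator_def)
  have "(\<integral>x. Re (- \<i> * w x) * indicator B (Y x) \<partial>M) = (\<integral>x. Re (- \<i> * v x) * indicator B (Z x) \<partial>N)"
  proof (rule weighted_law_Re[OF M N m(1) _ m(3) _ B _ _ eq1])
    show "(\<integral>x. - \<i> * w x * iexp (t * Y x) \<partial>M) = (\<integral>x. - \<i> * v x * iexp (t * Z x) \<partial>N)" for t
      using eq[of t] by (simp add: mult.assoc)
  qed (use w v in \<open>auto simp: norm_mult\<close>)
  then show "Im (\<integral>x. w x * of_bool (Y x \<in> B) \<partial>M) = Im (\<integral>x. v x * of_bool (Z x \<in> B) \<partial>N)"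
    using iM iN by (simp only: integral_Im[symmetric] Im indicator_def)
qed

text \<open>The exponential factors are traded one coordinate at a time for indicators: with every factor
  except the one of the coordinate \<open>j\<close> treated as a weight, the identity for all frequencies of
  \<open>V j\<close> says that the weighted laws of \<open>V j\<close> and \<open>W j\<close> have the same characteristic function.\<close>

lemma box_probabilities_step:
  fixes V :: "'i \<Rightarrow> 'a \<Rightarrow> real" and W :: "'i \<Rightarrow> 'b \<Rightarrow> real"
  assumes M: "prob_space M" and N: "prob_space N" and I: "finite I"
    and V[measurable]: "\<And>i. i \<in> I \<Longrightarrow> V i \<in> borel_measurable M"
    and W[measurable]: "\<And>i. i \<in> I \<Longrightarrow> W i \<in> borel_measurable N"
    and eq: "\<And>a. (\<integral>x. iexp (\<Sum>i\<in>I. a i * V i x) \<partial>M) = (\<integral>x. iexp (\<Sum>i\<in>I. a i * W i x) \<partial>N)"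
    and J: "J \<subseteq> I" and B: "\<And>i. i \<in> I \<Longrightarrow> B i \<in> sets borel"
  shows "(\<integral>x. of_bool (\<forall>j\<in>J. V j x \<in> B j) * iexp (\<Sum>i\<in>I-J. a i * V i x) \<partial>M)
       = (\<integral>x. of_bool (\<forall>j\<in>J. W j x \<in> B j) * iexp (\<Sum>i\<in>I-J. a i * W i x) \<partial>N)"
  using finite_subset[OF J I] J
proof (induction J arbitrary: a rule: finite_induct)
  case empty
  then show ?case using eq by simp
next
  case (insert j J)
  let ?R = "I - insert j J"
  have jI: "j \<in> I" and J: "finite J" "J \<subseteq> I" using insert by auto
  have IJ: "I - J = insert j ?R" "finite ?R" using jI insert I by auto
  have shift: "(\<Sum>i\<in>I-J. (if i = j then t else a i) * f i) = t * f j + (\<Sum>i\<in>?R. a i * f i)" for t and f :: "'i \<Rightarrow> real"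
    unfolding IJ using IJ(2) by (auto intro!: sum.cong)
  define w where "w y = of_bool (\<forall>j\<in>J. y j \<in> B j) * iexp (\<Sum>i\<in>?R. a i * y i)" for y :: "'i \<Rightarrow> real"
  have w1: "cmod (w y) \<le> 1" for y by (simp add: w_def norm_mult)
  have mw: "(\<lambda>x. w (\<lambda>i. U i x)) \<in> borel_measurable L" if U: "\<And>i. i \<in> I \<Longrightarrow> U i \<in> borel_measurable L" for U and L :: "'c measure"
  proof -
    have "Measurable.pred L (\<lambda>x. \<forall>j\<in>J. U j x \<in> B j)"
      using J U B by (intro pred_intros_finite(3)[OF J(1)] pred_sets2[OF _ U]) auto
    moreover have "(\<lambda>x. \<Sum>i\<in>?R. a i * U i x) \<in> borel_measurable L"
      using U by (intro borel_measurable_sum borel_measurable_times) auto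
    ultimately show ?thesis unfolding w_def[abs_def] by measurable
  qed
  have wexp: "w y * iexp (t * y j)
      = of_bool (\<forall>j\<in>J. y j \<in> B j) * iexp (\<Sum>i\<in>I-J. (if i = j then t else a i) * y i)" for y t
    unfolding w_def shift by (simp add: exp_add ring_distribs mult_ac)
  have single: "(\<Sum>i\<in>I. (if i = j then t else 0) * f i) = t * f j" for t and f :: "'i \<Rightarrow> real"
  proof -
    have "(if i = j then t else 0) * f i = (if i = j then t * f j else 0)" for i by simp
    then show ?thesis using jI I by simp
  qed
  have "(\<integral>x. w (\<lambda>i. V i x) * of_bool (V j x \<in> B j) \<partial>M) = (\<integral>x. w (\<lambda>i. W i x) * of_bool (W j x \<in> B j) \<partial>N)"
  proof (rule weighted_law_complex[OF M N V[OF jI] mw[OF V] W[OF jI] mw[OF W] B[OF jI] w1 w1])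
    show "(\<integral>x. iexp (t * V j x) \<partial>M) = (\<integral>x. iexp (t * W j x) \<partial>N)" for t
      using eq[of "\<lambda>i. if i = j then t else 0"] unfolding single .
    show "(\<integral>x. w (\<lambda>i. V i x) * iexp (t * V j x) \<partial>M) = (\<integral>x. w (\<lambda>i. W i x) * iexp (t * W j x) \<partial>N)" for t
      by (simp only: wexp[of "\<lambda>i. V i x" t for x] wexp[of "\<lambda>i. W i x" t for x] insert.IH[OF J(2)])
  qed
  then show ?case by (simp add: w_def of_bool_conj mult_ac)
qed

abbreviation joint_law :: "'a measure \<Rightarrow> 'i set \<Rightarrow> ('i \<Rightarrow> 'a \<Rightarrow> real) \<Rightarrow> ('i \<Rightarrow> real) measure" where
  "joint_law M I V \<equiv> distr M (Pi\<^sub>M I (\<lambda>_. borel)) (\<lambda>x. \<lambda>i\<in>I. V i x)"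

theorem joint_law_determined_by_char:
  fixes V :: "'i \<Rightarrow> 'a \<Rightarrow> real" and W :: "'i \<Rightarrow> 'b \<Rightarrow> real"
  assumes M: "prob_space M" and N: "prob_space N" and I: "finite I"
    and V[measurable]: "\<And>i. i \<in> I \<Longrightarrow> V i \<in> borel_measurable M"
    and W[measurable]: "\<And>i. i \<in> I \<Longrightarrow> W i \<in> borel_measurable N"
    and eq: "\<And>a. (\<integral>x. iexp (\<Sum>i\<in>I. a i * V i x) \<partial>M) = (\<integral>x. iexp (\<Sum>i\<in>I. a i * W i x) \<partial>N)"
  shows "joint_law M I V = joint_law N I W" (is "?P = ?Q")
proof (rule measure_eqI_PiM_finite[OF I])
  interpret M: prob_space M by fact
  interpret N: prob_space N by fact
  have mV: "(\<lambda>x. \<lambda>i\<in>I. V i x) \<in> M \<rightarrow>\<^sub>M Pi\<^sub>M I (\<lambda>_. borel)" by measurable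
  have mW: "(\<lambda>x. \<lambda>i\<in>I. W i x) \<in> N \<rightarrow>\<^sub>M Pi\<^sub>M I (\<lambda>_. borel)" by measurable
  have fin: "finite_measure ?P" "finite_measure ?Q"
    using M.prob_space_distr[OF mV] N.prob_space_distr[OF mW] by (simp_all add: prob_space_def)
  show "sets ?P = sets (Pi\<^sub>M I (\<lambda>_. borel))" "sets ?Q = sets (Pi\<^sub>M I (\<lambda>_. borel))" by simp_all
  {
    fix A :: "'i \<Rightarrow> real set" assume A: "\<And>i. i \<in> I \<Longrightarrow> A i \<in> sets borel"
    have PA: "Pi\<^sub>E I A \<in> sets (Pi\<^sub>M I (\<lambda>_. borel))" using A I by (intro sets_PiM_I_finite) auto
    have box: "complex_of_real (measure (joint_law L I U) (Pi\<^sub>E I A))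
        = (\<integral>x. of_bool (\<forall>j\<in>I. U j x \<in> A j) * iexp (\<Sum>i\<in>I-I. 0 * U i x) \<partial>L)"
      if U: "(\<lambda>x. \<lambda>i\<in>I. U i x) \<in> L \<rightarrow>\<^sub>M Pi\<^sub>M I (\<lambda>_. borel)" for L :: "'c measure" and U
    proof -
      have "complex_of_real (measure (joint_law L I U) (Pi\<^sub>E I A))
          = (\<integral>y. complex_of_real (indicator (Pi\<^sub>E I A) y) \<partial>joint_law L I U)"
        using PA by (subst integral_complex_of_real) simp
      also have "\<dots> = (\<integral>x. complex_of_real (indicator (Pi\<^sub>E I A) (\<lambda>i\<in>I. U i x)) \<partial>L)"
        using PA by (intro integral_distr[OF U]) simp
      also have "\<dots> = (\<integral>x. of_bool (\<forall>j\<in>I. U j x \<in> A j) * iexp (\<Sum>i\<in>I-I. 0 * U i x) \<partial>L)"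
        by (intro Bochner_Integration.integral_cong) (auto simp: indicator_def PiE_iff)
      finally show ?thesis .
    qed
    have "complex_of_real (measure ?P (Pi\<^sub>E I A)) = complex_of_real (measure ?Q (Pi\<^sub>E I A))"
      unfolding box[OF mV] box[OF mW] by (rule box_probabilities_step[OF M N I V W eq order_refl A])
    then show "emeasure ?P (Pi\<^sub>E I A) = emeasure ?Q (Pi\<^sub>E I A)"
      using fin by (simp add: finite_measure.emeasure_eq_measure)
  }
  define A where "A n = (\<Pi>\<^sub>E i\<in>I. UNIV :: real set)" for n :: nat
  show "range A \<subseteq> prod_algebra I (\<lambda>_. borel)" "(\<Union>i. A i) = space (Pi\<^sub>M I (\<lambda>_. borel))"
    using I by (auto simp: A_def space_PiM intro!: prod_algebraI_finite)
  show "emeasure ?P (A n) \<noteq> \<infinity>" for n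
    using fin by (simp add: finite_measure.emeasure_finite)
qed

section \<open>Square-integrable functions\<close>

lemma continuous_on_of_derivative:
  "(\<And>x. (f has_real_derivative f' x) (at x)) \<Longrightarrow> continuous_on UNIV f"
  by (meson DERIV_continuous_on has_field_derivative_at_within)

lemma two_abs_mult_le: "2 * \<bar>a * b\<bar> \<le> a\<^sup>2 + b\<^sup>2" for a b :: real
  using zero_le_power2[of "\<bar>a\<bar> - \<bar>b\<bar>"] by (simp add: power2_diff abs_mult)

definition square_integrable :: "'a measure \<Rightarrow> ('a \<Rightarrow> real) \<Rightarrow> bool" where
  "square_integrable M f \<longleftrightarrow> f \<in> borel_measurable M \<and> integrable M (\<lambda>x. (f x)\<^sup>2)"

lemma square_integrable_mult:
  assumes "square_integrable M f" "square_integrable M g"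
  shows "integrable M (\<lambda>x. f x * g x)"
proof (rule Bochner_Integration.integrable_bound)
  show "integrable M (\<lambda>x. (f x)\<^sup>2 + (g x)\<^sup>2)" using assms by (auto simp: square_integrable_def)
  have "\<bar>a * b\<bar> \<le> a\<^sup>2 + b\<^sup>2" for a b :: real
    using two_abs_mult_le[of a b] abs_ge_zero[of "a * b"] by linarith
  then show "AE x in M. norm (f x * g x) \<le> norm ((f x)\<^sup>2 + (g x)\<^sup>2)" by auto
qed (use assms in \<open>auto simp: square_integrable_def\<close>)

lemma square_integrable_add:
  assumes "square_integrable M f" "square_integrable M g"
  shows "square_integrable M (\<lambda>x. f x + g x)"
  using square_integrable_mult[OF assms] assms by (auto simp: square_integrable_def power2_sum mult.assoc)

lemma square_integrable_cmult: "square_integrable M f \<Longrightarrow> square_integrable M (\<lambda>x. c * f x)"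
  by (auto simp: square_integrable_def power_mult_distrib)

lemma square_integrable_diff:
  assumes "square_integrable M f" "square_integrable M g"
  shows "square_integrable M (\<lambda>x. f x - g x)"
  using square_integrable_add[OF assms(1) square_integrable_cmult[OF assms(2), of "-1"]] by simp

lemma square_integrable_sum:
  "(\<And>i. i \<in> A \<Longrightarrow> square_integrable M (f i)) \<Longrightarrow> square_integrable M (\<lambda>x. \<Sum>i\<in>A. f i x)"
  by (induction A rule: infinite_finite_induct) (auto intro: square_integrable_add simp: square_integrable_def[of M "\<lambda>x. 0"])

lemma integral_Cauchy_Schwarz:
  assumes f: "square_integrable M f" and g: "square_integrable M g"
  shows "\<bar>\<integral>x. f x * g x \<partial>M\<bar> \<le> sqrt ((\<integral>x. (f x)\<^sup>2 \<partial>M) * (\<integral>x. (g x)\<^sup>2 \<partial>M))"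
proof -
  define A where "A = (\<integral>x. (f x)\<^sup>2 \<partial>M)"
  define B where "B = (\<integral>x. (g x)\<^sup>2 \<partial>M)"
  define C where "C = (\<integral>x. f x * g x \<partial>M)"
  note fg = square_integrable_mult[OF f g]
  have i: "integrable M (\<lambda>x. (f x)\<^sup>2)" "integrable M (\<lambda>x. (g x)\<^sup>2)" using f g by (auto simp: square_integrable_def)
  have AB: "0 \<le> A" "0 \<le> B" by (auto simp: A_def B_def)
  have "C\<^sup>2 \<le> A * B"
  proof -
    have q: "0 \<le> t\<^sup>2 * A - 2 * t * C + B" for t
    proof -
      have "0 \<le> (\<integral>x. (t * f x - g x)\<^sup>2 \<partial>M)" by simp
      also have "\<dots> = (\<integral>x. t\<^sup>2 * (f x)\<^sup>2 - 2 * t * (f x * g x) + (g x)\<^sup>2 \<partial>M)"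
        by (simp add: power2_diff power_mult_distrib algebra_simps)
      also have "\<dots> = t\<^sup>2 * A - 2 * t * C + B" using i fg by (simp add: A_def B_def C_def)
      finally show ?thesis .
    qed
    show ?thesis
    proof (cases "A = 0")
      case True
      have "C = 0"
      proof (rule ccontr)
        assume "C \<noteq> 0"
        then have "2 * ((B + 1) / (2 * C)) * C = B + 1" by simp
        then show False using q[of "(B + 1) / (2 * C)"] True by simp
      qed
      then show ?thesis using True by simp
    next
      case False
      then have A: "A > 0" using AB by simp
      have "(C / A)\<^sup>2 * A - 2 * (C / A) * C + B = B - C\<^sup>2 / A"
        using A by (simp add: power2_eq_square field_simps)
      then have "C\<^sup>2 / A \<le> B" using q[of "C / A"] by simp
      then show ?thesis using A by (simp add: field_simps)
    qed
  qed
  then have "sqrt (C\<^sup>2) \<le> sqrt (A * B)" by (rule real_sqrt_le_mono)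
  then show ?thesis by (simp add: A_def B_def C_def)
qed

text \<open>The common tool behind all limits of second moments below: convergence of variances along
  approximating sequences, and the computation of covariances from Hermite expansions.\<close>

lemma L2_product_tendsto:
  assumes F: "\<And>n. square_integrable M (F n)" and G: "\<And>n. square_integrable M (G n)"
    and f: "square_integrable M f" and g: "square_integrable M g"
    and lF: "(\<lambda>n. \<integral>x. (F n x - f x)\<^sup>2 \<partial>M) \<longlonglongrightarrow> 0" and lG: "(\<lambda>n. \<integral>x. (G n x - g x)\<^sup>2 \<partial>M) \<longlonglongrightarrow> 0"
  shows "(\<lambda>n. \<integral>x. F n x * G n x \<partial>M) \<longlonglongrightarrow> (\<integral>x. f x * g x \<partial>M)"
proof -
  define a where "a n = (\<integral>x. (F n x - f x)\<^sup>2 \<partial>M)" for n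
  define b where "b n = (\<integral>x. (G n x - g x)\<^sup>2 \<partial>M)" for n
  define A where "A = (\<integral>x. (f x)\<^sup>2 \<partial>M)"
  define B where "B = (\<integral>x. (g x)\<^sup>2 \<partial>M)"
  have bound: "\<bar>(\<integral>x. F n x * G n x \<partial>M) - (\<integral>x. f x * g x \<partial>M)\<bar> \<le> sqrt (a n * b n) + sqrt (A * b n) + sqrt (a n * B)" for n
  proof -
    note dF = square_integrable_diff[OF F[of n] f] and dG = square_integrable_diff[OF G[of n] g]
    have "(\<integral>x. F n x * G n x \<partial>M) - (\<integral>x. f x * g x \<partial>M)
      = (\<integral>x. F n x * G n x - f x * g x \<partial>M)"
      using square_integrable_mult[OF F G] square_integrable_mult[OF f g] by simp
    also have "\<dots> = (\<integral>x. (F n x - f x) * (G n x - g x) + f x * (G n x - g x) + (F n x - f x) * g x \<partial>M)"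
      by (simp add: algebra_simps)
    also have "\<dots> = (\<integral>x. (F n x - f x) * (G n x - g x) \<partial>M) + (\<integral>x. f x * (G n x - g x) \<partial>M) + (\<integral>x. (F n x - f x) * g x \<partial>M)"
      using square_integrable_mult[OF dF dG] square_integrable_mult[OF f dG] square_integrable_mult[OF dF g] by simp
    finally show ?thesis
      using integral_Cauchy_Schwarz[OF dF dG] integral_Cauchy_Schwarz[OF f dG] integral_Cauchy_Schwarz[OF dF g]
      unfolding a_def b_def A_def B_def by linarith
  qed
  have "(\<lambda>n. sqrt (a n * b n) + sqrt (A * b n) + sqrt (a n * B)) \<longlonglongrightarrow> sqrt (0 * 0) + sqrt (A * 0) + sqrt (0 * B)"
    unfolding a_def b_def by (intro tendsto_intros lF lG)
  then have "(\<lambda>n. sqrt (a n * b n) + sqrt (A * b n) + sqrt (a n * B)) \<longlonglongrightarrow> 0" by simp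
  then have "(\<lambda>n. (\<integral>x. F n x * G n x \<partial>M) - (\<integral>x. f x * g x \<partial>M)) \<longlonglongrightarrow> 0"
    by (rule Lim_null_comparison[rotated]) (use bound in simp)
  then show ?thesis by (simp add: LIM_zero_iff)
qed

section \<open>The standard Gaussian measure\<close>

lemma prob_space_gauss: "prob_space gauss"
  unfolding gauss_def using prob_space_normal_density by simp

lemma sets_gauss[simp, measurable_cong]: "sets gauss = sets borel" by (simp add: gauss_def)
lemma space_gauss[simp]: "space gauss = UNIV" by (simp add: gauss_def)

lemma integral_gauss: "f \<in> borel_measurable borel \<Longrightarrow> (\<integral>x. f x \<partial>gauss) = (\<integral>x. std_normal_density x * (f x::real) \<partial>lborel)"
  unfolding gauss_def by (subst integral_density) auto

lemma integrable_gauss: "f \<in> borel_measurable borel \<Longrightarrow> integrable gauss f \<longleftrightarrow> integrable lborel (\<lambda>x. std_normal_density x * (f x::real))"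
  unfolding gauss_def by (subst integrable_density) auto

lemma integrable_gauss_power: "integrable gauss (\<lambda>x. x ^ k)"
  by (simp add: integrable_gauss integrable_std_normal_moment)

lemma std_normal_density_deriv: "(std_normal_density has_real_derivative (- x * std_normal_density x)) (at x)"
proof -
  define c where "c = 1 / sqrt (2 * pi)"
  have "((\<lambda>x. c * exp (- x\<^sup>2 / 2)) has_real_derivative (- x * (c * exp (- x\<^sup>2 / 2)))) (at x)"
    by (auto intro!: derivative_eq_intros simp: power2_eq_square)
  then show ?thesis unfolding std_normal_density_def c_def .
qed

text \<open>The derivative of \<open>\<phi> x * std_normal_density x\<close> is
  \<open>(\<phi>' x - x * \<phi> x) * std_normal_density x\<close>, and the boundary terms vanish.\<close>

lemma gauss_ibp_1d:
  assumes d: "\<And>x. (\<phi> has_real_derivative \<phi>' x) (at x)" and c: "continuous_on UNIV \<phi>'"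
    and i: "integrable gauss (\<lambda>x. x * \<phi> x)" "integrable gauss \<phi>'"
    and l: "((\<lambda>x. \<phi> x * std_normal_density x) \<longlongrightarrow> 0) at_top" "((\<lambda>x. \<phi> x * std_normal_density x) \<longlongrightarrow> 0) at_bot"
  shows "(\<integral>x. x * \<phi> x \<partial>gauss) = (\<integral>x. \<phi>' x \<partial>gauss)"
proof -
  have cphi: "continuous_on UNIV \<phi>" using d by (rule continuous_on_of_derivative)
  have [measurable]: "\<phi> \<in> borel_measurable borel" "\<phi>' \<in> borel_measurable borel"
    using c cphi by (auto intro: borel_measurable_continuous_onI)
  have cs: "isCont std_normal_density x" for x using std_normal_density_deriv DERIV_isCont by blast
  define f where "f x = std_normal_density x * \<phi>' x - std_normal_density x * (x * \<phi> x)" for x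
  have ii: "integrable lborel (\<lambda>x. std_normal_density x * \<phi>' x)" "integrable lborel (\<lambda>x. std_normal_density x * (x * \<phi> x))"
    using i by (simp_all add: integrable_gauss)
  have intf: "integrable lborel f" unfolding f_def using ii by (rule Bochner_Integration.integrable_diff)
  have "(LBINT x=-\<infinity>..\<infinity>. f x) = 0 - 0"
  proof (rule interval_integral_FTC_integrable[where F="\<lambda>x. \<phi> x * std_normal_density x"])
    show "((\<lambda>x. \<phi> x * std_normal_density x) has_vector_derivative f x) (at x)" for x
      using DERIV_mult[OF d[of x] std_normal_density_deriv[of x]]
      by (simp add: has_real_derivative_iff_has_vector_derivative f_def algebra_simps)
    show "isCont f x" for x unfolding f_def
      using c cphi cs by (intro continuous_intros) (auto simp: continuous_on_eq_continuous_at)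
    show "set_integrable lborel (einterval (-\<infinity>) \<infinity>) f"
      using intf by (simp add: set_integrable_def)
  qed (use l in \<open>auto simp: ereal_tendsto_simps1 ereal_tendsto_simps2\<close>)
  then have "(\<integral>x. f x \<partial>lborel) = 0"
    by (simp add: interval_lebesgue_integral_def set_lebesgue_integral_def)
  then have "(\<integral>x. std_normal_density x * \<phi>' x \<partial>lborel) = (\<integral>x. std_normal_density x * (x * \<phi> x) \<partial>lborel)"
    unfolding f_def using ii by simp
  then show ?thesis by (simp add: integral_gauss)
qed

section \<open>Gaussian vectors\<close>

text \<open>The characteristic function at 1 is enough: a Gaussian vector is required to have this property
  for all its linear combinations, hence in particular for all their multiples. A variable that
  vanishes almost everywhere qualifies, with variance 0, so linearly dependent coordinates cause no trouble.\<close>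

definition centred_gaussian :: "'a measure \<Rightarrow> ('a \<Rightarrow> real) \<Rightarrow> bool" where
  "centred_gaussian M Y \<longleftrightarrow> Y \<in> borel_measurable M \<and> integrable M (\<lambda>x. (Y x)\<^sup>2) \<and> (\<integral>x. Y x \<partial>M) = 0 \<and>
     (\<integral>x. iexp (Y x) \<partial>M) = complex_of_real (exp (- (\<integral>x. (Y x)\<^sup>2 \<partial>M) / 2))"

definition gaussian_vector :: "'a measure \<Rightarrow> 'i set \<Rightarrow> ('i \<Rightarrow> 'a \<Rightarrow> real) \<Rightarrow> bool" where
  "gaussian_vector M I V \<longleftrightarrow> prob_space M \<and> finite I \<and> (\<forall>a. centred_gaussian M (\<lambda>x. \<Sum>i\<in>I. a i * V i x))"

lemma gaussian_vectorD:
  assumes "gaussian_vector M I V"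
  shows "prob_space M" "finite I" "centred_gaussian M (\<lambda>x. \<Sum>i\<in>I. a i * V i x)"
    "i \<in> I \<Longrightarrow> centred_gaussian M (V i)" "i \<in> I \<Longrightarrow> V i \<in> borel_measurable M"
    "i \<in> I \<Longrightarrow> integrable M (\<lambda>x. (V i x)\<^sup>2)" "i \<in> I \<Longrightarrow> integrable M (V i)"
    "i \<in> I \<Longrightarrow> j \<in> I \<Longrightarrow> integrable M (\<lambda>x. V i x * V j x)"
    "integrable M (\<lambda>x. \<Sum>i\<in>I. a i * V i x)"
    "integrable M (\<lambda>x. (\<Sum>i\<in>I. a i * V i x)\<^sup>2)"
proof -
  show *: "prob_space M" "finite I" and c: "centred_gaussian M (\<lambda>x. \<Sum>i\<in>I. a i * V i x)" for a
    using assms by (auto simp: gaussian_vector_def)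
  interpret prob_space M by fact
  have s: "(\<Sum>k\<in>I. (if k = i then 1 else 0) * V k x) = V i x" if "i \<in> I" for i x
  proof -
    have "(if k = i then 1 else 0) * V k x = (if k = i then V i x else 0)" for k by simp
    then show ?thesis using that *(2) by simp
  qed
  show c1: "centred_gaussian M (V i)" if "i \<in> I" for i
    using c[of "\<lambda>k. if k = i then 1 else 0"] that by (simp add: s[OF that])
  show m[measurable]: "V i \<in> borel_measurable M" if "i \<in> I" for i using c1[OF that] by (simp add: centred_gaussian_def)
  show i2: "integrable M (\<lambda>x. (V i x)\<^sup>2)" if "i \<in> I" for i using c1[OF that] by (simp add: centred_gaussian_def)
  show i1: "integrable M (V i)" if "i \<in> I" for i
    by (rule square_integrable_imp_integrable[OF m[OF that] i2[OF that]])
  show "integrable M (\<lambda>x. V i x * V j x)" if "i \<in> I" "j \<in> I" for i j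
    by (rule square_integrable_mult) (use m i2 that in \<open>auto simp: square_integrable_def\<close>)
  show "integrable M (\<lambda>x. \<Sum>i\<in>I. a i * V i x)"
    by (intro Bochner_Integration.integrable_sum Bochner_Integration.integrable_mult_right i1 impI)
  show "integrable M (\<lambda>x. (\<Sum>i\<in>I. a i * V i x)\<^sup>2)" using c by (simp add: centred_gaussian_def)
qed

lemma gaussian_vector_gauss: "gaussian_vector gauss {()} (\<lambda>_ x. x)"
proof -
  interpret prob_space gauss by (rule prob_space_gauss)
  have sq: "(\<integral>x. (t * x)\<^sup>2 \<partial>gauss) = t\<^sup>2" for t :: real
    using integral_std_normal_moment_even[of 1]
    by (simp add: power_mult_distrib integral_gauss)
  have "(\<integral>x. iexp (t * x) \<partial>gauss) = complex_of_real (exp (- t\<^sup>2 / 2))" for t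
    using fun_cong[OF char_std_normal_distribution, of t] by (simp add: char_def gauss_def)
  moreover have "(\<integral>x. x \<partial>gauss) = 0" using integral_std_normal_moment_odd[of 0] by (simp add: integral_gauss)
  ultimately show ?thesis
    unfolding gaussian_vector_def centred_gaussian_def
    using prob_space_gauss integrable_gauss_power[of 2] sq[of 1] by (auto simp: power_mult_distrib)
qed

text \<open>Functions of the two factors of a product space are independent. Taking one of them to be 1
  shows that the factors keep their laws, which is how the lemma is mostly used.\<close>

lemma integral_product_fun:
  fixes f :: "'a \<Rightarrow> 'c::{real_normed_field, banach, second_countable_topology}" and g :: "'b \<Rightarrow> 'c"
  assumes M: "prob_space M" and N: "prob_space N" and f: "integrable M f" and g: "integrable N g"
  shows "integrable (M \<Otimes>\<^sub>M N) (\<lambda>\<omega>. f (fst \<omega>) * g (snd \<omega>))"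
    and "(\<integral>\<omega>. f (fst \<omega>) * g (snd \<omega>) \<partial>(M \<Otimes>\<^sub>M N)) = (\<integral>x. f x \<partial>M) * (\<integral>y. g y \<partial>N)"
proof -
  interpret M: prob_space M by fact
  interpret N: prob_space N by fact
  interpret P: pair_prob_space M N ..
  have [measurable]: "f \<in> borel_measurable M" "g \<in> borel_measurable N" using f g by auto
  show i: "integrable (M \<Otimes>\<^sub>M N) (\<lambda>\<omega>. f (fst \<omega>) * g (snd \<omega>))"
    by (rule P.Fubini_integrable) (use f g in \<open>auto simp: norm_mult\<close>)
  show "(\<integral>\<omega>. f (fst \<omega>) * g (snd \<omega>) \<partial>(M \<Otimes>\<^sub>M N)) = (\<integral>x. f x \<partial>M) * (\<integral>y. g y \<partial>N)"
    using P.integral_fst'[OF i, symmetric] f g by simp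
qed

lemma centred_gaussian_pair:
  assumes M: "prob_space M" and N: "prob_space N" and Y: "centred_gaussian M Y" and Z: "centred_gaussian N Z"
  shows "centred_gaussian (M \<Otimes>\<^sub>M N) (\<lambda>\<omega>. Y (fst \<omega>) + Z (snd \<omega>))"
    and "(\<integral>\<omega>. (Y (fst \<omega>) + Z (snd \<omega>))\<^sup>2 \<partial>(M \<Otimes>\<^sub>M N)) = (\<integral>x. (Y x)\<^sup>2 \<partial>M) + (\<integral>x. (Z x)\<^sup>2 \<partial>N)"
proof -
  interpret M: prob_space M by fact
  interpret N: prob_space N by fact
  interpret P: pair_prob_space M N ..
  have [measurable]: "Y \<in> borel_measurable M" "Z \<in> borel_measurable N"
    and sq: "integrable M (\<lambda>x. (Y x)\<^sup>2)" "integrable N (\<lambda>x. (Z x)\<^sup>2)"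
    and e: "(\<integral>x. Y x \<partial>M) = 0" "(\<integral>x. Z x \<partial>N) = 0"
    using Y Z by (auto simp: centred_gaussian_def)
  have iY: "integrable M Y" and iZ: "integrable N Z"
    using sq by (auto intro: M.square_integrable_imp_integrable N.square_integrable_imp_integrable)
  note P = integral_product_fun[OF M.prob_space_axioms N.prob_space_axioms]
  have i1: "integrable (M \<Otimes>\<^sub>M N) (\<lambda>\<omega>. f (fst \<omega>))" and e1: "(\<integral>\<omega>. f (fst \<omega>) \<partial>(M \<Otimes>\<^sub>M N)) = (\<integral>x. f x \<partial>M)"
    if "integrable M f" for f :: "_ \<Rightarrow> real"
    using P[OF that, of "\<lambda>_. 1"] by (simp_all add: N.prob_space)
  have i2: "integrable (M \<Otimes>\<^sub>M N) (\<lambda>\<omega>. f (snd \<omega>))" and e2: "(\<integral>\<omega>. f (snd \<omega>) \<partial>(M \<Otimes>\<^sub>M N)) = (\<integral>x. f x \<partial>N)"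
    if "integrable N f" for f :: "_ \<Rightarrow> real"
    using P[OF _ that, of "\<lambda>_. 1"] by (simp_all add: M.prob_space)
  have ip: "integrable (M \<Otimes>\<^sub>M N) (\<lambda>\<omega>. Y (fst \<omega>) * Z (snd \<omega>))"
    and ep: "(\<integral>\<omega>. Y (fst \<omega>) * Z (snd \<omega>) \<partial>(M \<Otimes>\<^sub>M N)) = 0"
    using P[OF iY iZ] e by auto
  have ex: "(Y (fst \<omega>) + Z (snd \<omega>))\<^sup>2 = (Y (fst \<omega>))\<^sup>2 + (Z (snd \<omega>))\<^sup>2 + 2 * (Y (fst \<omega>) * Z (snd \<omega>))" for \<omega>
    by (simp add: power2_sum)
  show v: "(\<integral>\<omega>. (Y (fst \<omega>) + Z (snd \<omega>))\<^sup>2 \<partial>(M \<Otimes>\<^sub>M N)) = (\<integral>x. (Y x)\<^sup>2 \<partial>M) + (\<integral>x. (Z x)\<^sup>2 \<partial>N)"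
    unfolding ex using i1[OF sq(1)] i2[OF sq(2)] ip ep e1[OF sq(1)] e2[OF sq(2)] by simp
  have "(\<integral>\<omega>. iexp (Y (fst \<omega>) + Z (snd \<omega>)) \<partial>(M \<Otimes>\<^sub>M N)) = (\<integral>x. iexp (Y x) \<partial>M) * (\<integral>x. iexp (Z x) \<partial>N)"
    using P(2)[of "\<lambda>x. iexp (Y x)" "\<lambda>x. iexp (Z x)"] by (simp add: exp_add ring_distribs M.integrable_iexp N.integrable_iexp)
  then show "centred_gaussian (M \<Otimes>\<^sub>M N) (\<lambda>\<omega>. Y (fst \<omega>) + Z (snd \<omega>))"
    unfolding centred_gaussian_def v using i1[OF sq(1)] i2[OF sq(2)] ip i1[OF iY] i2[OF iZ] e e1[OF iY] e2[OF iZ] Y Z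
    by (auto simp: ex centred_gaussian_def exp_add[symmetric] simp flip: of_real_mult)
qed

text \<open>All Gaussian vectors that occur are linear images of a pair of independent ones. The second
  moments of linear combinations are recorded because they determine the law.\<close>

lemma gaussian_vector_pair:
  assumes V: "gaussian_vector M I V" and W: "gaussian_vector N J W" and K: "finite K"
  shows "gaussian_vector (M \<Otimes>\<^sub>M N) K (\<lambda>k \<omega>. (\<Sum>i\<in>I. A k i * V i (fst \<omega>)) + (\<Sum>j\<in>J. B k j * W j (snd \<omega>)))"
    and "(\<integral>\<omega>. (\<Sum>k\<in>K. a k * ((\<Sum>i\<in>I. A k i * V i (fst \<omega>)) + (\<Sum>j\<in>J. B k j * W j (snd \<omega>))))\<^sup>2 \<partial>(M \<Otimes>\<^sub>M N))
       = (\<integral>x. (\<Sum>i\<in>I. (\<Sum>k\<in>K. a k * A k i) * V i x)\<^sup>2 \<partial>M) + (\<integral>x. (\<Sum>j\<in>J. (\<Sum>k\<in>K. a k * B k j) * W j x)\<^sup>2 \<partial>N)"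
proof -
  interpret M: prob_space M using V by (rule gaussian_vectorD)
  interpret N: prob_space N using W by (rule gaussian_vectorD)
  interpret P: pair_prob_space M N ..
  have e: "(\<Sum>k\<in>K. a k * ((\<Sum>i\<in>I. A k i * V i x) + (\<Sum>j\<in>J. B k j * W j y)))
    = (\<Sum>i\<in>I. (\<Sum>k\<in>K. a k * A k i) * V i x) + (\<Sum>j\<in>J. (\<Sum>k\<in>K. a k * B k j) * W j y)" for a x y
    by (simp only: distrib_left sum.distrib sum_distrib_left sum_distrib_right mult.assoc)
       (rule arg_cong2[where f="(+)"]; rule sum.swap)
  note c = centred_gaussian_pair[OF M.prob_space_axioms N.prob_space_axioms gaussian_vectorD(3)[OF V] gaussian_vectorD(3)[OF W]]
  show "gaussian_vector (M \<Otimes>\<^sub>M N) K (\<lambda>k \<omega>. (\<Sum>i\<in>I. A k i * V i (fst \<omega>)) + (\<Sum>j\<in>J. B k j * W j (snd \<omega>)))"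
    unfolding gaussian_vector_def e by (intro conjI allI P.prob_space_axioms K c(1))
  show "(\<integral>\<omega>. (\<Sum>k\<in>K. a k * ((\<Sum>i\<in>I. A k i * V i (fst \<omega>)) + (\<Sum>j\<in>J. B k j * W j (snd \<omega>))))\<^sup>2 \<partial>(M \<Otimes>\<^sub>M N))
       = (\<integral>x. (\<Sum>i\<in>I. (\<Sum>k\<in>K. a k * A k i) * V i x)\<^sup>2 \<partial>M) + (\<integral>x. (\<Sum>j\<in>J. (\<Sum>k\<in>K. a k * B k j) * W j x)\<^sup>2 \<partial>N)"
    unfolding e by (rule c(2))
qed

lemma gaussian_vector_law_eq:
  assumes V: "gaussian_vector M I V" and W: "gaussian_vector N I W"
    and eq: "\<And>a. (\<integral>x. (\<Sum>i\<in>I. a i * V i x)\<^sup>2 \<partial>M) = (\<integral>x. (\<Sum>i\<in>I. a i * W i x)\<^sup>2 \<partial>N)"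
  shows "joint_law M I V = joint_law N I W"
proof (rule joint_law_determined_by_char)
  show "(\<integral>x. iexp (\<Sum>i\<in>I. a i * V i x) \<partial>M) = (\<integral>x. iexp (\<Sum>i\<in>I. a i * W i x) \<partial>N)" for a
    using gaussian_vectorD(3)[OF V, of a] gaussian_vectorD(3)[OF W, of a] eq[of a] by (simp add: centred_gaussian_def)
qed (rule gaussian_vectorD[OF V] gaussian_vectorD[OF W]; assumption?)+

lemma gaussian_vector_law_eq_covariance:
  assumes V: "gaussian_vector M I V" and W: "gaussian_vector N I W"
    and eq: "\<And>i j. i \<in> I \<Longrightarrow> j \<in> I \<Longrightarrow> (\<integral>x. V i x * V j x \<partial>M) = (\<integral>x. W i x * W j x \<partial>N)"
  shows "joint_law M I V = joint_law N I W"
proof (rule gaussian_vector_law_eq[OF V W])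
  fix a :: "'b \<Rightarrow> real"
  have sq: "(\<Sum>i\<in>I. a i * f i)\<^sup>2 = (\<Sum>i\<in>I. \<Sum>j\<in>I. (a i * a j) * (f i * f j))" for f
    unfolding power2_eq_square sum_product by (simp only: mult_ac)
  have "(\<integral>x. (\<Sum>i\<in>I. a i * V i x)\<^sup>2 \<partial>M) = (\<Sum>i\<in>I. \<Sum>j\<in>I. (a i * a j) * (\<integral>x. V i x * V j x \<partial>M))"
    unfolding sq using gaussian_vectorD(8)[OF V] by (simp add: Bochner_Integration.integral_sum Bochner_Integration.integrable_sum)
  also have "\<dots> = (\<Sum>i\<in>I. \<Sum>j\<in>I. (a i * a j) * (\<integral>x. W i x * W j x \<partial>N))" using eq by simp
  also have "\<dots> = (\<integral>x. (\<Sum>i\<in>I. a i * W i x)\<^sup>2 \<partial>N)"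
    unfolding sq using gaussian_vectorD(8)[OF W] by (simp add: Bochner_Integration.integral_sum Bochner_Integration.integrable_sum)
  finally show "(\<integral>x. (\<Sum>i\<in>I. a i * V i x)\<^sup>2 \<partial>M) = (\<integral>x. (\<Sum>i\<in>I. a i * W i x)\<^sup>2 \<partial>N)" .
qed

text \<open>Special case of the same vector on both factors, mixed coordinate by coordinate: this covers a
  rotation of a vector against an independent copy, and the vector obtained by listing the original
  and the rotated coordinates together.\<close>

lemma gaussian_vector_mix:
  fixes \<alpha> \<beta> :: "'k \<Rightarrow> real" and \<pi> :: "'k \<Rightarrow> 'i"
  assumes V: "gaussian_vector M I V" and K: "finite K" "\<pi> ` K \<subseteq> I"
  shows "gaussian_vector (M \<Otimes>\<^sub>M M) K (\<lambda>k \<omega>. \<alpha> k * V (\<pi> k) (fst \<omega>) + \<beta> k * V (\<pi> k) (snd \<omega>))"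
    and "k \<in> K \<Longrightarrow> l \<in> K \<Longrightarrow> (\<integral>\<omega>. (\<alpha> k * V (\<pi> k) (fst \<omega>) + \<beta> k * V (\<pi> k) (snd \<omega>)) * (\<alpha> l * V (\<pi> l) (fst \<omega>) + \<beta> l * V (\<pi> l) (snd \<omega>)) \<partial>(M \<Otimes>\<^sub>M M))
       = (\<alpha> k * \<alpha> l + \<beta> k * \<beta> l) * (\<integral>x. V (\<pi> k) x * V (\<pi> l) x \<partial>M)"
proof -
  let ?MM = "M \<Otimes>\<^sub>M M"
  interpret M: prob_space M using V by (rule gaussian_vectorD)
  have I: "finite I" using V by (rule gaussian_vectorD)
  have sel: "(\<Sum>i\<in>I. (if i = \<pi> k then t else 0) * f i) = t * f (\<pi> k)" if "k \<in> K" for k t and f :: "'i \<Rightarrow> real"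
  proof -
    have "(if i = \<pi> k then t else 0) * f i = (if i = \<pi> k then t * f (\<pi> k) else 0)" for i by simp
    then show ?thesis using that K I by auto
  qed
  have g: "gaussian_vector ?MM K (\<lambda>k \<omega>. (\<Sum>i\<in>I. (if i = \<pi> k then \<alpha> k else 0) * V i (fst \<omega>)) + (\<Sum>i\<in>I. (if i = \<pi> k then \<beta> k else 0) * V i (snd \<omega>)))"
    by (rule gaussian_vector_pair(1)[OF V V K(1)])
  have sm: "(\<Sum>k\<in>K. a k * ((\<Sum>i\<in>I. (if i = \<pi> k then \<alpha> k else 0) * V i (fst \<omega>)) + (\<Sum>i\<in>I. (if i = \<pi> k then \<beta> k else 0) * V i (snd \<omega>))))
     = (\<Sum>k\<in>K. a k * (\<alpha> k * V (\<pi> k) (fst \<omega>) + \<beta> k * V (\<pi> k) (snd \<omega>)))" for a \<omega>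
    by (intro sum.cong refl) (simp only: sel)
  show "gaussian_vector ?MM K (\<lambda>k \<omega>. \<alpha> k * V (\<pi> k) (fst \<omega>) + \<beta> k * V (\<pi> k) (snd \<omega>))"
    using g unfolding gaussian_vector_def sm .
  assume k: "k \<in> K" and l: "l \<in> K"
  then have kl: "\<pi> k \<in> I" "\<pi> l \<in> I" using K by auto
  note pr = integral_product_fun[OF M.prob_space_axioms M.prob_space_axioms]
  have e0: "(\<integral>x. V i x \<partial>M) = 0" if "i \<in> I" for i using gaussian_vectorD(4)[OF V that] by (simp add: centred_gaussian_def)
  define R where "R = (\<integral>x. V (\<pi> k) x * V (\<pi> l) x \<partial>M)"
  note iR = gaussian_vectorD(8)[OF V kl]
  note i1 = gaussian_vectorD(7)[OF V kl(1)] note i2 = gaussian_vectorD(7)[OF V kl(2)]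
  have 1: "integrable ?MM (\<lambda>\<omega>. V (\<pi> k) (fst \<omega>) * V (\<pi> l) (fst \<omega>))" "(\<integral>\<omega>. V (\<pi> k) (fst \<omega>) * V (\<pi> l) (fst \<omega>) \<partial>?MM) = R"
    using pr[OF iR, of "\<lambda>_. 1"] by (simp_all add: R_def M.prob_space)
  have 2: "integrable ?MM (\<lambda>\<omega>. V (\<pi> k) (snd \<omega>) * V (\<pi> l) (snd \<omega>))" "(\<integral>\<omega>. V (\<pi> k) (snd \<omega>) * V (\<pi> l) (snd \<omega>) \<partial>?MM) = R"
    using pr[OF _ iR, of "\<lambda>_. 1"] by (simp_all add: R_def M.prob_space)
  have 3: "integrable ?MM (\<lambda>\<omega>. V (\<pi> k) (fst \<omega>) * V (\<pi> l) (snd \<omega>))" "(\<integral>\<omega>. V (\<pi> k) (fst \<omega>) * V (\<pi> l) (snd \<omega>) \<partial>?MM) = 0"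
    using pr[OF i1 i2] e0[OF kl(1)] by simp_all
  have 4: "integrable ?MM (\<lambda>\<omega>. V (\<pi> l) (fst \<omega>) * V (\<pi> k) (snd \<omega>))" "(\<integral>\<omega>. V (\<pi> l) (fst \<omega>) * V (\<pi> k) (snd \<omega>) \<partial>?MM) = 0"
    using pr[OF i2 i1] e0[OF kl(1)] by simp_all
  have ex: "(a * x + b * y) * (a' * x' + b' * y') = a * a' * (x * x') + b * b' * (y * y') + a * b' * (x * y') + a' * b * (x' * y)" for a b a' b' x y x' y' :: real
    by (simp add: algebra_simps)
  show "(\<integral>\<omega>. (\<alpha> k * V (\<pi> k) (fst \<omega>) + \<beta> k * V (\<pi> k) (snd \<omega>)) * (\<alpha> l * V (\<pi> l) (fst \<omega>) + \<beta> l * V (\<pi> l) (snd \<omega>)) \<partial>?MM)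
       = (\<alpha> k * \<alpha> l + \<beta> k * \<beta> l) * (\<integral>x. V (\<pi> k) x * V (\<pi> l) x \<partial>M)"
    unfolding ex R_def[symmetric] using 1 2 3 4 by (simp add: distrib_right)
qed

text \<open>The pair of a vector and an independent copy is invariant under rotations, because both sides are
  Gaussian and \<open>c\<^sup>2 + s\<^sup>2 = 1\<close> makes the covariances agree. The index set
  \<open>I \<times> UNIV\<close> with Boolean second component holds the two copies.\<close>

lemma gaussian_rotation_law:
  assumes V: "gaussian_vector M I V" and cs: "c\<^sup>2 + s\<^sup>2 = (1::real)"
  shows "joint_law (M \<Otimes>\<^sub>M M) (I \<times> UNIV) (\<lambda>k \<omega>. if snd k then c * V (fst k) (fst \<omega>) + s * V (fst k) (snd \<omega>)
           else - s * V (fst k) (fst \<omega>) + c * V (fst k) (snd \<omega>))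
    = joint_law (M \<Otimes>\<^sub>M M) (I \<times> UNIV) (\<lambda>k \<omega>. if snd k then V (fst k) (fst \<omega>) else V (fst k) (snd \<omega>))"
proof -
  have K: "finite (I \<times> (UNIV::bool set))" "fst ` (I \<times> (UNIV::bool set)) \<subseteq> I" using gaussian_vectorD(2)[OF V] by auto
  note mix = gaussian_vector_mix[OF V K]
  have cs': "c * c + s * s = 1" using cs by (simp add: power2_eq_square)
  have "joint_law (M \<Otimes>\<^sub>M M) (I \<times> UNIV) (\<lambda>k \<omega>. (if snd k then c else - s) * V (fst k) (fst \<omega>) + (if snd k then s else c) * V (fst k) (snd \<omega>))
    = joint_law (M \<Otimes>\<^sub>M M) (I \<times> UNIV) (\<lambda>k \<omega>. (if snd k then 1 else 0) * V (fst k) (fst \<omega>) + (if snd k then 0 else 1) * V (fst k) (snd \<omega>))"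
  proof (rule gaussian_vector_law_eq_covariance[OF mix(1) mix(1)], goal_cases)
    case (1 k l)
    show ?case
      unfolding mix(2)[where \<alpha>="\<lambda>k. if snd k then c else - s" and \<beta>="\<lambda>k. if snd k then s else c", OF 1]
        mix(2)[where \<alpha>="\<lambda>k. if snd k then 1 else 0" and \<beta>="\<lambda>k. if snd k then 0 else 1", OF 1]
      using cs' by (simp add: add.commute mult.commute)
  qed
  moreover have "(if b then c else - s) * y + (if b then s else c) * z = (if b then c * y + s * z else - s * y + c * z)"
    "(if b then 1 else 0) * y + (if b then 0 else 1) * z = (if b then y else z)" for b and y z :: real by simp_all
  ultimately show ?thesis by (simp only:)
qed

lemma gaussian_vector_std_normal:
  assumes V: "gaussian_vector M I V" and j: "j \<in> I" and v: "(\<integral>x. (V j x)\<^sup>2 \<partial>M) = 1"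
  shows "distr M borel (V j) = gauss"
proof (rule Levy_uniqueness)
  interpret prob_space M using V by (rule gaussian_vectorD)
  note I = gaussian_vectorD(2)[OF V]
  have [measurable]: "V j \<in> borel_measurable M" by (rule gaussian_vectorD(5)[OF V j])
  show "real_distribution (distr M borel (V j))" by simp
  show "real_distribution gauss" unfolding gauss_def by (rule real_dist_normal_dist)
  show "char (distr M borel (V j)) = char gauss"
  proof
    fix t
    have s: "(\<Sum>k\<in>I. (if k = j then t else 0) * V k x) = t * V j x" for x
    proof -
      have "(if k = j then t else 0) * V k x = (if k = j then t * V j x else 0)" for k by simp
      then show ?thesis using j I by simp
    qed
    have "char (distr M borel (V j)) t = (\<integral>x. iexp (t * V j x) \<partial>M)" unfolding char_def by (subst integral_distr) auto
    also have "\<dots> = complex_of_real (exp (- t\<^sup>2 / 2))"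
      using gaussian_vectorD(3)[OF V, of "\<lambda>k. if k = j then t else 0"] v
      by (simp add: s centred_gaussian_def power_mult_distrib)
    finally show "char (distr M borel (V j)) t = char gauss t"
      using fun_cong[OF char_std_normal_distribution, of t] by (simp add: gauss_def)
  qed
qed

text \<open>Regression on the coordinate \<open>j\<close>: the residuals \<open>V i - r i * V j\<close> are uncorrelated
  with \<open>V j\<close>, hence independent of it, so that \<open>V j\<close> may be replaced by a fresh
  standard normal variable on a separate factor.\<close>

lemma gaussian_vector_regression:
  assumes V: "gaussian_vector M I V" and j: "j \<in> I" and v: "(\<integral>x. (V j x)\<^sup>2 \<partial>M) = 1"
    and r: "\<And>i. i \<in> I \<Longrightarrow> r i = (\<integral>x. V j x * V i x \<partial>M)"
  shows "joint_law M I V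
    = distr (gauss \<Otimes>\<^sub>M M) (Pi\<^sub>M I (\<lambda>_. borel)) (\<lambda>\<omega>. \<lambda>i\<in>I. r i * fst \<omega> + (V i (snd \<omega>) - r i * V j (snd \<omega>)))"
proof -
  interpret prob_space M using V by (rule gaussian_vectorD)
  have I[simp]: "finite I" using V by (rule gaussian_vectorD)
  (* coefficients of the residual of \<open>V i\<close> *)
  define B where "B i k = (if k = i then 1 else 0) - (if k = j then r i else 0)" for i k
  have B: "(\<Sum>k\<in>I. B i k * V k y) = V i y - r i * V j y" if "i \<in> I" for i y
  proof -
    have "B i k * V k y = (if k = i then V i y else 0) - (if k = j then r i * V j y else 0)" for k
      by (simp add: B_def algebra_simps)
    then show ?thesis using that j by (simp add: sum_subtractf)
  qed
  note g = gaussian_vector_pair[OF gaussian_vector_gauss V I, where A="\<lambda>i _. r i" and B=B]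
  have "joint_law M I V =
     distr (gauss \<Otimes>\<^sub>M M) (Pi\<^sub>M I (\<lambda>_. borel)) (\<lambda>\<omega>. \<lambda>i\<in>I. (\<Sum>u\<in>{()}. r i * fst \<omega>) + (\<Sum>k\<in>I. B i k * V k (snd \<omega>)))"
  proof (rule gaussian_vector_law_eq[OF V g(1)])
    fix a
    define s where "s = (\<Sum>i\<in>I. a i * r i)"
    define S where "S y = (\<Sum>i\<in>I. a i * V i y)" for y
    have 1: "(\<integral>x. (\<Sum>u\<in>{()}. s * x)\<^sup>2 \<partial>gauss) = s\<^sup>2"
      using integral_std_normal_moment_even[of 1] by (simp add: power_mult_distrib integral_gauss)
    have 2: "(\<Sum>k\<in>I. (\<Sum>i\<in>I. a i * B i k) * V k y) = S y - s * V j y" for y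
    proof -
      have "(\<Sum>k\<in>I. (\<Sum>i\<in>I. a i * B i k) * V k y) = (\<Sum>i\<in>I. a i * (\<Sum>k\<in>I. B i k * V k y))"
        by (simp only: sum_distrib_left sum_distrib_right mult.assoc) (rule sum.swap)
      also have "\<dots> = (\<Sum>i\<in>I. a i * (V i y - r i * V j y))" using B by simp
      also have "\<dots> = S y - s * V j y" unfolding S_def s_def
        by (simp only: right_diff_distrib sum_subtractf sum_distrib_right mult.assoc)
      finally show ?thesis .
    qed
    have iS: "integrable M (\<lambda>y. (S y)\<^sup>2)" unfolding S_def using gaussian_vectorD(10)[OF V] .
    have iSV: "integrable M (\<lambda>y. S y * V j y)" unfolding S_def sum_distrib_right
      using gaussian_vectorD(8)[OF V _ j] by (auto simp: mult.assoc)
    have iV: "integrable M (\<lambda>y. (V j y)\<^sup>2)" using gaussian_vectorD(6)[OF V j] .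
    have eSV: "(\<integral>y. S y * V j y \<partial>M) = s"
    proof -
      have "(\<integral>y. S y * V j y \<partial>M) = (\<integral>y. (\<Sum>i\<in>I. a i * (V j y * V i y)) \<partial>M)"
        unfolding S_def sum_distrib_right by (simp add: mult_ac)
      also have "\<dots> = (\<Sum>i\<in>I. a i * (\<integral>y. V j y * V i y \<partial>M))"
        using gaussian_vectorD(8)[OF V j] by (subst Bochner_Integration.integral_sum) auto
      finally show ?thesis by (simp add: s_def r)
    qed
    have 3: "(\<integral>y. (S y - s * V j y)\<^sup>2 \<partial>M) = (\<integral>y. (S y)\<^sup>2 \<partial>M) - s\<^sup>2"
    proof -
      have "(\<integral>y. (S y - s * V j y)\<^sup>2 \<partial>M) = (\<integral>y. (S y)\<^sup>2 - 2 * s * (S y * V j y) + s\<^sup>2 * (V j y)\<^sup>2 \<partial>M)"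
        by (simp only: power2_diff power_mult_distrib) (simp only: mult_ac diff_add_eq)
      also have "\<dots> = (\<integral>y. (S y)\<^sup>2 \<partial>M) - 2 * s * s + s\<^sup>2 * 1"
        using iS iSV iV by (simp add: eSV v)
      finally show ?thesis by (simp add: power2_eq_square)
    qed
    show "(\<integral>x. (\<Sum>i\<in>I. a i * V i x)\<^sup>2 \<partial>M) = (\<integral>x. (\<Sum>i\<in>I. a i * ((\<Sum>u\<in>{()}. r i * fst x) + (\<Sum>k\<in>I. B i k * V k (snd x))))\<^sup>2 \<partial>(gauss \<Otimes>\<^sub>M M))"
      unfolding g(2) s_def[symmetric] 1 2 3 S_def[symmetric] by simp
  qed
  also have "(\<lambda>\<omega>. \<lambda>i\<in>I. (\<Sum>u\<in>{()}. r i * fst \<omega>) + (\<Sum>k\<in>I. B i k * V k (snd \<omega>)))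
     = (\<lambda>\<omega>. \<lambda>i\<in>I. r i * fst \<omega> + (V i (snd \<omega>) - r i * V j (snd \<omega>)))"
    using B by (auto simp: fun_eq_iff restrict_def)
  finally show ?thesis .
qed

section \<open>Gaussian integration by parts\<close>

text \<open>Functions of a vector with coordinates in \<open>I\<close> are written on the full function space, to
  avoid restrictions in every formula; they may depend on the coordinates in \<open>I\<close> only.\<close>

definition cylindrical :: "'i set \<Rightarrow> (('i \<Rightarrow> real) \<Rightarrow> real) \<Rightarrow> bool" where
  "cylindrical I F \<longleftrightarrow> F \<in> borel_measurable (Pi\<^sub>M I (\<lambda>_. borel)) \<and> (\<forall>v. F (restrict v I) = F v)"

lemma cylindrical_cong: "cylindrical I F \<Longrightarrow> (\<And>i. i \<in> I \<Longrightarrow> v i = w i) \<Longrightarrow> F v = F w"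
  unfolding cylindrical_def by (metis restrict_ext)

lemma cylindrical_measurable:
  assumes F: "cylindrical I F" and X: "\<And>i. i \<in> I \<Longrightarrow> X i \<in> borel_measurable M"
  shows "(\<lambda>\<omega>. F (\<lambda>i. X i \<omega>)) \<in> borel_measurable M"
proof -
  have "(\<lambda>\<omega>. \<lambda>i\<in>I. X i \<omega>) \<in> M \<rightarrow>\<^sub>M Pi\<^sub>M I (\<lambda>_. borel)" using X by (rule measurable_restrict)
  then have "(\<lambda>\<omega>. F (\<lambda>i\<in>I. X i \<omega>)) \<in> borel_measurable M"
    by (rule measurable_compose) (use F in \<open>simp add: cylindrical_def\<close>)
  moreover have "F (\<lambda>i\<in>I. X i \<omega>) = F (\<lambda>i. X i \<omega>)" for \<omega>
    using F by (simp add: cylindrical_def)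
  ultimately show ?thesis by simp
qed

lemma cylindrical_component: "i \<in> I \<Longrightarrow> cylindrical I (\<lambda>v. v i)"
  unfolding cylindrical_def by (auto intro!: measurable_component_singleton)

lemma cylindrical_const: "cylindrical I (\<lambda>v. c)"
  unfolding cylindrical_def by auto

lemma cylindrical_comp: "f \<in> borel_measurable borel \<Longrightarrow> cylindrical I F \<Longrightarrow> cylindrical I (\<lambda>v. f (F v))"
  unfolding cylindrical_def by auto

lemma cylindrical_add: "cylindrical I F \<Longrightarrow> cylindrical I G \<Longrightarrow> cylindrical I (\<lambda>v. F v + G v)"
  and cylindrical_diff: "cylindrical I F \<Longrightarrow> cylindrical I G \<Longrightarrow> cylindrical I (\<lambda>v. F v - G v)"
  and cylindrical_mult: "cylindrical I F \<Longrightarrow> cylindrical I G \<Longrightarrow> cylindrical I (\<lambda>v. F v * G v)"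
  unfolding cylindrical_def by auto

lemma cylindrical_sum: "(\<And>k. k \<in> K \<Longrightarrow> cylindrical I (F k)) \<Longrightarrow> cylindrical I (\<lambda>v. \<Sum>k\<in>K. F k v)"
  unfolding cylindrical_def by (auto intro!: borel_measurable_sum sum.cong)

lemma cylindrical_subst:
  assumes E: "cylindrical I E" and f: "\<And>i. i \<in> I \<Longrightarrow> cylindrical K (f i)"
  shows "cylindrical K (\<lambda>w. E (\<lambda>i. f i w))"
  unfolding cylindrical_def
proof
  show "(\<lambda>w. E (\<lambda>i. f i w)) \<in> borel_measurable (Pi\<^sub>M K (\<lambda>_. borel))"
    by (rule cylindrical_measurable[OF E]) (use f in \<open>simp add: cylindrical_def\<close>)
  show "\<forall>v. E (\<lambda>i. f i (restrict v K)) = E (\<lambda>i. f i v)"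
    by (intro allI cylindrical_cong[OF E]) (use f in \<open>simp add: cylindrical_def\<close>)
qed

lemma cylindrical_coordinate: "f \<in> borel_measurable borel \<Longrightarrow> i \<in> I \<Longrightarrow> cylindrical I (\<lambda>v. f (v i))"
  by (rule cylindrical_comp[OF _ cylindrical_component])

lemmas cylindrical_intros = cylindrical_component cylindrical_const
  cylindrical_add cylindrical_diff cylindrical_mult cylindrical_sum

lemma cylindrical_same_law:
  assumes eq: "joint_law M I V = joint_law N I W"
    and F: "cylindrical I F" and V: "\<And>i. i \<in> I \<Longrightarrow> V i \<in> borel_measurable M" and W: "\<And>i. i \<in> I \<Longrightarrow> W i \<in> borel_measurable N"
  shows "(\<integral>x. F (\<lambda>i. V i x) \<partial>M) = (\<integral>x. F (\<lambda>i. W i x) \<partial>N)"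
    and "integrable M (\<lambda>x. F (\<lambda>i. V i x)) \<longleftrightarrow> integrable N (\<lambda>x. F (\<lambda>i. W i x))"
proof -
  have mV: "(\<lambda>x. \<lambda>i\<in>I. V i x) \<in> M \<rightarrow>\<^sub>M Pi\<^sub>M I (\<lambda>_. borel)" using V by (rule measurable_restrict)
  have mW: "(\<lambda>x. \<lambda>i\<in>I. W i x) \<in> N \<rightarrow>\<^sub>M Pi\<^sub>M I (\<lambda>_. borel)" using W by (rule measurable_restrict)
  have mF: "F \<in> borel_measurable (Pi\<^sub>M I (\<lambda>_. borel))" and Fr: "F (restrict v I) = F v" for v
    using F by (auto simp: cylindrical_def)
  show "(\<integral>x. F (\<lambda>i. V i x) \<partial>M) = (\<integral>x. F (\<lambda>i. W i x) \<partial>N)"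
    using integral_distr[OF mV mF] integral_distr[OF mW mF] by (simp add: eq Fr)
  show "integrable M (\<lambda>x. F (\<lambda>i. V i x)) \<longleftrightarrow> integrable N (\<lambda>x. F (\<lambda>i. W i x))"
    using integrable_distr_eq[OF mV mF] integrable_distr_eq[OF mW mF] by (simp add: eq Fr)
qed

text \<open>Conditionally on the residuals of the regression on \<open>V j\<close>, the vector moves along a line in
  the direction of the covariances \<open>r\<close>, so the claim is the one-dimensional formula on
  each line. This is why \<open>\<Phi>'\<close> is a derivative in the single direction \<open>r\<close>.\<close>

lemma gaussian_vector_ibp:
  assumes V: "gaussian_vector M I V" and j: "j \<in> I" and v: "(\<integral>x. (V j x)\<^sup>2 \<partial>M) = 1"
    and r: "\<And>i. i \<in> I \<Longrightarrow> r i = (\<integral>x. V j x * V i x \<partial>M)"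
    and \<Phi>: "cylindrical I \<Phi>" and \<Phi>': "cylindrical I \<Phi>'"
    and d: "\<And>v x. ((\<lambda>t. \<Phi> (\<lambda>i. v i + t * r i)) has_real_derivative \<Phi>' (\<lambda>i. v i + x * r i)) (at x)"
    and c: "\<And>v. continuous_on UNIV (\<lambda>x. \<Phi>' (\<lambda>i. v i + x * r i))"
    and l: "\<And>v. ((\<lambda>x. \<Phi> (\<lambda>i. v i + x * r i) * std_normal_density x) \<longlongrightarrow> 0) at_top"
      "\<And>v. ((\<lambda>x. \<Phi> (\<lambda>i. v i + x * r i) * std_normal_density x) \<longlongrightarrow> 0) at_bot"
    and i: "integrable M (\<lambda>\<omega>. V j \<omega> * \<Phi> (\<lambda>i. V i \<omega>))" "integrable M (\<lambda>\<omega>. \<Phi>' (\<lambda>i. V i \<omega>))"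
  shows "(\<integral>\<omega>. V j \<omega> * \<Phi> (\<lambda>i. V i \<omega>) \<partial>M) = (\<integral>\<omega>. \<Phi>' (\<lambda>i. V i \<omega>) \<partial>M)"
proof -
  interpret prob_space M using V by (rule gaussian_vectorD)
  interpret G: prob_space gauss by (rule prob_space_gauss)
  interpret P: pair_prob_space gauss M ..
  note mV[measurable] = gaussian_vectorD(5)[OF V]
  have [measurable]: "V j \<in> borel_measurable M" using j by simp
  have rj: "r j = 1" using r[OF j] v by (simp add: power2_eq_square)
  have C1: "cylindrical I (\<lambda>v. v j * \<Phi> v)" by (intro cylindrical_mult cylindrical_component j \<Phi>)
  define R where "R i \<omega> = V i \<omega> - r i * V j \<omega>" for i \<omega>
  have [measurable]: "i \<in> I \<Longrightarrow> R i \<in> borel_measurable M" for i unfolding R_def by simp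
  note law = cylindrical_same_law[OF gaussian_vector_regression[OF V j v r]]
  have m1: "i \<in> I \<Longrightarrow> (\<lambda>\<omega>. r i * fst \<omega> + (V i (snd \<omega>) - r i * V j (snd \<omega>))) \<in> borel_measurable (gauss \<Otimes>\<^sub>M M)" for i
    by simp
  have eqR: "F (\<lambda>i. r i * x + (V i \<omega> - r i * V j \<omega>)) = F (\<lambda>i. R i \<omega> + x * r i)" for F :: "_ \<Rightarrow> real" and x \<omega>
    by (simp add: R_def algebra_simps)
  have e1: "(\<integral>\<omega>. V j \<omega> * \<Phi> (\<lambda>i. V i \<omega>) \<partial>M) = (\<integral>\<omega>. fst \<omega> * \<Phi> (\<lambda>i. R i (snd \<omega>) + fst \<omega> * r i) \<partial>(gauss \<Otimes>\<^sub>M M))"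
    using law(1)[OF _ C1 mV m1] by (simp add: eqR rj)
  have i1: "integrable (gauss \<Otimes>\<^sub>M M) (\<lambda>(x,\<omega>). x * \<Phi> (\<lambda>i. R i \<omega> + x * r i))"
    using law(2)[OF _ C1 mV m1] i(1) by (simp add: eqR rj split_beta')
  have e2: "(\<integral>\<omega>. \<Phi>' (\<lambda>i. V i \<omega>) \<partial>M) = (\<integral>\<omega>. \<Phi>' (\<lambda>i. R i (snd \<omega>) + fst \<omega> * r i) \<partial>(gauss \<Otimes>\<^sub>M M))"
    using law(1)[OF _ \<Phi>' mV m1] by (simp add: eqR)
  have i2: "integrable (gauss \<Otimes>\<^sub>M M) (\<lambda>(x,\<omega>). \<Phi>' (\<lambda>i. R i \<omega> + x * r i))"
    using law(2)[OF _ \<Phi>' mV m1] i(2) by (simp add: eqR split_beta')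
  have "(\<integral>\<omega>. V j \<omega> * \<Phi> (\<lambda>i. V i \<omega>) \<partial>M) = (\<integral>\<omega>. (\<integral>x. x * \<Phi> (\<lambda>i. R i \<omega> + x * r i) \<partial>gauss) \<partial>M)"
    unfolding e1 using P.integral_snd[OF i1] by (simp add: split_beta')
  also have "\<dots> = (\<integral>\<omega>. (\<integral>x. \<Phi>' (\<lambda>i. R i \<omega> + x * r i) \<partial>gauss) \<partial>M)"
  proof (rule integral_cong_AE)
    show "(\<lambda>\<omega>. (\<integral>x. x * \<Phi> (\<lambda>i. R i \<omega> + x * r i) \<partial>gauss)) \<in> borel_measurable M"
      using P.integrable_snd[OF i1] by simp
    show "(\<lambda>\<omega>. (\<integral>x. \<Phi>' (\<lambda>i. R i \<omega> + x * r i) \<partial>gauss)) \<in> borel_measurable M"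
      using P.integrable_snd[OF i2] by simp
    show "AE \<omega> in M. (\<integral>x. x * \<Phi> (\<lambda>i. R i \<omega> + x * r i) \<partial>gauss) = (\<integral>x. \<Phi>' (\<lambda>i. R i \<omega> + x * r i) \<partial>gauss)"
      using P.AE_integrable_snd[OF i1] P.AE_integrable_snd[OF i2]
      by eventually_elim (rule gauss_ibp_1d; use d c l in simp)
  qed
  also have "\<dots> = (\<integral>\<omega>. \<Phi>' (\<lambda>i. V i \<omega>) \<partial>M)"
    unfolding e2 using P.integral_snd[OF i2] by (simp add: split_beta')
  finally show ?thesis .
qed

section \<open>A covariance inequality for smooth functionals\<close>

text \<open>A bounded functional \<open>F\<close> with bounded partial derivatives \<open>D\<close>. Differentiability is
  expressed by the chain rule along arbitrary curves: it is applied in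
  this form, to rotations and to straight lines, and for concrete functionals it follows from the
  usual differentiation rules.\<close>

definition smooth_functional :: "'i set \<Rightarrow> (('i \<Rightarrow> real) \<Rightarrow> real) \<Rightarrow> ('i \<Rightarrow> ('i \<Rightarrow> real) \<Rightarrow> real) \<Rightarrow> bool" where
  "smooth_functional I F D \<longleftrightarrow> cylindrical I F \<and> (\<forall>i\<in>I. cylindrical I (D i)) \<and>
    (\<exists>B. \<forall>v. \<bar>F v\<bar> \<le> B \<and> (\<forall>i\<in>I. \<bar>D i v\<bar> \<le> B)) \<and>
    (\<forall>\<gamma> \<gamma>' t. (\<forall>i\<in>I. ((\<lambda>s. \<gamma> s i) has_real_derivative \<gamma>' i) (at t)) \<longrightarrow>
      ((\<lambda>s. F (\<gamma> s)) has_real_derivative (\<Sum>i\<in>I. D i (\<gamma> t) * \<gamma>' i)) (at t)) \<and>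
    (\<forall>\<gamma>. (\<forall>i\<in>I. continuous_on UNIV (\<lambda>s::real. \<gamma> s i)) \<longrightarrow> (\<forall>i\<in>I. continuous_on UNIV (\<lambda>s. D i (\<gamma> s))))"

lemma std_normal_density_tendsto_0:
  "(std_normal_density \<longlongrightarrow> 0) at_top" "(std_normal_density \<longlongrightarrow> 0) at_bot"
proof -
  have *: "((\<lambda>x::real. exp (- x\<^sup>2 / 2)) \<longlongrightarrow> 0) at_top"
    by real_asymp
  have **: "((\<lambda>x::real. exp (- x\<^sup>2 / 2)) \<longlongrightarrow> 0) at_bot"
    by real_asymp
  show "(std_normal_density \<longlongrightarrow> 0) at_top" "(std_normal_density \<longlongrightarrow> 0) at_bot"
    unfolding std_normal_density_def using tendsto_mult_right_zero[OF *, of "1 / sqrt (2*pi)"] tendsto_mult_right_zero[OF **, of "1 / sqrt (2*pi)"] by simp_all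
qed

lemma smooth_functionalD:
  assumes "smooth_functional I F D"
  shows "cylindrical I F" "i \<in> I \<Longrightarrow> cylindrical I (D i)"
    "(\<And>i. i \<in> I \<Longrightarrow> ((\<lambda>s. \<gamma> s i) has_real_derivative \<gamma>' i) (at t)) \<Longrightarrow>
      ((\<lambda>s. F (\<gamma> s)) has_real_derivative (\<Sum>i\<in>I. D i (\<gamma> t) * \<gamma>' i)) (at t)"
    "(\<And>i. i \<in> I \<Longrightarrow> continuous_on UNIV (\<lambda>s. \<gamma> s i)) \<Longrightarrow> i \<in> I \<Longrightarrow> continuous_on UNIV (\<lambda>s. D i (\<gamma> s))"
  using assms unfolding smooth_functional_def by blast+

lemma smooth_functional_bound:
  assumes "smooth_functional I F D"
  obtains B where "B \<ge> 0" "\<And>v. \<bar>F v\<bar> \<le> B" "\<And>i v. i \<in> I \<Longrightarrow> \<bar>D i v\<bar> \<le> B"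
  using assms unfolding smooth_functional_def by (meson abs_ge_zero order_trans)

text \<open>The derivative of \<open>c * V i + s * V' i\<close> with respect to the angle is
  \<open>- s * V j + c * V' j\<close>. Rotating back turns it into the second copy \<open>V' j\<close>, the
  argument of \<open>H\<close> into the first copy, and the argument of \<open>F\<close> into a mixture in which the
  second copy has the coefficient \<open>- s\<close>. With the first copy fixed, integration by parts in
  the second one then differentiates \<open>F\<close>, while \<open>H\<close> is constant.\<close>

lemma rotated_ibp:
  assumes V: "gaussian_vector M I V" and j: "j \<in> I" and v: "(\<integral>x. (V j x)\<^sup>2 \<partial>M) = 1"
    and F: "smooth_functional I F D" and H: "cylindrical I H" and HB: "\<And>v. \<bar>H v\<bar> \<le> B"
    and cs: "c\<^sup>2 + s\<^sup>2 = 1"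
  shows "(\<integral>\<omega>. F (\<lambda>i. V i (fst \<omega>)) * H (\<lambda>i. c * V i (fst \<omega>) + s * V i (snd \<omega>)) * (- s * V j (fst \<omega>) + c * V j (snd \<omega>)) \<partial>(M \<Otimes>\<^sub>M M))
    = - s * (\<Sum>i\<in>I. (\<integral>x. V j x * V i x \<partial>M) * (\<integral>\<omega>. H (\<lambda>i. V i (fst \<omega>)) * D i (\<lambda>i. c * V i (fst \<omega>) - s * V i (snd \<omega>)) \<partial>(M \<Otimes>\<^sub>M M)))"
    (is "?lhs = - s * (\<Sum>i\<in>I. _ * ?E i)")
proof -
  let ?MM = "M \<Otimes>\<^sub>M M"
  interpret M: prob_space M using V by (rule gaussian_vectorD)
  interpret P: pair_prob_space M M ..
  have I[simp]: "finite I" using V by (rule gaussian_vectorD)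
  note mV[measurable] = gaussian_vectorD(5)[OF V]
  note Fd = smooth_functionalD[OF F]
  have [measurable]: "V j \<in> borel_measurable M" using j by simp
  obtain A where A: "A \<ge> 0" "\<And>v. \<bar>F v\<bar> \<le> A" "\<And>i v. i \<in> I \<Longrightarrow> \<bar>D i v\<bar> \<le> A" using smooth_functional_bound[OF F] by blast
  have B0: "B \<ge> 0" using HB[of undefined] by linarith
  define r where "r i = (\<integral>x. V j x * V i x \<partial>M)" for i
  define h where "h x = H (\<lambda>i. V i x)" for x
  define Z where "Z x y = (\<lambda>i. c * V i x - s * V i y)" for x y
  have [measurable]: "h \<in> borel_measurable M" unfolding h_def by (rule cylindrical_measurable[OF H mV])
  have mZ: "(\<lambda>\<omega>. E (Z (fst \<omega>) (snd \<omega>))) \<in> borel_measurable ?MM" if "cylindrical I E" for E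
    unfolding Z_def by (rule cylindrical_measurable[OF that]) simp
  have hB: "\<bar>h x\<bar> \<le> B" for x unfolding h_def by (rule HB)
  (* the integrand in rotated coordinates: True marks the first copy, False the second one *)
  define \<Psi> where "\<Psi> w = F (\<lambda>i. c * w (i,True) - s * w (i,False)) * H (\<lambda>i. w (i,True)) * w (j,False)" for w :: "'b \<times> bool \<Rightarrow> real"
  have \<Psi>: "cylindrical (I \<times> UNIV) \<Psi>"
    unfolding \<Psi>_def[abs_def] by (intro cylindrical_intros cylindrical_subst[OF Fd(1)] cylindrical_subst[OF H]) (use j in auto)
  have unrot: "c * (c * y + s * z) - s * (- s * y + c * z) = y" for y z
  proof -
    have "c * (c * y + s * z) - s * (- s * y + c * z) = (c\<^sup>2 + s\<^sup>2) * y"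
      by (simp add: power2_eq_square algebra_simps)
    then show ?thesis using cs by simp
  qed
  have "?lhs = (\<integral>\<omega>. \<Psi> (\<lambda>k. if snd k then c * V (fst k) (fst \<omega>) + s * V (fst k) (snd \<omega>)
           else - s * V (fst k) (fst \<omega>) + c * V (fst k) (snd \<omega>)) \<partial>?MM)"
    unfolding \<Psi>_def by (simp only: unrot fst_conv snd_conv if_True if_False)
  also have "\<dots> = (\<integral>\<omega>. \<Psi> (\<lambda>k. if snd k then V (fst k) (fst \<omega>) else V (fst k) (snd \<omega>)) \<partial>?MM)"
    by (rule cylindrical_same_law(1)[OF gaussian_rotation_law[OF V cs] \<Psi>]) auto
  also have "\<dots> = (\<integral>\<omega>. F (Z (fst \<omega>) (snd \<omega>)) * h (fst \<omega>) * V j (snd \<omega>) \<partial>?MM)"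
    by (simp add: \<Psi>_def h_def Z_def)
  also have "\<dots> = (\<integral>x. (\<integral>y. F (Z x y) * h x * V j y \<partial>M) \<partial>M)"
  proof (subst P.integral_fst'[symmetric])
    show "integrable ?MM (\<lambda>\<omega>. F (Z (fst \<omega>) (snd \<omega>)) * h (fst \<omega>) * V j (snd \<omega>))"
    proof (rule Bochner_Integration.integrable_bound)
      show "integrable ?MM (\<lambda>\<omega>. (A * B) * V j (snd \<omega>))"
        using integral_product_fun(1)[OF M.prob_space_axioms M.prob_space_axioms _ gaussian_vectorD(7)[OF V j], of "\<lambda>_. 1"] by simp
      show "(\<lambda>\<omega>. F (Z (fst \<omega>) (snd \<omega>)) * h (fst \<omega>) * V j (snd \<omega>)) \<in> borel_measurable ?MM"
        by (intro borel_measurable_times mZ[OF Fd(1)]) auto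
      show "AE \<omega> in ?MM. norm (F (Z (fst \<omega>) (snd \<omega>)) * h (fst \<omega>) * V j (snd \<omega>)) \<le> norm (A * B * V j (snd \<omega>))"
        using A B0 hB by (intro AE_I2) (auto simp: abs_mult intro!: mult_mono)
    qed
  qed simp
  also have "\<dots> = (\<integral>x. (\<integral>y. (\<Sum>i\<in>I. (- s * r i) * (h x * D i (Z x y))) \<partial>M) \<partial>M)"
  proof (rule Bochner_Integration.integral_cong[OF refl])
    fix x
    define \<Phi> where "\<Phi> w = F (\<lambda>i. c * V i x - s * w i)" for w
    define \<Phi>' where "\<Phi>' w = - s * (\<Sum>i\<in>I. D i (\<lambda>i. c * V i x - s * w i) * r i)" for w
    have \<Phi>c: "cylindrical I \<Phi>" and \<Phi>'c: "cylindrical I \<Phi>'"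
      unfolding \<Phi>_def[abs_def] \<Phi>'_def[abs_def]
      by (intro cylindrical_intros cylindrical_subst[OF Fd(1)] cylindrical_subst[OF Fd(2)]; simp)+
    have dB: "\<bar>\<Phi>' w\<bar> \<le> \<bar>s\<bar> * (\<Sum>i\<in>I. A * \<bar>r i\<bar>)" for w
      unfolding \<Phi>'_def abs_mult abs_minus
      by (intro mult_left_mono order_trans[OF sum_abs] sum_mono) (auto simp: abs_mult intro!: mult_right_mono A)
    have eq: "(\<integral>y. V j y * \<Phi> (\<lambda>i. V i y) \<partial>M) = (\<integral>y. \<Phi>' (\<lambda>i. V i y) \<partial>M)"
    proof (rule gaussian_vector_ibp[where r=r and \<Phi>=\<Phi> and \<Phi>'=\<Phi>', OF V j v _ \<Phi>c \<Phi>'c])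
      show "r i = (\<integral>z. V j z * V i z \<partial>M)" for i by (rule r_def)
    next
      fix w t
      have "((\<lambda>t. \<Phi> (\<lambda>i. w i + t * r i)) has_real_derivative (\<Sum>i\<in>I. D i (\<lambda>i. c * V i x - s * (w i + t * r i)) * (- s * r i))) (at t)"
        unfolding \<Phi>_def by (rule Fd(3)) (auto intro!: derivative_eq_intros)
      then show "((\<lambda>t. \<Phi> (\<lambda>i. w i + t * r i)) has_real_derivative \<Phi>' (\<lambda>i. w i + t * r i)) (at t)"
        by (simp add: \<Phi>'_def sum_distrib_left mult_ac)
      show "continuous_on UNIV (\<lambda>t. \<Phi>' (\<lambda>i. w i + t * r i))"
        unfolding \<Phi>'_def by (intro continuous_intros Fd(4))
      have "((\<lambda>t. \<Phi> (\<lambda>i. w i + t * r i) * std_normal_density t) \<longlongrightarrow> 0) Fi" if "(std_normal_density \<longlongrightarrow> 0) Fi" for Fi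
      proof (rule Lim_null_comparison)
        show "\<forall>\<^sub>F t in Fi. norm (\<Phi> (\<lambda>i. w i + t * r i) * std_normal_density t) \<le> A * std_normal_density t"
          using A(2) by (auto simp: \<Phi>_def abs_mult intro!: always_eventually mult_right_mono)
        show "((\<lambda>t. A * std_normal_density t) \<longlongrightarrow> 0) Fi" using tendsto_mult_right_zero[OF that] .
      qed
      then show "((\<lambda>t. \<Phi> (\<lambda>i. w i + t * r i) * std_normal_density t) \<longlongrightarrow> 0) at_top"
        "((\<lambda>t. \<Phi> (\<lambda>i. w i + t * r i) * std_normal_density t) \<longlongrightarrow> 0) at_bot"
        using std_normal_density_tendsto_0 by auto
    next
      show "integrable M (\<lambda>y. V j y * \<Phi> (\<lambda>i. V i y))"
      proof (rule Bochner_Integration.integrable_bound)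
        show "integrable M (\<lambda>y. A * V j y)" using gaussian_vectorD(7)[OF V j] by simp
        show "(\<lambda>y. V j y * \<Phi> (\<lambda>i. V i y)) \<in> borel_measurable M"
          by (intro borel_measurable_times cylindrical_measurable[OF \<Phi>c]) auto
        show "AE y in M. norm (V j y * \<Phi> (\<lambda>i. V i y)) \<le> norm (A * V j y)"
          using A by (intro AE_I2) (auto simp: abs_mult \<Phi>_def mult.commute[of _ "\<bar>V j _\<bar>"] intro!: mult_left_mono)
      qed
      show "integrable M (\<lambda>y. \<Phi>' (\<lambda>i. V i y))"
        by (rule M.integrable_const_bound[where B="\<bar>s\<bar> * (\<Sum>i\<in>I. A * \<bar>r i\<bar>)"])
          (use dB in \<open>auto intro!: cylindrical_measurable[OF \<Phi>'c]\<close>)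
    qed
    have "(\<integral>y. F (Z x y) * h x * V j y \<partial>M) = (\<integral>y. h x * (V j y * \<Phi> (\<lambda>i. V i y)) \<partial>M)"
      by (simp only: \<Phi>_def Z_def mult_ac)
    also have "\<dots> = (\<integral>y. h x * \<Phi>' (\<lambda>i. V i y) \<partial>M)" by (simp only: integral_mult_right_zero eq)
    also have "\<dots> = (\<integral>y. (\<Sum>i\<in>I. (- s * r i) * (h x * D i (Z x y))) \<partial>M)"
      unfolding \<Phi>'_def Z_def sum_distrib_left by (simp only: mult_ac)
    finally show "(\<integral>y. F (Z x y) * h x * V j y \<partial>M) = (\<integral>y. (\<Sum>i\<in>I. (- s * r i) * (h x * D i (Z x y))) \<partial>M)" .
  qed
  also have "\<dots> = (\<Sum>i\<in>I. (- s * r i) * (\<integral>\<omega>. h (fst \<omega>) * D i (Z (fst \<omega>) (snd \<omega>)) \<partial>?MM))"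
  proof -
    have iD: "integrable ?MM (\<lambda>\<omega>. h (fst \<omega>) * D i (Z (fst \<omega>) (snd \<omega>)))" if i: "i \<in> I" for i
      using A hB B0 i mZ[OF Fd(2)[OF i]]
      by (intro P.integrable_const_bound[where B="B * A"]) (auto simp: abs_mult intro!: AE_I2 mult_mono)
    have "(\<integral>x. (\<integral>y. (\<Sum>i\<in>I. (- s * r i) * (h x * D i (Z x y))) \<partial>M) \<partial>M)
      = (\<integral>\<omega>. (\<Sum>i\<in>I. (- s * r i) * (h (fst \<omega>) * D i (Z (fst \<omega>) (snd \<omega>)))) \<partial>?MM)"
      by (subst P.integral_fst'[symmetric]) (auto intro!: Bochner_Integration.integrable_sum Bochner_Integration.integrable_mult_right iD)
    then show ?thesis
      by (subst (asm) Bochner_Integration.integral_sum) (auto intro!: Bochner_Integration.integrable_mult_right iD)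
  qed
  also have "\<dots> = - s * (\<Sum>i\<in>I. (\<integral>x. V j x * V i x \<partial>M) * ?E i)"
    unfolding r_def[symmetric] h_def Z_def sum_distrib_left by (simp only: mult.assoc)
  finally show ?thesis .
qed

text \<open>Let \<open>V'\<close> be an independent copy. The covariance is the expectation of
  \<open>F V * (G V - G V')\<close>, and \<open>G V' - G V\<close> is the integral of the derivative of \<open>G\<close>
  along the rotation \<open>cos t * V + sin t * V'\<close> for \<open>t\<close> from 0 to \<open>pi / 2\<close>. For each
  angle \<open>rotated_ibp\<close> evaluates the expectation as \<open>- sin t\<close> times the sum that the assumption
  bounds by \<open>K\<close>. Estimating \<open>\<bar>sin t\<bar>\<close> by 1 leaves the factor \<open>pi / 2\<close>.\<close>

lemma gaussian_covariance_bound: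
  assumes V: "gaussian_vector M I V" and v: "\<And>j. j \<in> I \<Longrightarrow> (\<integral>x. (V j x)\<^sup>2 \<partial>M) = 1"
    and F: "smooth_functional I F D" and G: "smooth_functional I G E"
    and K: "\<And>c s. c\<^sup>2 + s\<^sup>2 = 1 \<Longrightarrow> \<bar>\<Sum>j\<in>I. \<Sum>i\<in>I. (\<integral>x. V j x * V i x \<partial>M) *
         (\<integral>\<omega>. E j (\<lambda>i. V i (fst \<omega>)) * D i (\<lambda>i. c * V i (fst \<omega>) - s * V i (snd \<omega>)) \<partial>(M \<Otimes>\<^sub>M M))\<bar> \<le> K"
  shows "\<bar>(\<integral>x. F (\<lambda>i. V i x) * G (\<lambda>i. V i x) \<partial>M) - (\<integral>x. F (\<lambda>i. V i x) \<partial>M) * (\<integral>x. G (\<lambda>i. V i x) \<partial>M)\<bar> \<le> pi / 2 * K"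
proof -
  let ?MM = "M \<Otimes>\<^sub>M M"
  interpret M: prob_space M using V by (rule gaussian_vectorD)
  interpret P: pair_prob_space M M ..
  (* the uniform distribution of the angle, which makes Fubini a statement about probability spaces *)
  define U where "U = density lborel (\<lambda>t. ennreal (indicator {0..pi/2} t * (2/pi)))"
  have "prob_space U"
  proof
    have "emeasure U (space U) = (\<integral>\<^sup>+t. ennreal (2/pi) * indicator {0..pi/2} t \<partial>lborel)"
      unfolding U_def by (subst emeasure_density) (auto intro!: nn_integral_cong simp: indicator_def)
    also have "\<dots> = ennreal (2/pi) * ennreal (pi/2)" by (simp add: nn_integral_cmult_indicator)
    also have "\<dots> = 1" by (simp add: ennreal_mult[symmetric])
    finally show "emeasure U (space U) = 1" .
  qed
  then interpret U: prob_space U .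
  have Q: "pair_sigma_finite ?MM U"
    by (rule pair_sigma_finite.intro) (rule P.sigma_finite_measure_axioms, rule U.sigma_finite_measure_axioms)
  have [measurable_cong, simp]: "sets U = sets borel" by (simp add: U_def)
  have I[simp]: "finite I" using V by (rule gaussian_vectorD)
  note mV[measurable] = gaussian_vectorD(5)[OF V]
  note Fd = smooth_functionalD[OF F]
  note Gd = smooth_functionalD[OF G]
  obtain A where A: "A \<ge> 0" "\<And>v. \<bar>F v\<bar> \<le> A" "\<And>i v. i \<in> I \<Longrightarrow> \<bar>D i v\<bar> \<le> A" using smooth_functional_bound[OF F] by blast
  obtain B where B: "B \<ge> 0" "\<And>v. \<bar>G v\<bar> \<le> B" "\<And>i v. i \<in> I \<Longrightarrow> \<bar>E i v\<bar> \<le> B" using smooth_functional_bound[OF G] by blast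
  define W where "W j \<omega> t = - sin t * V j (fst \<omega>) + cos t * V j (snd \<omega>)" for j \<omega> t
  define p where "p \<omega> t = (\<lambda>i. cos t * V i (fst \<omega>) + sin t * V i (snd \<omega>))" for \<omega> t
  define g where "g \<omega> t = (\<Sum>j\<in>I. E j (p \<omega> t) * W j \<omega> t)" for \<omega> t
  have FTC: "(\<integral>t. g \<omega> t \<partial>U) = 2 / pi * (G (\<lambda>i. V i (snd \<omega>)) - G (\<lambda>i. V i (fst \<omega>)))" if "\<omega> \<in> space ?MM" for \<omega>
  proof -
    have cont: "continuous_on UNIV (g \<omega>)"
      unfolding g_def W_def p_def by (intro continuous_intros Gd(4))
    then have mg: "g \<omega> \<in> borel_measurable borel" by (rule borel_measurable_continuous_onI)
    have "(\<integral>t. g \<omega> t \<partial>U) = (\<integral>t. (indicator {0..pi/2} t * (2/pi)) *\<^sub>R g \<omega> t \<partial>lborel)"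
      unfolding U_def using mg by (intro integral_density) auto
    also have "\<dots> = 2/pi * (\<integral>t. indicator {0..pi/2} t *\<^sub>R g \<omega> t \<partial>lborel)"
      by (subst integral_mult_right_zero[symmetric]) (simp add: mult_ac)
    also have "(\<integral>t. indicator {0..pi/2} t *\<^sub>R g \<omega> t \<partial>lborel) = G (p \<omega> (pi/2)) - G (p \<omega> 0)"
    proof (rule integral_FTC_atLeastAtMost)
      show "continuous_on {0..pi/2} (g \<omega>)" using cont continuous_on_subset by blast
      fix t
      have "((\<lambda>t. G (p \<omega> t)) has_real_derivative (\<Sum>j\<in>I. E j (p \<omega> t) * W j \<omega> t)) (at t)"
        by (rule Gd(3)) (auto simp: p_def W_def intro!: derivative_eq_intros)
      then show "((\<lambda>t. G (p \<omega> t)) has_vector_derivative g \<omega> t) (at t within {0..pi/2})"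
        by (simp add: g_def has_real_derivative_iff_has_vector_derivative has_vector_derivative_at_within)
    qed simp
    finally show ?thesis by (simp add: p_def)
  qed
  have mEp: "(\<lambda>z. E j (p (fst z) (snd z))) \<in> borel_measurable (?MM \<Otimes>\<^sub>M U)" if "j \<in> I" for j
    unfolding p_def by (rule cylindrical_measurable[OF Gd(2)[OF that]]) measurable
  have mF: "(\<lambda>z. F (\<lambda>i. V i (fst (fst z)))) \<in> borel_measurable (?MM \<Otimes>\<^sub>M U)"
    by (rule cylindrical_measurable[OF Fd(1)]) measurable
  have iV: "integrable ?MM (\<lambda>\<omega>. A * (B * (\<bar>V j (fst \<omega>)\<bar> + \<bar>V j (snd \<omega>)\<bar>)))" if j: "j \<in> I" for j
  proof -
    note pr = integral_product_fun(1)[OF M.prob_space_axioms M.prob_space_axioms]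
    have "integrable M (\<lambda>x. \<bar>V j x\<bar>)" using gaussian_vectorD(7)[OF V j] by simp
    from pr[OF this, of "\<lambda>_. 1"] pr[OF _ this, of "\<lambda>_. 1"] show ?thesis by simp
  qed
  have mW: "(\<lambda>z. W j (fst z) (snd z)) \<in> borel_measurable (?MM \<Otimes>\<^sub>M U)" if [simp]: "j \<in> I" for j
    unfolding W_def by measurable
  have Wb: "\<bar>W j \<omega> t\<bar> \<le> \<bar>V j (fst \<omega>)\<bar> + \<bar>V j (snd \<omega>)\<bar>" for j \<omega> t
  proof -
    have "\<bar>sin t * V j (fst \<omega>)\<bar> \<le> 1 * \<bar>V j (fst \<omega>)\<bar>" "\<bar>cos t * V j (snd \<omega>)\<bar> \<le> 1 * \<bar>V j (snd \<omega>)\<bar>"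
      unfolding abs_mult by (intro mult_right_mono; simp)+
    then show ?thesis unfolding W_def by linarith
  qed
  have tb: "\<bar>F v * (E j w * W j \<omega> t)\<bar> \<le> A * (B * (\<bar>V j (fst \<omega>)\<bar> + \<bar>V j (snd \<omega>)\<bar>))" if "j \<in> I" for v w j \<omega> t
    unfolding abs_mult using A B that Wb by (intro mult_mono) auto
  have ij: "integrable (?MM \<Otimes>\<^sub>M U) (\<lambda>(\<omega>,t). F (\<lambda>i. V i (fst \<omega>)) * (E j (p \<omega> t) * W j \<omega> t))" if j: "j \<in> I" for j
    unfolding split_beta'
  proof (rule Bochner_Integration.integrable_bound)
    show "integrable (?MM \<Otimes>\<^sub>M U) (\<lambda>z. A * (B * (\<bar>V j (fst (fst z))\<bar> + \<bar>V j (snd (fst z))\<bar>)))"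
      using integral_product_fun(1)[OF P.prob_space_axioms U.prob_space_axioms iV[OF j], of "\<lambda>_. 1"] by simp
    show "(\<lambda>z. F (\<lambda>i. V i (fst (fst z))) * (E j (p (fst z) (snd z)) * W j (fst z) (snd z))) \<in> borel_measurable (?MM \<Otimes>\<^sub>M U)"
      by (intro borel_measurable_times mF mEp mW j)
  qed (use tb[OF j] in \<open>auto intro!: AE_I2 order_trans[OF tb[OF j]]\<close>)
  have ig: "integrable (?MM \<Otimes>\<^sub>M U) (\<lambda>(\<omega>,t). F (\<lambda>i. V i (fst \<omega>)) * g \<omega> t)"
    unfolding g_def sum_distrib_left using ij by (auto simp: split_beta' intro!: Bochner_Integration.integrable_sum)
  have bound: "\<bar>\<integral>\<omega>. F (\<lambda>i. V i (fst \<omega>)) * g \<omega> t \<partial>?MM\<bar> \<le> K" for t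
  proof -
    have ijt: "integrable ?MM (\<lambda>\<omega>. F (\<lambda>i. V i (fst \<omega>)) * (E j (p \<omega> t) * W j \<omega> t))" if j[simp]: "j \<in> I" for j
    proof (rule Bochner_Integration.integrable_bound[OF iV[OF j]])
      show "(\<lambda>\<omega>. F (\<lambda>i. V i (fst \<omega>)) * (E j (p \<omega> t) * W j \<omega> t)) \<in> borel_measurable ?MM"
        unfolding p_def W_def
        by (intro borel_measurable_times cylindrical_measurable[OF Fd(1)] cylindrical_measurable[OF Gd(2)[OF j]]) auto
    qed (auto intro!: AE_I2 order_trans[OF tb[OF j]])
    have "(\<integral>\<omega>. F (\<lambda>i. V i (fst \<omega>)) * g \<omega> t \<partial>?MM) = (\<Sum>j\<in>I. (\<integral>\<omega>. F (\<lambda>i. V i (fst \<omega>)) * (E j (p \<omega> t) * W j \<omega> t) \<partial>?MM))"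
      unfolding g_def sum_distrib_left using ijt by (intro Bochner_Integration.integral_sum) auto
    also have "\<dots> = (\<Sum>j\<in>I. - sin t * (\<Sum>i\<in>I. (\<integral>x. V j x * V i x \<partial>M) *
         (\<integral>\<omega>. E j (\<lambda>i. V i (fst \<omega>)) * D i (\<lambda>i. cos t * V i (fst \<omega>) - sin t * V i (snd \<omega>)) \<partial>?MM)))"
    proof (intro sum.cong refl)
      fix j assume j: "j \<in> I"
      show "(\<integral>\<omega>. F (\<lambda>i. V i (fst \<omega>)) * (E j (p \<omega> t) * W j \<omega> t) \<partial>?MM) = - sin t * (\<Sum>i\<in>I. (\<integral>x. V j x * V i x \<partial>M) *
         (\<integral>\<omega>. E j (\<lambda>i. V i (fst \<omega>)) * D i (\<lambda>i. cos t * V i (fst \<omega>) - sin t * V i (snd \<omega>)) \<partial>?MM))"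
        using rotated_ibp[OF V j v[OF j] F Gd(2)[OF j] B(3)[OF j], of "cos t" "sin t"]
        by (simp add: p_def W_def mult.assoc)
    qed
    also have "\<dots> = - sin t * (\<Sum>j\<in>I. \<Sum>i\<in>I. (\<integral>x. V j x * V i x \<partial>M) *
         (\<integral>\<omega>. E j (\<lambda>i. V i (fst \<omega>)) * D i (\<lambda>i. cos t * V i (fst \<omega>) - sin t * V i (snd \<omega>)) \<partial>?MM))"
      by (rule sum_distrib_left[symmetric])
    finally have "\<bar>\<integral>\<omega>. F (\<lambda>i. V i (fst \<omega>)) * g \<omega> t \<partial>?MM\<bar> = \<bar>sin t\<bar> * \<bar>\<Sum>j\<in>I. \<Sum>i\<in>I. (\<integral>x. V j x * V i x \<partial>M) *
         (\<integral>\<omega>. E j (\<lambda>i. V i (fst \<omega>)) * D i (\<lambda>i. cos t * V i (fst \<omega>) - sin t * V i (snd \<omega>)) \<partial>?MM)\<bar>"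
      by (simp add: abs_mult)
    also have "\<dots> \<le> 1 * K" by (intro mult_mono K) auto
    finally show ?thesis by simp
  qed
  have iF: "integrable M (\<lambda>x. F (\<lambda>i. V i x))"
    by (rule M.integrable_const_bound[where B=A]) (use A in \<open>auto intro!: cylindrical_measurable[OF Fd(1)]\<close>)
  have iG: "integrable M (\<lambda>x. G (\<lambda>i. V i x))"
    by (rule M.integrable_const_bound[where B=B]) (use B in \<open>auto intro!: cylindrical_measurable[OF Gd(1)]\<close>)
  have iFG: "integrable M (\<lambda>x. F (\<lambda>i. V i x) * G (\<lambda>i. V i x))"
    by (rule M.integrable_const_bound[where B="A * B"])
      (use A B in \<open>auto simp: abs_mult intro!: mult_mono borel_measurable_times cylindrical_measurable[OF Gd(1)] cylindrical_measurable[OF Fd(1)]\<close>)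
  note p1 = integral_product_fun[OF M.prob_space_axioms M.prob_space_axioms iF iG]
  have p2: "integrable ?MM (\<lambda>\<omega>. F (\<lambda>i. V i (fst \<omega>)) * G (\<lambda>i. V i (fst \<omega>)))"
    "(\<integral>\<omega>. F (\<lambda>i. V i (fst \<omega>)) * G (\<lambda>i. V i (fst \<omega>)) \<partial>?MM) = (\<integral>x. F (\<lambda>i. V i x) * G (\<lambda>i. V i x) \<partial>M)"
    using integral_product_fun[OF M.prob_space_axioms M.prob_space_axioms iFG, of "\<lambda>_. 1"] by (simp_all add: M.prob_space)
  have "(\<integral>x. F (\<lambda>i. V i x) \<partial>M) * (\<integral>x. G (\<lambda>i. V i x) \<partial>M) - (\<integral>x. F (\<lambda>i. V i x) * G (\<lambda>i. V i x) \<partial>M)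
    = (\<integral>\<omega>. F (\<lambda>i. V i (fst \<omega>)) * G (\<lambda>i. V i (snd \<omega>)) - F (\<lambda>i. V i (fst \<omega>)) * G (\<lambda>i. V i (fst \<omega>)) \<partial>?MM)"
    using p1 p2 by simp
  also have "\<dots> = (\<integral>\<omega>. pi / 2 * (\<integral>t. F (\<lambda>i. V i (fst \<omega>)) * g \<omega> t \<partial>U) \<partial>?MM)"
    by (rule Bochner_Integration.integral_cong) (simp_all add: FTC right_diff_distrib)
  also have "\<dots> = pi / 2 * (\<integral>t. (\<integral>\<omega>. F (\<lambda>i. V i (fst \<omega>)) * g \<omega> t \<partial>?MM) \<partial>U)"
    using pair_sigma_finite.Fubini_integral[OF Q ig] by simp
  finally have eq: "(\<integral>x. F (\<lambda>i. V i x) \<partial>M) * (\<integral>x. G (\<lambda>i. V i x) \<partial>M) - (\<integral>x. F (\<lambda>i. V i x) * G (\<lambda>i. V i x) \<partial>M)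
    = pi / 2 * (\<integral>t. (\<integral>\<omega>. F (\<lambda>i. V i (fst \<omega>)) * g \<omega> t \<partial>?MM) \<partial>U)" .
  have "\<bar>\<integral>t. (\<integral>\<omega>. F (\<lambda>i. V i (fst \<omega>)) * g \<omega> t \<partial>?MM) \<partial>U\<bar>
     \<le> (\<integral>t. \<bar>\<integral>\<omega>. F (\<lambda>i. V i (fst \<omega>)) * g \<omega> t \<partial>?MM\<bar> \<partial>U)"
    by (rule integral_abs_bound)
  also have "\<dots> \<le> (\<integral>t. K \<partial>U)"
    using pair_sigma_finite.integrable_snd[OF Q ig] bound by (intro integral_mono) auto
  also have "\<dots> = K" by (simp add: U.prob_space)
  finally have "\<bar>\<integral>t. (\<integral>\<omega>. F (\<lambda>i. V i (fst \<omega>)) * g \<omega> t \<partial>?MM) \<partial>U\<bar> \<le> K" .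
  then have "pi / 2 * \<bar>\<integral>t. (\<integral>\<omega>. F (\<lambda>i. V i (fst \<omega>)) * g \<omega> t \<partial>?MM) \<partial>U\<bar> \<le> pi / 2 * K" by (rule mult_left_mono) simp
  then have "\<bar>(\<integral>x. F (\<lambda>i. V i x) \<partial>M) * (\<integral>x. G (\<lambda>i. V i x) \<partial>M) - (\<integral>x. F (\<lambda>i. V i x) * G (\<lambda>i. V i x) \<partial>M)\<bar> \<le> pi / 2 * K"
    unfolding eq abs_mult by simp
  then show ?thesis by (simp only: abs_minus_commute)
qed

section \<open>Stein's equation and the total variation distance\<close>

text \<open>On the tail \<open>{x..}\<close> the factor \<open>x\<close> is at most \<open>t\<close>, and
  \<open>t * exp (- t\<^sup>2 / 2)\<close> has an explicit antiderivative.\<close>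

lemma gaussian_tail_bound:
  fixes q :: "real \<Rightarrow> real"
  assumes [measurable]: "q \<in> borel_measurable borel" and q: "\<And>t. \<bar>q t\<bar> \<le> exp (- t\<^sup>2 / 2)" and x: "x \<ge> 0"
  shows "x * \<bar>\<integral>t. indicator {x..} t * q t \<partial>lborel\<bar> \<le> exp (- x\<^sup>2 / 2)"
proof -
  have nn: "(\<integral>\<^sup>+t. ennreal (t * exp (- t\<^sup>2 / 2)) * indicator {x..} t \<partial>lborel) = ennreal (0 - (- exp (- x\<^sup>2 / 2)))"
  proof (rule nn_integral_FTC_atLeast)
    show "((\<lambda>t. - exp (- t\<^sup>2 / 2)) has_real_derivative t * exp (- t\<^sup>2 / 2)) (at t)" for t :: real
      by (auto intro!: derivative_eq_intros simp: power2_eq_square)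
    show "((\<lambda>t::real. - exp (- t\<^sup>2 / 2)) \<longlongrightarrow> 0) at_top" by real_asymp
  qed (use x in auto)
  have hb: "has_bochner_integral lborel (\<lambda>t. indicator {x..} t * (t * exp (- t\<^sup>2 / 2))) (exp (- x\<^sup>2 / 2))"
  proof (rule has_bochner_integral_nn_integral)
    show "AE t in lborel. 0 \<le> indicator {x..} t * (t * exp (- t\<^sup>2 / 2))"
      using x by (auto simp: indicator_def)
    show "(\<integral>\<^sup>+t. ennreal (indicator {x..} t * (t * exp (- t\<^sup>2 / 2))) \<partial>lborel) = ennreal (exp (- x\<^sup>2 / 2))"
      using nn by (simp add: ennreal_mult' ennreal_indicator mult.commute)
  qed auto
  have "x * \<bar>\<integral>t. indicator {x..} t * q t \<partial>lborel\<bar> = \<bar>\<integral>t. x * (indicator {x..} t * q t) \<partial>lborel\<bar>"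
    using x by (simp add: abs_mult)
  also have "\<dots> \<le> (\<integral>t. indicator {x..} t * (t * exp (- t\<^sup>2 / 2)) \<partial>lborel)"
  proof (rule integral_abs_bound_integral)
    show i: "integrable lborel (\<lambda>t. indicator {x..} t * (t * exp (- t\<^sup>2 / 2)))" using hb by (simp add: has_bochner_integral_iff)
    have b: "\<bar>x * (indicator {x..} t * q t)\<bar> \<le> indicator {x..} t * (t * exp (- t\<^sup>2 / 2))" for t
      using q[of t] x by (auto simp: indicator_def abs_mult intro!: mult_mono)
    show "\<bar>x * (indicator {x..} t * q t)\<bar> \<le> indicator {x..} t * (t * exp (- t\<^sup>2 / 2))" for t by (rule b)
    show "integrable lborel (\<lambda>t. x * (indicator {x..} t * q t))"
      by (rule Bochner_Integration.integrable_bound[OF i])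
         (auto intro!: AE_I2 order_trans[OF b] simp del: abs_mult)
  qed
  finally show ?thesis using hb by (simp add: has_bochner_integral_iff)
qed

text \<open>The solution is \<open>exp (x\<^sup>2 / 2)\<close> times the integral up to \<open>x\<close> of the centred right-hand
  side against \<open>exp (- t\<^sup>2 / 2)\<close>. As the total integral vanishes, the integral may be taken over
  either tail; on the tail that does not contain 0 the tail bound gives \<open>\<bar>x * f x\<bar> \<le> 1\<close>, and then the
  equation itself bounds \<open>f'\<close> by 2. Near 0 the solution is trivially bounded.\<close>

lemma stein_equation:
  fixes h :: "real \<Rightarrow> real"
  assumes h: "continuous_on UNIV h" and b: "\<And>x. 0 \<le> h x" "\<And>x. h x \<le> 1"
  obtains f f' C where "\<And>x. (f has_real_derivative f' x) (at x)" "continuous_on UNIV f'"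
    "\<And>x. \<bar>f x\<bar> \<le> C" "\<And>x. \<bar>f' x\<bar> \<le> 2"
    "\<And>x. f' x - x * f x = h x - (\<integral>y. h y \<partial>gauss)"
proof -
  interpret G: prob_space gauss by (rule prob_space_gauss)
  have [measurable]: "h \<in> borel_measurable borel" using h by (rule borel_measurable_continuous_onI)
  have ih: "integrable gauss h" by (rule G.integrable_const_bound[where B=1]) (use b in auto)
  define m where "m = (\<integral>y. h y \<partial>gauss)"
  have m: "0 \<le> m" "m \<le> 1" unfolding m_def using b G.integral_le_const[OF ih] by auto
  have hm: "\<bar>h x - m\<bar> \<le> 1" for x using b[of x] m by linarith
  define e where "e t = exp (- t\<^sup>2 / 2)" for t :: real
  have e_std: "e t = sqrt (2 * pi) * std_normal_density t" for t by (simp add: e_def std_normal_density_def)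
  have ie: "integrable lborel e" unfolding e_std using integrable_normal_density[of 1 0] by simp
  define q where "q t = (h t - m) * e t" for t
  have [measurable]: "e \<in> borel_measurable borel" unfolding e_def by measurable
  have [measurable]: "q \<in> borel_measurable borel" unfolding q_def by measurable
  have e0: "e t > 0" for t by (simp add: e_def)
  have qe: "\<bar>q t\<bar> \<le> e t" for t unfolding q_def abs_mult using hm[of t] e0[of t] mult_right_mono[of "\<bar>h t - m\<bar>" 1 "e t"] by simp
  have iq: "integrable lborel q" by (rule Bochner_Integration.integrable_bound[OF ie]) (use qe e0 in \<open>auto intro!: AE_I2 simp: less_imp_le\<close>)
  have q0: "(\<integral>t. q t \<partial>lborel) = 0"
  proof -
    have "(\<integral>t. h t - m \<partial>gauss) = 0" using ih G.prob_space by (simp add: m_def)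
    then have "(\<integral>t. std_normal_density t * (h t - m) \<partial>lborel) = 0" by (subst (asm) integral_gauss) auto
    moreover have "q = (\<lambda>t. sqrt (2 * pi) * (std_normal_density t * (h t - m)))" by (auto simp: q_def e_std)
    ultimately show ?thesis by simp
  qed
  define P where "P x = (\<integral>t. indicator {..x} t * q t \<partial>lborel)" for x
  have ind: "integrable lborel (\<lambda>t. indicator S t * q t)" if [measurable]: "S \<in> sets borel" for S
    using integrable_mult_indicator[OF _ iq, of S] by simp
  have dP: "(P has_real_derivative q x) (at x)" for x
  proof -
    (* near x only the integral over {x - 1..u} varies with u *)
    define K where "K = (\<integral>t. indicator {..<x-1} t * q t \<partial>lborel)"
    have cq: "continuous_on S q" for S unfolding q_def e_def
      by (intro continuous_intros continuous_on_subset[OF h]) auto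
    have "((\<lambda>u. integral {x-1..u} q) has_vector_derivative q x) (at x within {x-1..x+1})"
      by (rule integral_has_vector_derivative[OF cq]) auto
    then have d: "((\<lambda>u. integral {x-1..u} q) has_real_derivative q x) (at x)"
      by (simp add: has_real_derivative_iff_has_vector_derivative at_within_Icc_at)
    have dK: "((\<lambda>u. K + integral {x-1..u} q) has_real_derivative q x) (at x)"
      using DERIV_add[OF DERIV_const[of K] d] by simp
    have eqP: "K + integral {x-1..u} q = P u" if "u \<in> {x - 1<..}" for u
    proof -
      have "(\<lambda>t. indicator {..u} t * q t) = (\<lambda>t. indicator {..<x-1} t * q t + indicator {x-1..u} t * q t)"
        using that by (auto simp: indicator_def fun_eq_iff)
      then have "P u = K + (\<integral>t. indicator {x-1..u} t * q t \<partial>lborel)"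
        unfolding P_def K_def using ind by simp
      also have "(\<integral>t. indicator {x-1..u} t * q t \<partial>lborel) = integral {x-1..u} q"
        using set_borel_integral_eq_integral(2)[of "{x-1..u}" q] ind[of "{x-1..u}"]
        by (simp add: set_lebesgue_integral_def set_integrable_def)
      finally show ?thesis by simp
    qed
    show ?thesis
      by (rule has_field_derivative_transform_within_open[OF dK, where S="{x-1<..}"]) (use eqP in auto)
  qed
  have Pright: "P x = - (\<integral>t. indicator {x..} t * (indicator {x<..} t * q t) \<partial>lborel)" for x
  proof -
    have "q = (\<lambda>t. indicator {..x} t * q t + indicator {x..} t * (indicator {x<..} t * q t))"
      by (auto simp: indicator_def fun_eq_iff)
    moreover have "integrable lborel (\<lambda>t. indicator {x..} t * (indicator {x<..} t * q t))"
      using integrable_mult_indicator[OF _ ind, of "{x..}" "{x<..}"] by simp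
    ultimately have "(\<integral>t. q t \<partial>lborel) = P x + (\<integral>t. indicator {x..} t * (indicator {x<..} t * q t) \<partial>lborel)"
      unfolding P_def using ind[of "{..x}"] by (metis (no_types, lifting) Bochner_Integration.integral_add Bochner_Integration.integral_cong atMost_borel)
    then show ?thesis using q0 by simp
  qed
  have xP: "\<bar>x * P x\<bar> \<le> e x" for x
  proof (cases "x \<ge> 0")
    case True
    have "x * \<bar>\<integral>t. indicator {x..} t * (indicator {x<..} t * q t) \<partial>lborel\<bar> \<le> exp (- x\<^sup>2 / 2)"
      by (rule gaussian_tail_bound[OF _ _ True]) (use qe e0 in \<open>auto simp: indicator_def e_def\<close>)
    then show ?thesis unfolding Pright abs_mult using True by (simp add: e_def)
  next
    case False
    have "P x = (\<integral>t. indicator {..x} (-t) * q (-t) \<partial>lborel)"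
      unfolding P_def using lborel_integral_real_affine[of "-1" "\<lambda>t. indicator {..x} t * q t" 0] by simp
    also have "\<dots> = (\<integral>t. indicator {-x..} t * q (-t) \<partial>lborel)"
      by (intro Bochner_Integration.integral_cong) (auto simp: indicator_def)
    finally have "(-x) * \<bar>P x\<bar> \<le> exp (- (-x)\<^sup>2 / 2)"
      using gaussian_tail_bound[of "\<lambda>t. q (-t)" "-x"] False qe[of "- _"] by (auto simp: e_def)
    then show ?thesis unfolding abs_mult using False by (simp add: e_def)
  qed
  define f where "f x = P x / e x" for x
  define f' where "f' x = x * f x + (h x - m)" for x
  have df: "(f has_real_derivative f' x) (at x)" for x
  proof -
    have de: "(e has_real_derivative - x * e x) (at x)"
      unfolding e_def by (auto intro!: derivative_eq_intros simp: power2_eq_square)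
    have "(f has_real_derivative (q x * e x - P x * (- x * e x)) / (e x * e x)) (at x)"
      unfolding f_def using e0[of x] by (intro DERIV_divide dP de) simp
    moreover have "(q x * e x - P x * (- x * e x)) / (e x * e x) = f' x"
      using e0[of x] by (simp add: f'_def f_def q_def field_simps)
    ultimately show ?thesis by simp
  qed
  have xf: "\<bar>x * f x\<bar> \<le> 1" for x
    using xP[of x] e0[of x] by (simp add: f_def abs_mult)
  show ?thesis
  proof (rule that[of f f' "1 + exp (1/2) * (\<integral>t. e t \<partial>lborel)"])
    show "continuous_on UNIV f'"
    proof -
      have "continuous_on UNIV f" using df by (rule continuous_on_of_derivative)
      then show ?thesis unfolding f'_def by (intro continuous_intros h)
    qed
    show "\<bar>f' x\<bar> \<le> 2" for x unfolding f'_def using xf[of x] hm[of x] by linarith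
    show "f' x - x * f x = h x - (\<integral>y. h y \<partial>gauss)" for x by (simp add: f'_def m_def)
    have ie0: "0 \<le> (\<integral>t. e t \<partial>lborel)" using e0 by (simp add: less_imp_le)
    show "\<bar>f x\<bar> \<le> 1 + exp (1/2) * (\<integral>t. e t \<partial>lborel)" for x
    proof (cases "\<bar>x\<bar> \<ge> 1")
      case True
      then have "1 * \<bar>f x\<bar> \<le> \<bar>x\<bar> * \<bar>f x\<bar>" by (intro mult_right_mono) auto
      then show ?thesis using xf[of x] ie0 by (simp add: abs_mult) (smt (verit) exp_gt_zero mult_nonneg_nonneg)
    next
      case False
      have "x\<^sup>2 \<le> 1" using False by (simp add: abs_square_le_1)
      then have ex: "e x \<ge> exp (-1/2)" by (simp add: e_def)
      have "\<bar>P x\<bar> \<le> (\<integral>t. e t \<partial>lborel)"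
        unfolding P_def by (rule integral_abs_bound_integral[OF ind ie]) (use qe e0 in \<open>auto simp: indicator_def less_imp_le\<close>)
      then have "\<bar>f x\<bar> \<le> (\<integral>t. e t \<partial>lborel) / exp (-1/2)"
        unfolding f_def abs_divide using ex e0[of x] ie0 by (intro frac_le) auto
      then show ?thesis by (simp add: exp_minus field_simps)
    qed
  qed (rule df)
qed

text \<open>The indicator of a compact set is the limit of the Lipschitz functions
  \<open>max 0 (1 - n * infdist x C)\<close>, and inner regularity passes from compact sets to Borel
  sets. As the bound \<open>K\<close> does not depend on the Lipschitz constant, nothing is lost.\<close>

lemma tv_from_lipschitz:
  fixes \<mu> \<nu> :: "real measure"
  assumes mu: "prob_space \<mu>" and nu: "prob_space \<nu>" and s: "sets \<mu> = sets borel" "sets \<nu> = sets borel"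
    and L: "\<And>h L. (\<And>x y. \<bar>h x - h y\<bar> \<le> L * \<bar>x - y\<bar>) \<Longrightarrow> (\<And>x. 0 \<le> h x) \<Longrightarrow> (\<And>x. h x \<le> 1) \<Longrightarrow>
       \<bar>(\<integral>x. h x \<partial>\<mu>) - (\<integral>x. h x \<partial>\<nu>)\<bar> \<le> K"
    and B: "B \<in> sets borel"
  shows "\<bar>measure \<mu> B - measure \<nu> B\<bar> \<le> K"
proof -
  interpret mu: prob_space \<mu> by fact
  interpret nu: prob_space \<nu> by fact
  note [measurable_cong, simp] = s
  have closed: "\<bar>measure \<mu> C - measure \<nu> C\<bar> \<le> K" if C: "compact C" for C
  proof (cases "C = {}")
    case True
    have "\<bar>(\<integral>x. 0 \<partial>\<mu>) - (\<integral>x. 0 \<partial>\<nu>)\<bar> \<le> K" by (rule L[of _ 0]) auto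
    then show ?thesis using True by simp
  next
    case False
    have [measurable]: "C \<in> sets borel" using C by (simp add: borel_compact)
    define h where "h n x = max 0 (1 - real n * infdist x C)" for n x
    have lip: "\<bar>h n x - h n y\<bar> \<le> real n * \<bar>x - y\<bar>" for n x y
    proof -
      have "\<bar>infdist x C - infdist y C\<bar> \<le> dist x y" by (rule infdist_triangle_abs)
      then have "real n * \<bar>infdist x C - infdist y C\<bar> \<le> real n * \<bar>x - y\<bar>" by (intro mult_left_mono) (auto simp: dist_real_def)
      then have "\<bar>real n * infdist x C - real n * infdist y C\<bar> \<le> real n * \<bar>x - y\<bar>"
        by (simp add: abs_mult flip: right_diff_distrib)
      then show ?thesis unfolding h_def by linarith
    qed
    have hb: "0 \<le> h n x" "h n x \<le> 1" for n x
      using infdist_nonneg[of x C] by (auto simp: h_def)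
    have [measurable]: "h n \<in> borel_measurable borel" for n
      unfolding h_def by (intro borel_measurable_continuous_onI continuous_intros)
    have lim: "(\<lambda>n. h n x) \<longlonglongrightarrow> indicator C x" for x
    proof (cases "x \<in> C")
      case True then show ?thesis by (simp add: h_def infdist_zero)
    next
      case F: False
      have "infdist x C > 0" using C F False compact_imp_closed in_closed_iff_infdist_zero[of C x] infdist_nonneg[of x C] by fastforce
      then obtain k :: nat where k: "1 < real k * infdist x C" using reals_Archimedean3 by blast
      have "h n x = 0" if "n \<ge> k" for n
      proof -
        have "real k * infdist x C \<le> real n * infdist x C" using that by (intro mult_right_mono) (auto simp: infdist_nonneg)
        then show ?thesis using k by (simp add: h_def)
      qed
      then have "\<forall>\<^sub>F n in sequentially. h n x = indicator C x"
        using F by (auto simp: eventually_sequentially intro!: exI[of _ k])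
      then show ?thesis by (rule tendsto_eventually)
    qed
    have "(\<lambda>n. \<integral>x. h n x \<partial>\<mu>) \<longlonglongrightarrow> (\<integral>x. indicator C x \<partial>\<mu>)"
      by (rule integral_dominated_convergence[where w="\<lambda>_. 1"]) (use hb lim in auto)
    moreover have "(\<lambda>n. \<integral>x. h n x \<partial>\<nu>) \<longlonglongrightarrow> (\<integral>x. indicator C x \<partial>\<nu>)"
      by (rule integral_dominated_convergence[where w="\<lambda>_. 1"]) (use hb lim in auto)
    ultimately have "(\<lambda>n. \<bar>(\<integral>x. h n x \<partial>\<mu>) - (\<integral>x. h n x \<partial>\<nu>)\<bar>) \<longlonglongrightarrow> \<bar>measure \<mu> C - measure \<nu> C\<bar>"
      by (auto intro!: tendsto_intros)
    then show ?thesis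
      by (rule LIMSEQ_le_const2) (use L[OF lip hb] in auto)
  qed
  have one: "measure a B \<le> measure b B + K" if p: "prob_space a" "prob_space b" "sets a = sets borel" "sets b = sets borel"
     and c: "\<And>C. compact C \<Longrightarrow> \<bar>measure a C - measure b C\<bar> \<le> K" and B: "B \<in> sets borel" for a b :: "real measure" and B
  proof (rule field_le_epsilon)
    fix e :: real assume e: "e > 0"
    interpret a: prob_space a by fact
    interpret b: prob_space b by fact
    have sa: "emeasure a (space a) \<noteq> \<infinity>" by simp
    have sup: "emeasure a B = (SUP C \<in> {C. C \<subseteq> B \<and> compact C}. emeasure a C)"
      using inner_regular[OF p(3) sa B] .
    have "\<exists>C. C \<subseteq> B \<and> compact C \<and> measure a B - e < measure a C"
    proof (rule ccontr)
      assume n: "\<not> ?thesis"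
      have "(SUP C \<in> {C. C \<subseteq> B \<and> compact C}. emeasure a C) \<le> ennreal (max 0 (measure a B - e))"
        using n by (intro SUP_least) (auto simp: a.emeasure_eq_measure not_less intro!: ennreal_leI)
      then have "ennreal (measure a B) \<le> ennreal (max 0 (measure a B - e))"
        unfolding sup[symmetric] unfolding a.emeasure_eq_measure .
      then have "measure a B \<le> max 0 (measure a B - e)"
        by (subst (asm) ennreal_le_iff) simp_all
      then have "measure a B = 0" using e measure_nonneg[of a B] by linarith
      then have "measure a B - e < measure a {}" using e by simp
      then have "{} \<subseteq> B \<and> compact {} \<and> measure a B - e < measure a {}" by simp
      then have "\<exists>C. C \<subseteq> B \<and> compact C \<and> measure a B - e < measure a C" by (rule exI)
      with n show False by contradiction
    qed
    then obtain C where C: "C \<subseteq> B" "compact C" "measure a B - e < measure a C" by blast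
    have "measure b C \<le> measure b B" using C B p by (intro b.finite_measure_mono) auto
    then show "measure a B \<le> measure b B + K + e" using c[OF C(2)] C(3) by linarith
  qed
  have "measure \<mu> B \<le> measure \<nu> B + K" by (rule one[OF mu nu s closed B])
  moreover have "measure \<nu> B \<le> measure \<mu> B + K"
    by (rule one[OF nu mu s(2,1) _ B]) (use closed in \<open>simp add: abs_minus_commute\<close>)
  ultimately show ?thesis by linarith
qed

section \<open>Variance of quadratic functionals\<close>

lemma gauss_law_integral:
  assumes "distr M borel Y = gauss" "Y \<in> borel_measurable M" "f \<in> borel_measurable borel"
  shows "(\<integral>x. f (Y x) \<partial>M) = (\<integral>x. f x \<partial>gauss :: real)" "integrable M (\<lambda>x. f (Y x)) \<longleftrightarrow> integrable gauss (f :: real \<Rightarrow> real)"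
  using integral_distr[of Y M borel f] integrable_distr_eq[of Y M borel f] assms by simp_all

text \<open>Hoelder's inequality in the form of the inequality between arithmetic and geometric means: the four
  factors enter only through their fourth moments, whatever their joint law is. This is where
  the exponent 4 of the Sobolev space comes from.\<close>

lemma four_product_bound:
  assumes P: "prob_space M" and law: "\<And>i. i < (4::nat) \<Longrightarrow> distr M borel (Y i) = gauss" "\<And>i. i < (4::nat) \<Longrightarrow> Y i \<in> borel_measurable M"
    and [measurable]: "p \<in> borel_measurable borel" "q \<in> borel_measurable borel"
    and b: "\<And>x. \<bar>p x\<bar> \<le> (B::real)" "\<And>x. \<bar>q x\<bar> \<le> B"
  shows "(\<integral>x. \<bar>q (Y 0 x) * p (Y 1 x) * (q (Y 2 x) * p (Y 3 x))\<bar> \<partial>M) \<le> ((\<integral>x. (q x) ^ 4 \<partial>gauss) + (\<integral>x. (p x) ^ 4 \<partial>gauss)) / 2"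
proof -
  interpret prob_space M by fact
  have [measurable]: "Y 0 \<in> borel_measurable M" "Y 1 \<in> borel_measurable M" "Y 2 \<in> borel_measurable M" "Y 3 \<in> borel_measurable M"
    using law(2) by simp_all
  have amgm: "\<bar>a * b * (c * d)\<bar> \<le> (a^4 + b^4 + c^4 + d^4) / 4" for a b c d :: real
  proof -
    note s = two_abs_mult_le
    have lin: "x \<le> (e + f + g + h) / 4" if "2 * x \<le> y + z" "2 * y \<le> e + f" "2 * z \<le> g + h" for x y z e f g h :: real
    proof -
      have "4 * x \<le> 2 * y + 2 * z" using that(1) by simp
      also have "\<dots> \<le> e + f + g + h" using that by simp
      finally show ?thesis by simp
    qed
    have "2 * \<bar>(a * b) * (c * d)\<bar> \<le> a\<^sup>2 * b\<^sup>2 + c\<^sup>2 * d\<^sup>2" using s[of "a*b" "c*d"] by (simp add: power_mult_distrib)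
    moreover have "2 * (a\<^sup>2 * b\<^sup>2) \<le> a^4 + b^4" using s[of "a\<^sup>2" "b\<^sup>2"] by simp
    moreover have "2 * (c\<^sup>2 * d\<^sup>2) \<le> c^4 + d^4" using s[of "c\<^sup>2" "d\<^sup>2"] by simp
    ultimately show ?thesis by (rule lin)
  qed
  have b4: "(f x)^4 \<le> B^4" if "\<bar>f x\<bar> \<le> B" for f :: "real \<Rightarrow> real" and x
    using power_mono[OF that, of 4] by simp
  interpret G: prob_space gauss by (rule prob_space_gauss)
  have ig: "integrable gauss (\<lambda>x. (p x)^4)" "integrable gauss (\<lambda>x. (q x)^4)"
    using b by (auto intro!: G.integrable_const_bound[where B="B^4"] AE_I2 b4)
  have q0: "integrable M (\<lambda>x. (q (Y 0 x))^4)" "(\<integral>x. (q (Y 0 x))^4 \<partial>M) = (\<integral>x. (q x) ^ 4 \<partial>gauss)"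
    using gauss_law_integral[OF law(1)[of 0] law(2)[of 0], of "\<lambda>x. (q x)^4"] ig by simp_all
  have p1: "integrable M (\<lambda>x. (p (Y 1 x))^4)" "(\<integral>x. (p (Y 1 x))^4 \<partial>M) = (\<integral>x. (p x) ^ 4 \<partial>gauss)"
    using gauss_law_integral[OF law(1)[of 1] law(2)[of 1], of "\<lambda>x. (p x)^4"] ig by simp_all
  have q2: "integrable M (\<lambda>x. (q (Y 2 x))^4)" "(\<integral>x. (q (Y 2 x))^4 \<partial>M) = (\<integral>x. (q x) ^ 4 \<partial>gauss)"
    using gauss_law_integral[OF law(1)[of 2] law(2)[of 2], of "\<lambda>x. (q x)^4"] ig by simp_all
  have p3: "integrable M (\<lambda>x. (p (Y 3 x))^4)" "(\<integral>x. (p (Y 3 x))^4 \<partial>M) = (\<integral>x. (p x) ^ 4 \<partial>gauss)"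
    using gauss_law_integral[OF law(1)[of 3] law(2)[of 3], of "\<lambda>x. (p x)^4"] ig by simp_all
  have i: "integrable M (\<lambda>x. ((q (Y 0 x))^4 + (p (Y 1 x))^4 + (q (Y 2 x))^4 + (p (Y 3 x))^4) / 4)"
    using q0 p1 q2 p3 by simp
  have "(\<integral>x. \<bar>q (Y 0 x) * p (Y 1 x) * (q (Y 2 x) * p (Y 3 x))\<bar> \<partial>M) \<le> (\<integral>x. ((q (Y 0 x))^4 + (p (Y 1 x))^4 + (q (Y 2 x))^4 + (p (Y 3 x))^4) / 4 \<partial>M)"
    by (rule integral_mono'[OF i]) (use amgm in auto)
  also have "\<dots> = ((\<integral>x. (q x) ^ 4 \<partial>gauss) + (\<integral>x. (p x) ^ 4 \<partial>gauss)) / 2"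
    using q0 p1 q2 p3 by simp
  finally show ?thesis .
qed

text \<open>Symmetry of \<open>t\<close> merges the two terms of the product rule, whence the factor 2.\<close>

lemma smooth_functional_quadratic:
  assumes L: "finite L" and t: "\<And>k l. t k l = t l k"
    and p: "\<And>x. (p has_real_derivative q x) (at x)" and q: "continuous_on UNIV q"
    and b: "\<And>x. \<bar>p x\<bar> \<le> B" "\<And>x. \<bar>q x\<bar> \<le> B"
  shows "smooth_functional L (\<lambda>v. \<Sum>k\<in>L. \<Sum>l\<in>L. t k l * (p (v k) * p (v l))) (\<lambda>k v. 2 * (\<Sum>l\<in>L. t k l * (q (v k) * p (v l))))"
proof -
  have cp: "continuous_on UNIV p" using p by (rule continuous_on_of_derivative)
  have [measurable]: "p \<in> borel_measurable borel" "q \<in> borel_measurable borel"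
    using cp q by (auto intro: borel_measurable_continuous_onI)
  have B0: "0 \<le> B" using b(1)[of 0] by linarith
  define C where "C = (\<Sum>k\<in>L. \<Sum>l\<in>L. \<bar>t k l\<bar> * (B * B))"
  have bd: "\<bar>\<Sum>l\<in>L. t k l * (x l * y l)\<bar> \<le> (\<Sum>l\<in>L. \<bar>t k l\<bar> * (B * B))" if "\<And>l. \<bar>x l\<bar> \<le> B" "\<And>l. \<bar>y l\<bar> \<le> B" for k x y
    by (intro order_trans[OF sum_abs] sum_mono) (auto simp: abs_mult intro!: mult_left_mono mult_mono that B0)
  have C0: "(\<Sum>l\<in>L. \<bar>t k l\<bar> * (B * B)) \<le> C" if "k \<in> L" for k
    unfolding C_def by (rule member_le_sum[OF that _ L]) (auto intro!: sum_nonneg mult_nonneg_nonneg B0)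
  have C1: "0 \<le> C" unfolding C_def by (auto intro!: sum_nonneg mult_nonneg_nonneg B0)
  show ?thesis
    unfolding smooth_functional_def
  proof (intro conjI ballI allI impI exI)
    show "cylindrical L (\<lambda>v. \<Sum>k\<in>L. \<Sum>l\<in>L. t k l * (p (v k) * p (v l)))"
      by (intro cylindrical_intros cylindrical_coordinate) auto
    show "cylindrical L (\<lambda>v. 2 * (\<Sum>l\<in>L. t k l * (q (v k) * p (v l))))" if "k \<in> L" for k
      by (intro cylindrical_intros cylindrical_coordinate that) auto
    show "\<bar>\<Sum>k\<in>L. \<Sum>l\<in>L. t k l * (p (v k) * p (v l))\<bar> \<le> 2 * C" for v
    proof -
      have "\<bar>\<Sum>k\<in>L. \<Sum>l\<in>L. t k l * (p (v k) * p (v l))\<bar> \<le> C" unfolding C_def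
        by (intro order_trans[OF sum_abs] sum_mono bd b)
      then show ?thesis using C1 by linarith
    qed
    show "\<bar>2 * (\<Sum>l\<in>L. t k l * (q (v k) * p (v l)))\<bar> \<le> 2 * C" if "k \<in> L" for k v
      using order_trans[OF bd[of "\<lambda>_. q (v k)" "\<lambda>l. p (v l)" k] C0[OF that]] b by (simp add: abs_mult)
  next
    fix \<gamma> :: "real \<Rightarrow> 'a \<Rightarrow> real" and \<gamma>' s
    assume g: "\<forall>i\<in>L. ((\<lambda>s. \<gamma> s i) has_real_derivative \<gamma>' i) (at s)"
    have pg: "((\<lambda>s. p (\<gamma> s i)) has_real_derivative q (\<gamma> s i) * \<gamma>' i) (at s)" if "i \<in> L" for i
      using DERIV_chain2[OF p] g that by blast
    have "((\<lambda>s. \<Sum>k\<in>L. \<Sum>l\<in>L. t k l * (p (\<gamma> s k) * p (\<gamma> s l))) has_real_derivative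
        (\<Sum>k\<in>L. \<Sum>l\<in>L. t k l * ((q (\<gamma> s k) * \<gamma>' k) * p (\<gamma> s l) + (q (\<gamma> s l) * \<gamma>' l) * p (\<gamma> s k)))) (at s)"
      by (intro DERIV_sum DERIV_cmult DERIV_mult pg)
    also have "(\<Sum>k\<in>L. \<Sum>l\<in>L. t k l * ((q (\<gamma> s k) * \<gamma>' k) * p (\<gamma> s l) + (q (\<gamma> s l) * \<gamma>' l) * p (\<gamma> s k)))
      = (\<Sum>k\<in>L. \<Sum>l\<in>L. t k l * ((q (\<gamma> s k) * \<gamma>' k) * p (\<gamma> s l))) + (\<Sum>k\<in>L. \<Sum>l\<in>L. t k l * ((q (\<gamma> s l) * \<gamma>' l) * p (\<gamma> s k)))"
      by (simp only: distrib_left sum.distrib)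
    also have "(\<Sum>k\<in>L. \<Sum>l\<in>L. t k l * ((q (\<gamma> s l) * \<gamma>' l) * p (\<gamma> s k))) = (\<Sum>k\<in>L. \<Sum>l\<in>L. t k l * ((q (\<gamma> s k) * \<gamma>' k) * p (\<gamma> s l)))"
      by (subst sum.swap) (simp only: t)
    also have "(\<Sum>k\<in>L. \<Sum>l\<in>L. t k l * ((q (\<gamma> s k) * \<gamma>' k) * p (\<gamma> s l))) + (\<Sum>k\<in>L. \<Sum>l\<in>L. t k l * ((q (\<gamma> s k) * \<gamma>' k) * p (\<gamma> s l)))
       = (\<Sum>i\<in>L. 2 * (\<Sum>l\<in>L. t i l * (q (\<gamma> s i) * p (\<gamma> s l))) * \<gamma>' i)"
      by (simp only: mult_2[symmetric] sum_distrib_left sum_distrib_right mult_ac)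
    finally show "((\<lambda>s. \<Sum>k\<in>L. \<Sum>l\<in>L. t k l * (p (\<gamma> s k) * p (\<gamma> s l))) has_real_derivative
        (\<Sum>i\<in>L. 2 * (\<Sum>l\<in>L. t i l * (q (\<gamma> s i) * p (\<gamma> s l))) * \<gamma>' i)) (at s)" .
  next
    fix \<gamma> :: "real \<Rightarrow> 'a \<Rightarrow> real" and k
    assume g: "\<forall>i\<in>L. continuous_on UNIV (\<lambda>s. \<gamma> s i)" and k: "k \<in> L"
    have "continuous_on UNIV (\<lambda>s. p (\<gamma> s i))" "continuous_on UNIV (\<lambda>s. q (\<gamma> s i))" if "i \<in> L" for i
      using continuous_on_compose2[OF cp, of UNIV "\<lambda>s. \<gamma> s i"] continuous_on_compose2[OF q, of UNIV "\<lambda>s. \<gamma> s i"] g that by auto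
    then show "continuous_on UNIV (\<lambda>s. 2 * (\<Sum>l\<in>L. t k l * (q (\<gamma> s k) * p (\<gamma> s l))))"
      using k by (intro continuous_intros)
  qed
qed

text \<open>The covariance inequality with \<open>F = G\<close>. Every term is a product of two coefficients
  \<open>t\<close>, one covariance of the vector, and the expectation of a product of four functions of
  standard normal variables. Summing over all but one of the four indices costs a row sum each
  time; only the last summation contributes the number of coordinates.\<close>

lemma quadratic_variance_bound:
  fixes V :: "'k \<Rightarrow> 'a \<Rightarrow> real"
  assumes V: "gaussian_vector M L V" and v: "\<And>k. k \<in> L \<Longrightarrow> (\<integral>x. (V k x)\<^sup>2 \<partial>M) = 1"
    and R: "\<And>k. k \<in> L \<Longrightarrow> (\<Sum>l\<in>L. \<bar>\<integral>x. V k x * V l x \<partial>M\<bar>) \<le> S2"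
    and t: "\<And>k l. t k l = t l k" "\<And>k. k \<in> L \<Longrightarrow> (\<Sum>l\<in>L. \<bar>t k l\<bar>) \<le> S1" and S: "0 \<le> S1"
    and p: "\<And>x. (p has_real_derivative q x) (at x)" and q: "continuous_on UNIV q"
    and b: "\<And>x. \<bar>p x\<bar> \<le> B" "\<And>x. \<bar>q x\<bar> \<le> B"
  defines "T \<equiv> \<lambda>x. \<Sum>k\<in>L. \<Sum>l\<in>L. t k l * (p (V k x) * p (V l x))"
    and "K \<equiv> ((\<integral>x. (q x) ^ 4 \<partial>gauss) + (\<integral>x. (p x) ^ 4 \<partial>gauss)) / 2"
  shows "(\<integral>x. (T x)\<^sup>2 \<partial>M) - (\<integral>x. T x \<partial>M)\<^sup>2 \<le> pi / 2 * (4 * S1\<^sup>2 * S2 * card L * K)"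
proof -
  let ?MM = "M \<Otimes>\<^sub>M M"
  interpret M: prob_space M using V by (rule gaussian_vectorD)
  interpret P: pair_prob_space M M ..
  have L[simp]: "finite L" using V by (rule gaussian_vectorD)
  note mV[measurable] = gaussian_vectorD(5)[OF V]
  have cp: "continuous_on UNIV p" using p by (rule continuous_on_of_derivative)
  have [measurable]: "p \<in> borel_measurable borel" "q \<in> borel_measurable borel"
    using cp q by (auto intro: borel_measurable_continuous_onI)
  have B0: "0 \<le> B" using b(1)[of 0] by linarith
  have K0: "0 \<le> K" unfolding K_def by simp
  note sm = smooth_functional_quadratic[OF L t(1) p q b]
  have "\<bar>(\<integral>x. T x * T x \<partial>M) - (\<integral>x. T x \<partial>M) * (\<integral>x. T x \<partial>M)\<bar> \<le> pi / 2 * (4 * S1\<^sup>2 * S2 * card L * K)"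
    unfolding T_def
  proof (rule gaussian_covariance_bound[OF V v sm sm])
    fix c s :: real assume cs: "c\<^sup>2 + s\<^sup>2 = 1"
    define W where "W k \<omega> = c * V k (fst \<omega>) - s * V k (snd \<omega>)" for k \<omega>
    define U where "U k \<omega> = V k (fst \<omega>)" for k and \<omega> :: "'a \<times> 'a"
    have gW: "gaussian_vector ?MM L W" "\<And>k. k \<in> L \<Longrightarrow> (\<integral>\<omega>. (W k \<omega>)\<^sup>2 \<partial>?MM) = 1"
      using gaussian_vector_mix[OF V L, where \<pi>="\<lambda>k. k" and \<alpha>="\<lambda>_. c" and \<beta>="\<lambda>_. -s"] v cs unfolding W_def by (auto simp: power2_eq_square)
    have gU: "gaussian_vector ?MM L U" "\<And>k. k \<in> L \<Longrightarrow> (\<integral>\<omega>. (U k \<omega>)\<^sup>2 \<partial>?MM) = 1"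
      using gaussian_vector_mix[OF V L, where \<pi>="\<lambda>k. k" and \<alpha>="\<lambda>_. 1" and \<beta>="\<lambda>_. 0"] v unfolding U_def by (auto simp: power2_eq_square)
    have [measurable]: "k \<in> L \<Longrightarrow> W k \<in> borel_measurable ?MM" "k \<in> L \<Longrightarrow> U k \<in> borel_measurable ?MM" for k
      unfolding W_def U_def by simp_all
    have four: "(\<integral>\<omega>. \<bar>q (U k \<omega>) * p (U a \<omega>) * (q (W l \<omega>) * p (W b \<omega>))\<bar> \<partial>?MM) \<le> K" if "k \<in> L" "a \<in> L" "l \<in> L" "b \<in> L" for k a l b
      using four_product_bound[OF P.prob_space_axioms, of "\<lambda>i::nat. if i = 0 then U k else if i = 1 then U a else if i = 2 then W l else W b" p q B]
        gaussian_vector_std_normal[OF gU(1) _ gU(2)] gaussian_vector_std_normal[OF gW(1) _ gW(2)] that b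
      unfolding K_def by auto
    have i4: "integrable ?MM (\<lambda>\<omega>. q (U k \<omega>) * p (U a \<omega>) * (q (W l \<omega>) * p (W b \<omega>)))" if "k \<in> L" "a \<in> L" "l \<in> L" "b \<in> L" for k a l b
      by (rule P.integrable_const_bound[where B="B * B * (B * B)"])
         (use that B0 b in \<open>auto simp: abs_mult intro!: AE_I2 mult_mono\<close>)
    define DT where "DT k w = 2 * (\<Sum>l\<in>L. t k l * (q (w k) * p (w l)))" for k and w :: "'k \<Rightarrow> real"
    have term_b: "\<bar>\<integral>\<omega>. DT k (\<lambda>i. U i \<omega>) * DT l (\<lambda>i. W i \<omega>) \<partial>?MM\<bar> \<le> 4 * S1\<^sup>2 * K" if kl: "k \<in> L" "l \<in> L" for k l
    proof -
      have "(\<integral>\<omega>. DT k (\<lambda>i. U i \<omega>) * DT l (\<lambda>i. W i \<omega>) \<partial>?MM)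
        = (\<integral>\<omega>. (\<Sum>a\<in>L. \<Sum>b\<in>L. (4 * t k a * t l b) * (q (U k \<omega>) * p (U a \<omega>) * (q (W l \<omega>) * p (W b \<omega>)))) \<partial>?MM)"
      proof -
        have "DT k u * DT l w = (\<Sum>a\<in>L. \<Sum>b\<in>L. (4 * t k a * t l b) * (q (u k) * p (u a) * (q (w l) * p (w b))))" for u w
        proof -
          have "DT k u * DT l w = 4 * ((\<Sum>a\<in>L. t k a * (q (u k) * p (u a))) * (\<Sum>b\<in>L. t l b * (q (w l) * p (w b))))"
            by (simp add: DT_def)
          also have "\<dots> = (\<Sum>a\<in>L. \<Sum>b\<in>L. (4 * t k a * t l b) * (q (u k) * p (u a) * (q (w l) * p (w b))))"
            unfolding sum_product unfolding sum_distrib_left by (simp only: mult_ac)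
          finally show ?thesis .
        qed
        then show ?thesis by simp
      qed
      also have "\<dots> = (\<Sum>a\<in>L. \<Sum>b\<in>L. (4 * t k a * t l b) * (\<integral>\<omega>. q (U k \<omega>) * p (U a \<omega>) * (q (W l \<omega>) * p (W b \<omega>)) \<partial>?MM))"
        by (simp add: Bochner_Integration.integral_sum Bochner_Integration.integrable_sum i4 kl)
      also have "\<bar>\<dots>\<bar> \<le> (\<Sum>a\<in>L. \<Sum>b\<in>L. (4 * \<bar>t k a\<bar> * \<bar>t l b\<bar>) * K)"
      proof (intro order_trans[OF sum_abs] sum_mono)
        fix a b assume ab: "a \<in> L" "b \<in> L"
        have "\<bar>\<integral>\<omega>. q (U k \<omega>) * p (U a \<omega>) * (q (W l \<omega>) * p (W b \<omega>)) \<partial>?MM\<bar> \<le> K"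
          using order_trans[OF integral_abs_bound four] kl ab by blast
        then show "\<bar>(4 * t k a * t l b) * (\<integral>\<omega>. q (U k \<omega>) * p (U a \<omega>) * (q (W l \<omega>) * p (W b \<omega>)) \<partial>?MM)\<bar> \<le> (4 * \<bar>t k a\<bar> * \<bar>t l b\<bar>) * K"
          unfolding abs_mult by (intro mult_mono) auto
      qed
      also have "\<dots> = 4 * ((\<Sum>a\<in>L. \<bar>t k a\<bar>) * (\<Sum>b\<in>L. \<bar>t l b\<bar>)) * K"
        unfolding sum_product unfolding sum_distrib_left sum_distrib_right by (simp only: mult_ac)
      also have "\<dots> \<le> 4 * (S1 * S1) * K"
        using t(2) kl K0 S by (intro mult_right_mono mult_left_mono mult_mono) (auto intro!: sum_nonneg)
      finally show ?thesis by (simp add: power2_eq_square)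
    qed
    have "\<bar>\<Sum>j\<in>L. \<Sum>i\<in>L. (\<integral>x. V j x * V i x \<partial>M) * (\<integral>\<omega>. DT j (\<lambda>i. U i \<omega>) * DT i (\<lambda>i. W i \<omega>) \<partial>?MM)\<bar>
       \<le> (\<Sum>j\<in>L. \<Sum>i\<in>L. \<bar>\<integral>x. V j x * V i x \<partial>M\<bar> * (4 * S1\<^sup>2 * K))"
      by (intro order_trans[OF sum_abs] sum_mono) (auto simp only: abs_mult intro!: mult_left_mono term_b)
    also have "\<dots> = (\<Sum>j\<in>L. (\<Sum>i\<in>L. \<bar>\<integral>x. V j x * V i x \<partial>M\<bar>) * (4 * S1\<^sup>2 * K))" by (simp only: sum_distrib_right)
    also have "\<dots> \<le> (\<Sum>j\<in>L. S2 * (4 * S1\<^sup>2 * K))"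
      using K0 by (intro sum_mono mult_right_mono R) auto
    also have "\<dots> = 4 * S1\<^sup>2 * S2 * card L * K" by simp
    finally show "\<bar>\<Sum>j\<in>L. \<Sum>i\<in>L. (\<integral>x. V j x * V i x \<partial>M) * (\<integral>\<omega>. 2 * (\<Sum>l\<in>L. t j l * (q (V j (fst \<omega>)) * p (V l (fst \<omega>)))) * (2 * (\<Sum>l\<in>L. t i l * (q (c * V i (fst \<omega>) - s * V i (snd \<omega>)) * p (c * V l (fst \<omega>) - s * V l (snd \<omega>))))) \<partial>?MM)\<bar> \<le> 4 * S1\<^sup>2 * S2 * card L * K"
      unfolding DT_def U_def W_def .
  qed
  then show ?thesis unfolding power2_eq_square by linarith
qed

lemma sum_times_bool: "finite I \<Longrightarrow> (\<Sum>k\<in>I \<times> (UNIV::bool set). f k) = (\<Sum>i\<in>I. f (i, True) + f (i, False))"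
proof -
  assume "finite I"
  have "(\<Sum>k\<in>I \<times> (UNIV::bool set). f k) = (\<Sum>i\<in>I. \<Sum>b\<in>UNIV. f (i, b))"
    by (simp add: sum.cartesian_product split_beta')
  then show ?thesis by (simp add: UNIV_bool add.commute)
qed

section \<open>The normal approximation for smooth functions\<close>

text \<open>For a given number of coordinates the argument of \<open>f\<close> stays in a compact interval, so \<open>f\<close>
  itself may be unbounded; this allows both the identity and \<open>f x - c * x\<close>.\<close>

lemma smooth_functional_additive:
  assumes I: "finite I"
    and u: "\<And>x. (u has_real_derivative u' x) (at x)" and u': "continuous_on UNIV u'"
    and b: "\<And>x. \<bar>u x\<bar> \<le> B" "\<And>x. \<bar>u' x\<bar> \<le> B"
    and f: "\<And>x. (f has_real_derivative f' x) (at x)" and f': "continuous_on UNIV f'" and fb: "\<And>x. \<bar>f' x\<bar> \<le> C"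
  shows "smooth_functional I (\<lambda>v. f (a * (\<Sum>i\<in>I. u (v i)))) (\<lambda>i v. f' (a * (\<Sum>i\<in>I. u (v i))) * (a * u' (v i)))"
proof -
  have cu: "continuous_on UNIV u" using u by (rule continuous_on_of_derivative)
  have cf: "continuous_on UNIV f" using f by (rule continuous_on_of_derivative)
  have m[measurable]: "u \<in> borel_measurable borel" "u' \<in> borel_measurable borel" "f \<in> borel_measurable borel" "f' \<in> borel_measurable borel"
    using cu u' cf f' by (auto intro: borel_measurable_continuous_onI)
  define R where "R = \<bar>a\<bar> * (\<Sum>i\<in>I. B)"
  have sb: "\<bar>a * (\<Sum>i\<in>I. u (v i))\<bar> \<le> R" for v :: "'a \<Rightarrow> real"
    unfolding R_def abs_mult by (intro mult_left_mono order_trans[OF sum_abs] sum_mono b) auto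
  have "compact (f ` {-R..R})" by (intro compact_continuous_image continuous_on_subset[OF cf]) auto
  then obtain D where "\<forall>y\<in>f ` {-R..R}. norm y \<le> D"
    using compact_imp_bounded[of "f ` {-R..R}"] unfolding bounded_iff by auto
  then have D: "\<bar>y\<bar> \<le> D" if "y \<in> f ` {-R..R}" for y using that by auto
  have B0: "0 \<le> B" "0 \<le> C" using b(1)[of 0] fb[of 0] by linarith+
  have S: "cylindrical I (\<lambda>v. a * (\<Sum>i\<in>I. u (v i)))" by (intro cylindrical_intros cylindrical_coordinate) auto
  show ?thesis
    unfolding smooth_functional_def
  proof (intro conjI ballI allI impI exI)
    show "cylindrical I (\<lambda>v. f (a * (\<Sum>i\<in>I. u (v i))))" by (rule cylindrical_comp[OF _ S]) auto
    show "cylindrical I (\<lambda>v. f' (a * (\<Sum>i\<in>I. u (v i))) * (a * u' (v i)))" if "i \<in> I" for i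
      by (intro cylindrical_mult cylindrical_const cylindrical_comp[OF _ S] cylindrical_coordinate that m)
    show "\<bar>f (a * (\<Sum>i\<in>I. u (v i)))\<bar> \<le> max D (C * (\<bar>a\<bar> * B))" for v
      using D[of "f (a * (\<Sum>i\<in>I. u (v i)))"] sb[of v] by (auto simp: le_max_iff_disj abs_le_iff)
    show "\<bar>f' (a * (\<Sum>i\<in>I. u (v i))) * (a * u' (v i))\<bar> \<le> max D (C * (\<bar>a\<bar> * B))" for i v
      unfolding abs_mult by (rule max.coboundedI2) (intro mult_mono fb b order_refl mult_nonneg_nonneg abs_ge_zero B0)
  next
    fix \<gamma> :: "real \<Rightarrow> 'a \<Rightarrow> real" and \<gamma>' s
    assume g: "\<forall>i\<in>I. ((\<lambda>s. \<gamma> s i) has_real_derivative \<gamma>' i) (at s)"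
    have ug: "((\<lambda>s. u (\<gamma> s i)) has_real_derivative u' (\<gamma> s i) * \<gamma>' i) (at s)" if "i \<in> I" for i
      using DERIV_chain2[OF u] g that by blast
    have "((\<lambda>s. f (a * (\<Sum>i\<in>I. u (\<gamma> s i)))) has_real_derivative f' (a * (\<Sum>i\<in>I. u (\<gamma> s i))) * (a * (\<Sum>i\<in>I. u' (\<gamma> s i) * \<gamma>' i))) (at s)"
      by (rule DERIV_chain2[OF f]) (intro DERIV_cmult DERIV_sum ug)
    also have "f' (a * (\<Sum>i\<in>I. u (\<gamma> s i))) * (a * (\<Sum>i\<in>I. u' (\<gamma> s i) * \<gamma>' i)) = (\<Sum>i\<in>I. f' (a * (\<Sum>i\<in>I. u (\<gamma> s i))) * (a * u' (\<gamma> s i)) * \<gamma>' i)"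
      unfolding sum_distrib_left[of a "\<lambda>i. u' (\<gamma> s i) * \<gamma>' i"] sum_distrib_left[of "f' (a * (\<Sum>i\<in>I. u (\<gamma> s i)))"] by (simp only: mult.assoc)
    finally show "((\<lambda>s. f (a * (\<Sum>i\<in>I. u (\<gamma> s i)))) has_real_derivative (\<Sum>i\<in>I. f' (a * (\<Sum>i\<in>I. u (\<gamma> s i))) * (a * u' (\<gamma> s i)) * \<gamma>' i)) (at s)" .
  next
    fix \<gamma> :: "real \<Rightarrow> 'a \<Rightarrow> real" and k
    assume g: "\<forall>i\<in>I. continuous_on UNIV (\<lambda>s. \<gamma> s i)" and k: "k \<in> I"
    have c: "continuous_on UNIV (\<lambda>s. u (\<gamma> s i))" "continuous_on UNIV (\<lambda>s. u' (\<gamma> s i))" if "i \<in> I" for i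
      using continuous_on_compose2[OF cu, of UNIV "\<lambda>s. \<gamma> s i"] continuous_on_compose2[OF u', of UNIV "\<lambda>s. \<gamma> s i"] g that by auto
    have c2: "continuous_on UNIV (\<lambda>s. a * (\<Sum>i\<in>I. u (\<gamma> s i)))" by (intro continuous_intros c)
    show "continuous_on UNIV (\<lambda>s. f' (a * (\<Sum>i\<in>I. u (\<gamma> s i))) * (a * u' (\<gamma> s k)))"
      using k by (intro continuous_intros c continuous_on_compose2[OF f' c2]) auto
  qed
qed

text \<open>The sum over pairs of an original and a rotated coordinate is a quadratic functional of the
  Gaussian vector that lists both kinds of coordinates. Its coefficients are halved to make them
  symmetric, and all covariances of the larger vector are dominated by those of \<open>V\<close>.\<close>

lemma mixed_quadratic_variance:
  assumes V: "gaussian_vector M I V" and v: "\<And>i. i \<in> I \<Longrightarrow> (\<integral>x. (V i x)\<^sup>2 \<partial>M) = 1"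
    and r: "\<And>i j. r i j = (\<integral>x. V i x * V j x \<partial>M)"
    and S: "\<And>i. i \<in> I \<Longrightarrow> (\<Sum>j\<in>I. \<bar>r i j\<bar>) \<le> S" "0 \<le> S"
    and p: "\<And>x. (p has_real_derivative q x) (at x)" and q: "continuous_on UNIV q"
    and b: "\<And>x. \<bar>p x\<bar> \<le> B" "\<And>x. \<bar>q x\<bar> \<le> B" and cs: "c\<^sup>2 + s\<^sup>2 = 1"
  defines "T \<equiv> \<lambda>\<omega>. \<Sum>j\<in>I. \<Sum>i\<in>I. r j i * (p (V j (fst \<omega>)) * p (c * V i (fst \<omega>) - s * V i (snd \<omega>)))"
    and "K \<equiv> ((\<integral>x. (q x) ^ 4 \<partial>gauss) + (\<integral>x. (p x) ^ 4 \<partial>gauss)) / 2"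
  shows "(\<integral>x. (T x)\<^sup>2 \<partial>(M \<Otimes>\<^sub>M M)) - (\<integral>x. T x \<partial>(M \<Otimes>\<^sub>M M))\<^sup>2 \<le> 2 * pi * S ^ 3 * card I * K"
proof -
  let ?MM = "M \<Otimes>\<^sub>M M"
  have I: "finite I" using V by (rule gaussian_vectorD)
  have rs: "r i j = r j i" for i j by (simp add: r mult.commute)
  define L where "L = I \<times> (UNIV :: bool set)"
  have L: "finite L" using I by (simp add: L_def)
  define \<alpha> where "\<alpha> k = (if snd k then 1 else c)" for k :: "'b \<times> bool"
  define \<beta> where "\<beta> k = (if snd k then 0 else - s)" for k :: "'b \<times> bool"
  define X where "X k \<omega> = \<alpha> k * V (fst k) (fst \<omega>) + \<beta> k * V (fst k) (snd \<omega>)" for k \<omega>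
  define t where "t k l = (if snd k \<noteq> snd l then r (fst k) (fst l) / 2 else 0)" for k l :: "'b \<times> bool"
  have sub: "fst ` L \<subseteq> I" by (auto simp: L_def)
  note mix = gaussian_vector_mix[OF V L sub, where \<alpha>=\<alpha> and \<beta>=\<beta>, folded X_def r]
  have ab: "\<bar>\<alpha> k * \<alpha> l + \<beta> k * \<beta> l\<bar> \<le> 1" for k l
  proof -
    have "c\<^sup>2 \<le> 1" using cs zero_le_power2[of s] by linarith
    then have "\<bar>c\<bar> \<le> 1" by (simp add: abs_square_le_1)
    moreover have "c * c + s * s = 1" using cs by (simp add: power2_eq_square)
    ultimately show ?thesis by (auto simp: \<alpha>_def \<beta>_def)
  qed
  have T: "T \<omega> = (\<Sum>k\<in>L. \<Sum>l\<in>L. t k l * (p (X k \<omega>) * p (X l \<omega>)))" for \<omega>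
  proof -
    have "(\<Sum>k\<in>L. \<Sum>l\<in>L. t k l * (p (X k \<omega>) * p (X l \<omega>)))
      = (\<Sum>j\<in>I. (\<Sum>i\<in>I. r j i / 2 * (p (V j (fst \<omega>)) * p (c * V i (fst \<omega>) - s * V i (snd \<omega>))))
          + (\<Sum>i\<in>I. r j i / 2 * (p (c * V j (fst \<omega>) - s * V j (snd \<omega>)) * p (V i (fst \<omega>)))))"
      unfolding L_def sum_times_bool[OF I] by (simp add: t_def X_def \<alpha>_def \<beta>_def)
    also have "\<dots> = (\<Sum>j\<in>I. \<Sum>i\<in>I. r j i / 2 * (p (V j (fst \<omega>)) * p (c * V i (fst \<omega>) - s * V i (snd \<omega>))))
          + (\<Sum>j\<in>I. \<Sum>i\<in>I. r j i / 2 * (p (c * V j (fst \<omega>) - s * V j (snd \<omega>)) * p (V i (fst \<omega>))))"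
      by (rule sum.distrib)
    also have "(\<Sum>j\<in>I. \<Sum>i\<in>I. r j i / 2 * (p (c * V j (fst \<omega>) - s * V j (snd \<omega>)) * p (V i (fst \<omega>))))
       = (\<Sum>j\<in>I. \<Sum>i\<in>I. r j i / 2 * (p (V j (fst \<omega>)) * p (c * V i (fst \<omega>) - s * V i (snd \<omega>))))"
      by (subst sum.swap) (intro sum.cong refl, simp add: rs mult_ac)
    finally show ?thesis unfolding T_def by (simp add: sum.distrib[symmetric] mult_2[symmetric] sum_distrib_left)
  qed
  have "(\<integral>x. (T x)\<^sup>2 \<partial>?MM) - (\<integral>x. T x \<partial>?MM)\<^sup>2 \<le> pi / 2 * (4 * (S/2)\<^sup>2 * (2 * S) * card L * K)"
    unfolding T K_def
  proof (rule quadratic_variance_bound[OF mix(1)])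
    show "(\<integral>x. (X k x)\<^sup>2 \<partial>?MM) = 1" if "k \<in> L" for k
      using mix(2)[OF that that] that v[of "fst k"] cs by (auto simp: power2_eq_square \<alpha>_def \<beta>_def r L_def)
    show "(\<Sum>l\<in>L. \<bar>\<integral>x. X k x * X l x \<partial>?MM\<bar>) \<le> 2 * S" if k: "k \<in> L" for k
    proof -
      have "(\<Sum>l\<in>L. \<bar>\<integral>x. X k x * X l x \<partial>?MM\<bar>) \<le> (\<Sum>l\<in>L. \<bar>r (fst k) (fst l)\<bar>)"
      proof (rule sum_mono)
        fix l assume "l \<in> L"
        then show "\<bar>\<integral>x. X k x * X l x \<partial>?MM\<bar> \<le> \<bar>r (fst k) (fst l)\<bar>"
          using mix(2)[OF k] mult_right_mono[OF ab[of k l], of "\<bar>r (fst k) (fst l)\<bar>"] by (simp add: abs_mult)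
      qed
      also have "\<dots> = 2 * (\<Sum>i\<in>I. \<bar>r (fst k) i\<bar>)"
        unfolding L_def sum_times_bool[OF I] by (simp add: sum_distrib_left)
      finally show ?thesis using S(1)[of "fst k"] k by (auto simp: L_def)
    qed
    show "t k l = t l k" for k l by (simp add: t_def rs)
    show "(\<Sum>l\<in>L. \<bar>t k l\<bar>) \<le> S / 2" if k: "k \<in> L" for k
    proof -
      have "(\<Sum>l\<in>L. \<bar>t k l\<bar>) = (\<Sum>i\<in>I. \<bar>r (fst k) i\<bar> / 2)"
        unfolding L_def sum_times_bool[OF I] by (intro sum.cong refl) (auto simp: t_def)
      then show ?thesis using S(1)[of "fst k"] k by (auto simp: L_def sum_divide_distrib[symmetric])
    qed
  qed (use S p q b in auto)
  also have "pi / 2 * (4 * (S/2)\<^sup>2 * (2 * S) * card L * K) = 2 * pi * S ^ 3 * card I * K"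
    by (simp add: L_def card_cartesian_product power2_eq_square power3_eq_cube)
  finally show ?thesis .
qed

lemma abs_integral_le:
  fixes f g :: "'a \<Rightarrow> real"
  assumes "integrable M f" "integrable M g" "\<And>x. \<bar>f x\<bar> \<le> g x"
  shows "\<bar>\<integral>x. f x \<partial>M\<bar> \<le> (\<integral>x. g x \<partial>M)"
  by (rule order_trans[OF integral_abs_bound]) (intro integral_mono integrable_abs assms)

text \<open>Since \<open>f\<close> is centred, \<open>T\<close> may be centred as well, and only its standard deviation counts.\<close>

lemma (in prob_space) expectation_mult_centred_bound:
  assumes [measurable]: "f \<in> borel_measurable M" "T \<in> borel_measurable M"
    and f: "\<And>x. \<bar>f x\<bar> \<le> C" "(\<integral>x. f x \<partial>M) = 0" and T: "\<And>x. \<bar>T x\<bar> \<le> B"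
    and W: "(\<integral>x. (T x)\<^sup>2 \<partial>M) - (\<integral>x. T x \<partial>M)\<^sup>2 \<le> W"
  shows "\<bar>\<integral>x. f x * T x \<partial>M\<bar> \<le> C * sqrt W"
proof -
  have C0: "0 \<le> C" and B0: "0 \<le> B" using f(1)[of undefined] T[of undefined] by linarith+
  define m where "m = (\<integral>x. T x \<partial>M)"
  have T2: "\<bar>(T x)\<^sup>2\<bar> \<le> B\<^sup>2" for x using T[of x] by (simp add: abs_le_square_iff[symmetric] B0)
  have iT: "integrable M T" "integrable M (\<lambda>x. (T x)\<^sup>2)" "integrable M f"
    using T T2 f(1) by (auto intro: integrable_const_bound[where B=B] integrable_const_bound[where B="B\<^sup>2"] integrable_const_bound[where B=C])
  have ifT: "integrable M (\<lambda>x. f x * T x)"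
    by (rule integrable_const_bound[where B="C * B"]) (use f T C0 B0 in \<open>auto simp: abs_mult intro!: AE_I2 mult_mono\<close>)
  have i2: "integrable M (\<lambda>x. (T x - m)\<^sup>2)" using iT by (simp add: power2_diff)
  have v: "(\<integral>x. (T x - m)\<^sup>2 \<partial>M) \<le> W"
    using W variance_eq[OF iT(1,2)] by (simp add: m_def)
  have iA: "integrable M (\<lambda>x. \<bar>T x - m\<bar>)" using iT by simp
  have "(\<integral>x. \<bar>T x - m\<bar> \<partial>M)\<^sup>2 \<le> (\<integral>x. (T x - m)\<^sup>2 \<partial>M)"
    using variance_positive[of "\<lambda>x. \<bar>T x - m\<bar>"] variance_eq[OF iA] i2 by simp
  then have a: "(\<integral>x. \<bar>T x - m\<bar> \<partial>M) \<le> sqrt W" using v by (intro real_le_rsqrt) linarith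
  have "(\<integral>x. f x * T x \<partial>M) = (\<integral>x. f x * (T x - m) \<partial>M)"
    using ifT iT f(2) by (simp add: right_diff_distrib)
  also have "\<bar>\<dots>\<bar> \<le> (\<integral>x. C * \<bar>T x - m\<bar> \<partial>M)"
  proof (rule abs_integral_le)
    show "integrable M (\<lambda>x. f x * (T x - m))" using ifT iT by (simp add: right_diff_distrib)
    show "integrable M (\<lambda>x. C * \<bar>T x - m\<bar>)" using iA by simp
    show "\<bar>f x * (T x - m)\<bar> \<le> C * \<bar>T x - m\<bar>" for x unfolding abs_mult by (intro mult_right_mono f(1)) simp
  qed
  also have "\<dots> \<le> C * sqrt W" using a C0 by (simp add: mult_left_mono)
  finally show ?thesis .
qed

text \<open>By Stein's equation the left-hand side is the difference of \<open>c = E (f' G)\<close> and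
  \<open>E (G * f G)\<close>. The covariance inequality is applied to \<open>f G - c * G\<close> and \<open>G\<close>. The
  expectations that it asks for are \<open>a\<^sup>2 * E (H * T)\<close>, where \<open>H\<close> is \<open>f' - c\<close> evaluated at
  the rotated sum and \<open>T\<close> is the quadratic functional of the preceding lemmas. The rotated sum has
  the same law as \<open>G\<close>, so that \<open>H\<close> has mean 0 by the choice of \<open>c\<close>, and only the standard
  deviation of \<open>T\<close> contributes. What remains is \<open>c * (1 - E (G\<^sup>2))\<close>, the first term of the bound.\<close>

lemma stein_bound_smooth:
  fixes a :: real
  assumes V: "gaussian_vector M I V" and v: "\<And>i. i \<in> I \<Longrightarrow> (\<integral>x. (V i x)\<^sup>2 \<partial>M) = 1"
    and r: "\<And>i j. r i j = (\<integral>x. V i x * V j x \<partial>M)"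
    and S: "\<And>i. i \<in> I \<Longrightarrow> (\<Sum>j\<in>I. \<bar>r i j\<bar>) \<le> S" "0 \<le> S"
    and u: "\<And>x. (u has_real_derivative p x) (at x)" and p: "\<And>x. (p has_real_derivative q x) (at x)" and q: "continuous_on UNIV q"
    and b: "\<And>x. \<bar>u x\<bar> \<le> B" "\<And>x. \<bar>p x\<bar> \<le> B" "\<And>x. \<bar>q x\<bar> \<le> B"
    and u0: "(\<integral>x. u x \<partial>gauss) = 0"
    and h: "continuous_on UNIV h" "\<And>x. 0 \<le> h x" "\<And>x. h x \<le> 1"
  defines "G \<equiv> \<lambda>x. a * (\<Sum>i\<in>I. u (V i x))"
    and "K \<equiv> ((\<integral>x. (q x) ^ 4 \<partial>gauss) + (\<integral>x. (p x) ^ 4 \<partial>gauss)) / 2"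
  shows "\<bar>(\<integral>x. h (G x) \<partial>M) - (\<integral>x. h x \<partial>gauss)\<bar> \<le> 2 * \<bar>1 - (\<integral>x. (G x)\<^sup>2 \<partial>M)\<bar> + 2 * pi * a\<^sup>2 * sqrt (2 * pi * S ^ 3 * card I * K)"
proof -
  let ?MM = "M \<Otimes>\<^sub>M M"
  interpret M: prob_space M using V by (rule gaussian_vectorD)
  interpret P: pair_prob_space M M ..
  have I: "finite I" using V by (rule gaussian_vectorD)
  note mV[measurable] = gaussian_vectorD(5)[OF V]
  have cu: "continuous_on UNIV u" using u by (rule continuous_on_of_derivative)
  have cp: "continuous_on UNIV p" using p by (rule continuous_on_of_derivative)
  have [measurable]: "u \<in> borel_measurable borel" "p \<in> borel_measurable borel" "h \<in> borel_measurable borel"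
    using cp cu h by (auto intro: borel_measurable_continuous_onI)
  have B0: "0 \<le> B" using b(1)[of 0] by linarith
  obtain f f' C where f: "\<And>x. (f has_real_derivative f' x) (at x)" "continuous_on UNIV f'"
    "\<And>x. \<bar>f x\<bar> \<le> C" "\<And>x. \<bar>f' x\<bar> \<le> 2"
    "\<And>x. f' x - x * f x = h x - (\<integral>y. h y \<partial>gauss)"
    using stein_equation[OF h] by blast
  have cf: "continuous_on UNIV f" using f(1) by (rule continuous_on_of_derivative)
  have [measurable]: "f \<in> borel_measurable borel" "f' \<in> borel_measurable borel"
    using cf f(2) by (auto intro: borel_measurable_continuous_onI)
  have mG[measurable]: "G \<in> borel_measurable M" unfolding G_def by measurable
  define R where "R = \<bar>a\<bar> * (\<Sum>i\<in>I. B)"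
  have sb: "\<bar>a * (\<Sum>i\<in>I. u (w i))\<bar> \<le> R" for w :: "'b \<Rightarrow> real"
    unfolding R_def abs_mult by (intro mult_left_mono order_trans[OF sum_abs] sum_mono b) auto
  have GR: "\<bar>G x\<bar> \<le> R" for x unfolding G_def by (rule sb)
  have R0: "0 \<le> R" using GR[of undefined] by linarith
  have C0: "0 \<le> C" using f(3)[of 0] by linarith
  have iG: "integrable M G" by (rule M.integrable_const_bound[where B=R]) (use GR in auto)
  have iG2: "integrable M (\<lambda>x. (G x)\<^sup>2)"
    by (rule M.integrable_const_bound[where B="R\<^sup>2"]) (use GR R0 in \<open>auto simp: abs_le_square_iff[symmetric]\<close>)
  have ifG: "integrable M (\<lambda>x. f (G x) * G x)"
    by (rule M.integrable_const_bound[where B="C * R"]) (use f(3) GR C0 R0 in \<open>auto simp: abs_mult intro!: AE_I2 mult_mono\<close>)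
  have if1: "integrable M (\<lambda>x. f (G x))" by (rule M.integrable_const_bound[where B=C]) (use f(3) in auto)
  have if': "integrable M (\<lambda>x. f' (G x))" by (rule M.integrable_const_bound[where B=2]) (use f(4) in auto)
  have ih: "integrable M (\<lambda>x. h (G x))" by (rule M.integrable_const_bound[where B=1]) (use h in auto)
  interpret Ga: prob_space gauss by (rule prob_space_gauss)
  have EG: "(\<integral>x. G x \<partial>M) = 0"
  proof -
    have "integrable gauss u" by (rule Ga.integrable_const_bound[where B=B]) (use b in auto)
    then have "integrable M (\<lambda>x. u (V i x))" "(\<integral>x. u (V i x) \<partial>M) = 0" if "i \<in> I" for i
      using gauss_law_integral[OF gaussian_vector_std_normal[OF V that v[OF that]] mV[OF that], of u] u0 by simp_all
    then show ?thesis unfolding G_def by (simp add: Bochner_Integration.integral_sum)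
  qed
  define c where "c = (\<integral>x. f' (G x) \<partial>M)"
  have c2: "\<bar>c\<bar> \<le> 2"
  proof -
    have "\<bar>c\<bar> \<le> (\<integral>x. 2 \<partial>M)" unfolding c_def by (rule abs_integral_le[OF if']) (use f(4) in auto)
    then show ?thesis by (simp add: M.prob_space)
  qed
  (* subtracting c * y makes the derivative centred under the law of G *)
  define \<phi> where "\<phi> y = f y - c * y" for y
  define \<phi>' where "\<phi>' y = f' y - c" for y
  have \<phi>: "(\<phi> has_real_derivative \<phi>' x) (at x)" for x
    unfolding \<phi>_def \<phi>'_def by (auto intro!: derivative_eq_intros f(1))
  have c\<phi>: "continuous_on UNIV \<phi>'" unfolding \<phi>'_def by (intro continuous_intros f(2))
  have \<phi>4: "\<bar>\<phi>' x\<bar> \<le> 4" for x unfolding \<phi>'_def using f(4)[of x] c2 by linarith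
  have [measurable]: "\<phi>' \<in> borel_measurable borel" using c\<phi> by (rule borel_measurable_continuous_onI)
  have smF: "smooth_functional I (\<lambda>w. \<phi> (a * (\<Sum>i\<in>I. u (w i)))) (\<lambda>i w. \<phi>' (a * (\<Sum>i\<in>I. u (w i))) * (a * p (w i)))"
    by (rule smooth_functional_additive[OF I u cp b(1,2) \<phi> c\<phi> \<phi>4])
  have smG: "smooth_functional I (\<lambda>w. a * (\<Sum>i\<in>I. u (w i))) (\<lambda>i w. 1 * (a * p (w i)))"
    by (rule smooth_functional_additive[OF I u cp b(1,2), of "\<lambda>x. x" "\<lambda>_. 1" 1]) auto
  define W where "W = 2 * pi * S ^ 3 * card I * K"
  have "\<bar>(\<integral>x. \<phi> (a * (\<Sum>i\<in>I. u (V i x))) * (a * (\<Sum>i\<in>I. u (V i x))) \<partial>M) -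
      (\<integral>x. \<phi> (a * (\<Sum>i\<in>I. u (V i x))) \<partial>M) * (\<integral>x. a * (\<Sum>i\<in>I. u (V i x)) \<partial>M)\<bar> \<le> pi / 2 * (a\<^sup>2 * (4 * sqrt W))"
  proof (rule gaussian_covariance_bound[OF V v smF smG])
    fix k s :: real assume ks: "k\<^sup>2 + s\<^sup>2 = 1"
    define X where "X i \<omega> = k * V i (fst \<omega>) - s * V i (snd \<omega>)" for i \<omega>
    have X: "gaussian_vector ?MM I X" "i \<in> I \<Longrightarrow> j \<in> I \<Longrightarrow> (\<integral>\<omega>. X i \<omega> * X j \<omega> \<partial>?MM) = (\<integral>x. V i x * V j x \<partial>M)" for i j
      using gaussian_vector_mix[OF V I, where \<pi>="\<lambda>i. i" and \<alpha>="\<lambda>_. k" and \<beta>="\<lambda>_. -s"] ks unfolding X_def by (auto simp: power2_eq_square)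
    note mX[measurable] = gaussian_vectorD(5)[OF X(1)]
    note law = gaussian_vector_law_eq_covariance[OF X(1) V X(2)]
    have cyl: "cylindrical I (\<lambda>w. \<phi>' (a * (\<Sum>i\<in>I. u (w i))))"
      by (intro cylindrical_comp[of \<phi>'] cylindrical_intros cylindrical_coordinate) auto
    define H where "H \<omega> = \<phi>' (a * (\<Sum>i\<in>I. u (X i \<omega>)))" for \<omega>
    define T where "T \<omega> = (\<Sum>j\<in>I. \<Sum>i\<in>I. r j i * (p (V j (fst \<omega>)) * p (X i \<omega>)))" for \<omega>
    have [measurable]: "H \<in> borel_measurable ?MM" "T \<in> borel_measurable ?MM" unfolding H_def T_def by measurable
    have H0: "(\<integral>\<omega>. H \<omega> \<partial>?MM) = 0"
    proof -
      have "(\<integral>\<omega>. H \<omega> \<partial>?MM) = (\<integral>x. \<phi>' (G x) \<partial>M)"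
        unfolding H_def G_def by (rule cylindrical_same_law(1)[OF law cyl mX mV])
      also have "\<dots> = 0" unfolding \<phi>'_def using if' by (simp add: c_def M.prob_space)
      finally show ?thesis .
    qed
    have Tb: "\<bar>T \<omega>\<bar> \<le> (\<Sum>j\<in>I. \<Sum>i\<in>I. \<bar>r j i\<bar> * (B * B))" for \<omega>
      unfolding T_def by (intro order_trans[OF sum_abs] sum_mono) (auto simp: abs_mult intro!: mult_left_mono mult_mono b B0)
    have main: "\<bar>\<integral>\<omega>. H \<omega> * T \<omega> \<partial>?MM\<bar> \<le> 4 * sqrt W"
    proof (rule P.expectation_mult_centred_bound[OF _ _ _ H0 Tb])
      show "\<bar>H \<omega>\<bar> \<le> 4" for \<omega> unfolding H_def by (rule \<phi>4)
      show "(\<integral>x. (T x)\<^sup>2 \<partial>?MM) - (\<integral>x. T x \<partial>?MM)\<^sup>2 \<le> W"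
        unfolding T_def X_def W_def K_def by (rule mixed_quadratic_variance[OF V v r S p q b(2,3) ks])
    qed measurable
    have iprod: "integrable ?MM (\<lambda>\<omega>. 1 * (a * p (V j (fst \<omega>))) * (H \<omega> * (a * p (X i \<omega>))))" if "i \<in> I" "j \<in> I" for i j
      by (rule P.integrable_const_bound[where B="1 * (\<bar>a\<bar> * B) * (4 * (\<bar>a\<bar> * B))"])
        (use that b B0 \<phi>4 in \<open>auto simp: H_def abs_mult intro!: AE_I2 mult_mono\<close>)
    have "(\<Sum>j\<in>I. \<Sum>i\<in>I. (\<integral>x. V j x * V i x \<partial>M) * (\<integral>\<omega>. 1 * (a * p (V j (fst \<omega>))) * (H \<omega> * (a * p (X i \<omega>))) \<partial>?MM))
       = (\<integral>\<omega>. (\<Sum>j\<in>I. \<Sum>i\<in>I. r j i * (1 * (a * p (V j (fst \<omega>))) * (H \<omega> * (a * p (X i \<omega>))))) \<partial>?MM)"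
      unfolding r[symmetric] using iprod by (simp add: Bochner_Integration.integral_sum Bochner_Integration.integrable_sum del: mult_1_left)
    also have "\<dots> = (\<integral>\<omega>. a\<^sup>2 * (H \<omega> * T \<omega>) \<partial>?MM)"
      unfolding T_def sum_distrib_left power2_eq_square by (simp only: mult_ac mult_1_left mult_1_right)
    finally have "\<bar>\<Sum>j\<in>I. \<Sum>i\<in>I. (\<integral>x. V j x * V i x \<partial>M) * (\<integral>\<omega>. 1 * (a * p (V j (fst \<omega>))) * (H \<omega> * (a * p (X i \<omega>))) \<partial>?MM)\<bar> \<le> a\<^sup>2 * (4 * sqrt W)"
      using mult_left_mono[OF main, of "a\<^sup>2"] by (simp add: abs_mult)
    then show "\<bar>\<Sum>j\<in>I. \<Sum>i\<in>I. (\<integral>x. V j x * V i x \<partial>M) * (\<integral>\<omega>. 1 * (a * p (V j (fst \<omega>))) *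
       (\<phi>' (a * (\<Sum>i\<in>I. u (k * V i (fst \<omega>) - s * V i (snd \<omega>)))) * (a * p (k * V i (fst \<omega>) - s * V i (snd \<omega>)))) \<partial>?MM)\<bar> \<le> a\<^sup>2 * (4 * sqrt W)"
      unfolding H_def X_def .
  qed
  then have "\<bar>(\<integral>x. \<phi> (G x) * G x \<partial>M) - (\<integral>x. \<phi> (G x) \<partial>M) * (\<integral>x. G x \<partial>M)\<bar> \<le> pi / 2 * (a\<^sup>2 * (4 * sqrt W))"
    unfolding G_def .
  moreover have "(\<integral>x. \<phi> (G x) * G x \<partial>M) = (\<integral>x. f (G x) * G x \<partial>M) - c * (\<integral>x. (G x)\<^sup>2 \<partial>M)"
    unfolding \<phi>_def using ifG iG2 by (simp add: left_diff_distrib power2_eq_square mult.assoc)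
  ultimately have cov: "\<bar>(\<integral>x. f (G x) * G x \<partial>M) - c * (\<integral>x. (G x)\<^sup>2 \<partial>M)\<bar> \<le> 2 * pi * a\<^sup>2 * sqrt W"
    unfolding EG by (simp add: mult_ac)
  have "(\<integral>x. h (G x) \<partial>M) - (\<integral>x. h x \<partial>gauss) = (\<integral>x. h (G x) - (\<integral>x. h x \<partial>gauss) \<partial>M)"
    using ih by (simp add: M.prob_space)
  also have "\<dots> = (\<integral>x. f' (G x) - f (G x) * G x \<partial>M)" by (simp only: f(5)[symmetric] mult.commute)
  also have "\<dots> = c - (\<integral>x. f (G x) * G x \<partial>M)" using if' ifG by (simp add: c_def)
  also have "\<dots> = c * (1 - (\<integral>x. (G x)\<^sup>2 \<partial>M)) - ((\<integral>x. f (G x) * G x \<partial>M) - c * (\<integral>x. (G x)\<^sup>2 \<partial>M))"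
    by (simp add: algebra_simps)
  finally have eq: "(\<integral>x. h (G x) \<partial>M) - (\<integral>x. h x \<partial>gauss) = \<dots>" .
  have "\<bar>c * (1 - (\<integral>x. (G x)\<^sup>2 \<partial>M))\<bar> \<le> 2 * \<bar>1 - (\<integral>x. (G x)\<^sup>2 \<partial>M)\<bar>"
    unfolding abs_mult by (rule mult_right_mono[OF c2]) simp
  then show ?thesis unfolding eq W_def[symmetric] using cov by linarith
qed

section \<open>Approximation in the Gaussian Sobolev space\<close>

lemma Lp_fun_4: "Lp_fun M 4 f \<longleftrightarrow> f \<in> borel_measurable M \<and> integrable M (\<lambda>x. (f x) ^ 4)"
  unfolding Lp_fun_def by simp

lemma Cb_infinityD:
  assumes "u \<in> Cb_infinity"
  shows "((deriv ^^ i) u has_real_derivative (deriv ^^ Suc i) u x) (at x)" "continuous_on UNIV ((deriv ^^ i) u)"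
    "\<exists>B. \<forall>x. \<bar>(deriv ^^ i) u x\<bar> \<le> B"
proof -
  have "(deriv ^^ i) u differentiable_on UNIV" "bounded (range ((deriv ^^ i) u))" using assms by (auto simp: Cb_infinity_def)
  then show "((deriv ^^ i) u has_real_derivative (deriv ^^ Suc i) u x) (at x)"
    by (simp add: differentiable_on_def real_differentiable_def DERIV_deriv_iff_real_differentiable)
  show "continuous_on UNIV ((deriv ^^ i) u)"
    using \<open>(deriv ^^ i) u differentiable_on UNIV\<close> by (rule differentiable_imp_continuous_on)
  show "\<exists>B. \<forall>x. \<bar>(deriv ^^ i) u x\<bar> \<le> B"
    using \<open>bounded (range ((deriv ^^ i) u))\<close> by (auto simp: bounded_iff)
qed

lemma fourth_power_add: "(a + b) ^ 4 \<le> 8 * (a ^ 4 + b ^ 4)" for a b :: real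
proof -
  have s: "(x + y)\<^sup>2 \<le> 2 * (x\<^sup>2 + y\<^sup>2)" for x y :: real
    using zero_le_power2[of "x - y"] by (simp add: power2_sum power2_diff)
  have "((a + b)\<^sup>2)\<^sup>2 \<le> (2 * (a\<^sup>2 + b\<^sup>2))\<^sup>2" by (rule power_mono[OF s]) simp
  also have "\<dots> = 4 * (a\<^sup>2 + b\<^sup>2)\<^sup>2" by (subst power_mult_distrib) simp
  also have "\<dots> \<le> 4 * (2 * ((a\<^sup>2)\<^sup>2 + (b\<^sup>2)\<^sup>2))" using s[of "a\<^sup>2" "b\<^sup>2"] by simp
  finally show ?thesis by simp
qed

text \<open>The Sobolev norm controls the fourth moments of the differences of the derivatives. Hence the
  fourth moments of the first two derivatives stay bounded along the sequence, which is all
  that the bound for smooth functions needs to know about them.\<close>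

lemma gauss_sobolev_approximation:
  assumes g: "g \<in> gauss_sobolev 2 4"
  obtains u p q :: "nat \<Rightarrow> real \<Rightarrow> real" and B :: "nat \<Rightarrow> real" and K :: real where
    "\<And>n x. (u n has_real_derivative p n x) (at x)" "\<And>n x. (p n has_real_derivative q n x) (at x)"
    "\<And>n. continuous_on UNIV (q n)"
    "\<And>n x. \<bar>u n x\<bar> \<le> B n" "\<And>n x. \<bar>p n x\<bar> \<le> B n" "\<And>n x. \<bar>q n x\<bar> \<le> B n"
    "\<And>n. (\<integral>x. (q n x) ^ 4 \<partial>gauss) + (\<integral>x. (p n x) ^ 4 \<partial>gauss) \<le> K"
    "square_integrable gauss g" "(\<lambda>n. \<integral>x. (u n x - g x)\<^sup>2 \<partial>gauss) \<longlonglongrightarrow> 0"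
proof -
  interpret G: prob_space gauss by (rule prob_space_gauss)
  obtain h u where h0: "h 0 = g" and h: "\<And>i. i \<le> 2 \<Longrightarrow> Lp_fun gauss 4 (h i)" and u: "\<And>n. u n \<in> Cb_infinity"
    and lim: "(\<lambda>n. (\<Sum>i\<le>2. Lp_norm gauss 4 (\<lambda>x. h i x - (deriv ^^ i) (u n) x) powr 4) powr (1 / 4)) \<longlonglongrightarrow> 0"
    using g unfolding gauss_sobolev_def by auto
  define D where "D i n = (deriv ^^ i) (u n)" for i n
  have D: "(D i n has_real_derivative D (Suc i) n x) (at x)" "continuous_on UNIV (D i n)" "\<exists>B. \<forall>x. \<bar>D i n x\<bar> \<le> B" for i n x
    unfolding D_def using Cb_infinityD[OF u] by blast+
  have [measurable]: "D i n \<in> borel_measurable borel" for i n using D(2) by (rule borel_measurable_continuous_onI)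
  have hm[measurable]: "h i \<in> borel_measurable borel" if "i \<le> 2" for i
    using h[OF that] by (simp add: Lp_fun_4 measurable_def)
  have h4: "integrable gauss (\<lambda>x. (h i x)^4)" if "i \<le> 2" for i using h[OF that] by (simp add: Lp_fun_4)
  have D4: "integrable gauss (\<lambda>x. (D i n x)^4)" for i n
  proof -
    obtain B where B: "\<forall>x. \<bar>D i n x\<bar> \<le> B" using D(3) by blast
    have "(D i n x)^4 \<le> B^4" for x using power_mono[of "\<bar>D i n x\<bar>" B 4] B by simp
    then show ?thesis by (intro G.integrable_const_bound[where B="B^4"]) auto
  qed
  define d where "d i n = (\<integral>x. (h i x - D i n x)^4 \<partial>gauss)" for i n
  have d4: "integrable gauss (\<lambda>x. (h i x - D i n x)^4)" if "i \<le> 2" for i n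
  proof (rule Bochner_Integration.integrable_bound)
    show "integrable gauss (\<lambda>x. 8 * ((h i x)^4 + (D i n x)^4))" using h4[OF that] D4 by simp
    show "(\<lambda>x. (h i x - D i n x)^4) \<in> borel_measurable gauss" using that by simp
    show "AE x in gauss. norm ((h i x - D i n x)^4) \<le> norm (8 * ((h i x)^4 + (D i n x)^4))"
      using fourth_power_add[of "h i _" "- D i n _"] by simp
  qed
  have d0: "0 \<le> d i n" for i n unfolding d_def by simp
  have norm_d: "Lp_norm gauss 4 (\<lambda>x. h i x - D i n x) powr 4 = d i n" for i n
    using d0[of i n] unfolding Lp_norm_def d_def by (simp add: powr_powr)
  define s where "s n = (\<Sum>i\<le>2. d i n)" for n
  have s0: "0 \<le> s n" for n unfolding s_def using d0 by (simp add: sum_nonneg)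
  have "(\<lambda>n. s n powr (1/4)) \<longlonglongrightarrow> 0" using lim unfolding D_def[symmetric] norm_d s_def .
  then have "(\<lambda>n. (s n powr (1/4)) ^ 4) \<longlonglongrightarrow> 0 ^ 4" by (rule tendsto_power)
  moreover have "(s n powr (1/4)) ^ 4 = s n" for n
  proof -
    have "(s n powr (1/4)) powr 4 = s n" unfolding powr_powr using s0[of n] by simp
    moreover have "(s n powr (1/4)) powr 4 = (s n powr (1/4)) ^ 4" by (rule powr_numeral) simp
    ultimately show ?thesis by simp
  qed
  ultimately have sl: "s \<longlonglongrightarrow> 0" by simp
  have ds: "d i n \<le> s n" if "i \<le> 2" for i n unfolding s_def using that d0 by (intro member_le_sum) auto
  have dl: "d i \<longlonglongrightarrow> 0" if "i \<le> 2" for i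
    by (rule tendsto_sandwich[OF _ _ tendsto_const sl]) (use d0 ds[OF that] in auto)
  obtain S where S: "s n \<le> S" for n
    using convergent_imp_Bseq[OF convergentI[OF sl]] s0 unfolding Bseq_def by (auto simp: abs_of_nonneg)
  have D4b: "(\<integral>x. (D i n x)^4 \<partial>gauss) \<le> 8 * (S + (\<integral>x. (h i x)^4 \<partial>gauss))" if i: "i \<le> 2" for i n
  proof -
    have "(\<integral>x. (D i n x)^4 \<partial>gauss) \<le> (\<integral>x. 8 * ((h i x - D i n x)^4 + (h i x)^4) \<partial>gauss)"
    proof (rule integral_mono)
      show "(D i n x)^4 \<le> 8 * ((h i x - D i n x)^4 + (h i x)^4)" for x
        using fourth_power_add[of "h i x - D i n x" "- h i x"] by simp
    qed (use D4 d4[OF i] h4[OF i] in auto)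
    also have "\<dots> = 8 * (d i n + (\<integral>x. (h i x)^4 \<partial>gauss))" using d4[OF i] h4[OF i] by (simp add: d_def)
    also have "\<dots> \<le> 8 * (S + (\<integral>x. (h i x)^4 \<partial>gauss))" using ds[OF i, of n] S[of n] by simp
    finally show ?thesis .
  qed
  have "\<forall>i n. \<exists>B. \<forall>x. \<bar>D i n x\<bar> \<le> B" using D(3) by blast
  then obtain b where b: "\<And>i n x. \<bar>D i n x\<bar> \<le> b i n" by metis
  define B where "B n = max (b 0 n) (max (b 1 n) (b 2 n))" for n
  have sq4: "square_integrable gauss f" if [measurable]: "f \<in> borel_measurable borel" and "integrable gauss (\<lambda>x. (f x)^4)" for f
    unfolding square_integrable_def
  proof
    show "integrable gauss (\<lambda>x. (f x)\<^sup>2)"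
      by (rule G.square_integrable_imp_integrable) (use that in auto)
  qed simp
  have g2: "square_integrable gauss g" using sq4[of "h 0"] hm[of 0] h4[of 0] h0 by simp
  have ul: "(\<lambda>n. \<integral>x. (D 0 n x - g x)\<^sup>2 \<partial>gauss) \<longlonglongrightarrow> 0"
  proof (rule tendsto_sandwich[OF _ _ tendsto_const])
    show "(\<lambda>n. sqrt (d 0 n)) \<longlonglongrightarrow> 0" using tendsto_real_sqrt[OF dl[of 0]] by simp
    have "(\<integral>x. (D 0 n x - g x)\<^sup>2 \<partial>gauss) \<le> sqrt (d 0 n)" for n
    proof -
      define z where "z x = (D 0 n x - g x)\<^sup>2" for x
      have [measurable]: "z \<in> borel_measurable borel" unfolding z_def[abs_def] using hm[of 0] h0 by simp
      have z4: "(z x)\<^sup>2 = (h 0 x - D 0 n x)^4" for x by (simp add: z_def h0 power2_commute[of "D 0 n x"])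
      have "square_integrable gauss z" unfolding square_integrable_def z4 using d4[of 0] hm[of 0] h0 by (simp add: z_def)
      then have "\<bar>\<integral>x. z x * 1 \<partial>gauss\<bar> \<le> sqrt ((\<integral>x. (z x)\<^sup>2 \<partial>gauss) * (\<integral>x. 1\<^sup>2 \<partial>gauss))"
        by (rule integral_Cauchy_Schwarz) (simp add: square_integrable_def)
      then show ?thesis using G.prob_space unfolding z4 by (simp add: z_def d_def)
    qed
    then show "\<forall>\<^sub>F n in sequentially. (\<integral>x. (D 0 n x - g x)\<^sup>2 \<partial>gauss) \<le> sqrt (d 0 n)" by simp
  qed simp
  show ?thesis
  proof (rule that[of "D 0" "D 1" "D 2" B "8 * (S + (\<integral>x. (h 2 x)^4 \<partial>gauss)) + 8 * (S + (\<integral>x. (h 1 x)^4 \<partial>gauss))"])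
    show "(D 0 n has_real_derivative D 1 n x) (at x)" "(D 1 n has_real_derivative D 2 n x) (at x)" for n x
      using D(1)[of 0 n x] D(1)[of 1 n x] by (simp_all add: numeral_2_eq_2)
    show "\<bar>D 0 n x\<bar> \<le> B n" "\<bar>D 1 n x\<bar> \<le> B n" "\<bar>D 2 n x\<bar> \<le> B n" for n x
      using b[of 0 n x] b[of 1 n x] b[of 2 n x] unfolding B_def by linarith+
    show "(\<integral>x. (D 2 n x)^4 \<partial>gauss) + (\<integral>x. (D 1 n x)^4 \<partial>gauss) \<le> 8 * (S + (\<integral>x. (h 2 x)^4 \<partial>gauss)) + 8 * (S + (\<integral>x. (h 1 x)^4 \<partial>gauss))" for n
      by (intro add_mono D4b) auto
  qed (fact D(2) g2 ul)+
qed


text \<open>The approximating functions are centred and inserted into the bound for smooth functions. Their sums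
  converge in \<open>L\<^sup>2\<close>, so the variances tend to 1 and the expectations of the Lipschitz function
  converge, while the main term depends on the functions only through \<open>K\<close>.\<close>

lemma stein_bound_limit:
  fixes a L :: real
  assumes V: "gaussian_vector M I V" and v: "\<And>i. i \<in> I \<Longrightarrow> (\<integral>x. (V i x)\<^sup>2 \<partial>M) = 1"
    and r: "\<And>i j. r i j = (\<integral>x. V i x * V j x \<partial>M)"
    and S: "\<And>i. i \<in> I \<Longrightarrow> (\<Sum>j\<in>I. \<bar>r i j\<bar>) \<le> S" "0 \<le> S"
    and u: "\<And>n x. (u n has_real_derivative p n x) (at x)" and p: "\<And>n x. (p n has_real_derivative q n x) (at x)"
    and q: "\<And>n. continuous_on UNIV (q n)"
    and b: "\<And>n x. \<bar>u n x\<bar> \<le> B n" "\<And>n x. \<bar>p n x\<bar> \<le> B n" "\<And>n x. \<bar>q n x\<bar> \<le> B n"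
    and K: "\<And>n. (\<integral>x. (q n x) ^ 4 \<partial>gauss) + (\<integral>x. (p n x) ^ 4 \<partial>gauss) \<le> K"
    and g: "square_integrable gauss g" "(\<integral>x. g x \<partial>gauss) = 0"
    and ul: "(\<lambda>n. \<integral>x. (u n x - g x)\<^sup>2 \<partial>gauss) \<longlonglongrightarrow> 0"
    and norm: "(\<integral>x. (a * (\<Sum>i\<in>I. g (V i x)))\<^sup>2 \<partial>M) = 1"
    and h: "\<And>x y. \<bar>h x - h y\<bar> \<le> L * \<bar>x - y\<bar>" "\<And>x. 0 \<le> h x" "\<And>x. h x \<le> 1"
  shows "\<bar>(\<integral>x. h (a * (\<Sum>i\<in>I. g (V i x))) \<partial>M) - (\<integral>x. h x \<partial>gauss)\<bar> \<le> 2 * pi * a\<^sup>2 * sqrt (2 * pi * S ^ 3 * card I * (K / 2))"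
proof -
  interpret M: prob_space M using V by (rule gaussian_vectorD)
  interpret Ga: prob_space gauss by (rule prob_space_gauss)
  have I: "finite I" using V by (rule gaussian_vectorD)
  note mV[measurable] = gaussian_vectorD(5)[OF V]
  note law = gauss_law_integral[OF gaussian_vector_std_normal[OF V _ v] mV]
  have L0: "0 \<le> L" using h(1)[of 1 0] by simp
  have ch: "continuous_on UNIV h"
  proof (rule lipschitz_on_continuous_on)
    show "L-lipschitz_on UNIV h" using h(1) L0 by (auto simp: lipschitz_on_def dist_real_def)
  qed
  have [measurable]: "h \<in> borel_measurable borel" using ch by (rule borel_measurable_continuous_onI)
  have [measurable]: "g \<in> borel_measurable borel" using g(1) by (simp add: square_integrable_def measurable_def)
  have cu: "continuous_on UNIV (u n)" for n using u by (rule continuous_on_of_derivative)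
  have [measurable]: "u n \<in> borel_measurable borel" for n using cu by (rule borel_measurable_continuous_onI)
  define m where "m n = (\<integral>x. u n x \<partial>gauss)" for n
  (* centring does not increase the distance to g, because g has mean 0 *)
  define w where "w n x = u n x - m n" for n x
  have iu: "integrable gauss (u n)" for n by (rule Ga.integrable_const_bound[where B="B n"]) (use b in auto)
  have sq_bounded: "square_integrable gauss f" if [measurable]: "f \<in> borel_measurable borel" and "\<And>x. \<bar>f x\<bar> \<le> D" for f D
  proof -
    have "0 \<le> D" using that(2)[of 0] by linarith
    then have "(f x)\<^sup>2 \<le> D\<^sup>2" for x using that(2)[of x] power_mono[of "\<bar>f x\<bar>" D 2] by simp
    then show ?thesis unfolding square_integrable_def by (auto intro!: Ga.integrable_const_bound[where B="D\<^sup>2"])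
  qed
  have su: "square_integrable gauss (u n)" for n by (rule sq_bounded[OF _ b(1)]) simp
  have s1: "square_integrable gauss (\<lambda>x. c)" for c by (simp add: square_integrable_def)
  have sw: "square_integrable gauss (w n)" for n unfolding w_def[abs_def] by (intro square_integrable_diff su s1)
  have ig: "integrable gauss g" using square_integrable_mult[OF g(1) s1[of 1]] by simp
  define e where "e n = (\<integral>x. (w n x - g x)\<^sup>2 \<partial>gauss)" for n
  have e0: "0 \<le> e n" for n by (simp add: e_def)
  have el: "e \<longlonglongrightarrow> 0"
  proof (rule tendsto_sandwich[OF _ _ tendsto_const ul])
    show "\<forall>\<^sub>F n in sequentially. e n \<le> (\<integral>x. (u n x - g x)\<^sup>2 \<partial>gauss)"
    proof (intro always_eventually allI)
      fix n
      note sd = square_integrable_diff[OF su[of n] g(1)]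
      have mean: "Ga.expectation (\<lambda>x. u n x - g x) = m n" using iu ig g(2) by (simp add: m_def)
      have "e n = Ga.variance (\<lambda>x. u n x - g x)" unfolding mean e_def w_def by (simp add: algebra_simps)
      also have "\<dots> \<le> (\<integral>x. (u n x - g x)\<^sup>2 \<partial>gauss)"
        using Ga.variance_eq[of "\<lambda>x. u n x - g x"] iu ig sd by (simp add: square_integrable_def)
      finally show "e n \<le> (\<integral>x. (u n x - g x)\<^sup>2 \<partial>gauss)" .
    qed
  qed (use e0 in simp)
  define G where "G x = a * (\<Sum>i\<in>I. g (V i x))" for x
  define F where "F n x = a * (\<Sum>i\<in>I. w n (V i x))" for n x
  have sV: "square_integrable M (\<lambda>x. f (V i x))" if "square_integrable gauss f" "i \<in> I" for f i
  proof -
    have [measurable]: "f \<in> borel_measurable borel" using that by (simp add: square_integrable_def measurable_def)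
    show ?thesis using law(2)[OF that(2), of "\<lambda>x. (f x)\<^sup>2"] that mV[OF that(2)] by (simp add: square_integrable_def)
  qed
  have sG: "square_integrable M G" unfolding G_def[abs_def] by (intro square_integrable_cmult square_integrable_sum sV g(1))
  have sF: "square_integrable M (F n)" for n unfolding F_def[abs_def] by (intro square_integrable_cmult square_integrable_sum sV sw)
  define d where "d n = (\<integral>x. (F n x - G x)\<^sup>2 \<partial>M)" for n
  have d0: "0 \<le> d n" for n by (simp add: d_def)
  have de: "d n \<le> a\<^sup>2 * (card I * (card I * e n))" for n
  proof -
    note swg = square_integrable_diff[OF sw[of n] g(1)]
    have i1: "integrable M (\<lambda>x. (w n (V i x) - g (V i x))\<^sup>2)" if "i \<in> I" for i
      using sV[OF swg that] by (simp add: square_integrable_def)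
    have [measurable]: "w n \<in> borel_measurable borel" unfolding w_def[abs_def] by simp
    have e1: "(\<integral>x. (w n (V i x) - g (V i x))\<^sup>2 \<partial>M) = e n" if "i \<in> I" for i
      using law(1)[OF that, of "\<lambda>x. (w n x - g x)\<^sup>2"] by (simp add: e_def that)
    have "d n \<le> (\<integral>x. a\<^sup>2 * (card I * (\<Sum>i\<in>I. (w n (V i x) - g (V i x))\<^sup>2)) \<partial>M)"
      unfolding d_def
    proof (rule integral_mono)
      show "integrable M (\<lambda>x. (F n x - G x)\<^sup>2)" using square_integrable_diff[OF sF sG] by (simp add: square_integrable_def)
      show "integrable M (\<lambda>x. a\<^sup>2 * (card I * (\<Sum>i\<in>I. (w n (V i x) - g (V i x))\<^sup>2)))" using i1 by auto
      fix x
      have "F n x - G x = a * (\<Sum>i\<in>I. w n (V i x) - g (V i x))" by (simp add: F_def G_def sum_subtractf right_diff_distrib)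
      then have "(F n x - G x)\<^sup>2 = a\<^sup>2 * (\<Sum>i\<in>I. w n (V i x) - g (V i x))\<^sup>2" by (simp add: power_mult_distrib)
      also have "\<dots> \<le> a\<^sup>2 * (card I * (\<Sum>i\<in>I. (w n (V i x) - g (V i x))\<^sup>2))"
        using Cauchy_Schwarz_ineq_sum[of "\<lambda>_. 1" "\<lambda>i. w n (V i x) - g (V i x)" I] by (intro mult_left_mono) auto
      finally show "(F n x - G x)\<^sup>2 \<le> a\<^sup>2 * (card I * (\<Sum>i\<in>I. (w n (V i x) - g (V i x))\<^sup>2))" .
    qed
    also have "\<dots> = a\<^sup>2 * (card I * (card I * e n))" using i1 e1 by (simp add: Bochner_Integration.integral_sum)
    finally show ?thesis .
  qed
  have dl: "d \<longlonglongrightarrow> 0"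
  proof (rule tendsto_sandwich[OF _ _ tendsto_const])
    show "(\<lambda>n. a\<^sup>2 * (card I * (card I * e n))) \<longlonglongrightarrow> 0" using tendsto_mult_right_zero[OF el] by (intro tendsto_mult_right_zero el)
  qed (use d0 de in auto)
  have F2: "(\<lambda>n. \<integral>x. (F n x)\<^sup>2 \<partial>M) \<longlonglongrightarrow> 1"
    using L2_product_tendsto[OF sF sF sG sG dl[unfolded d_def[abs_def]] dl[unfolded d_def[abs_def]]] norm by (simp add: G_def power2_eq_square)
  define C where "C = 2 * pi * a\<^sup>2 * sqrt (2 * pi * S ^ 3 * card I * (K / 2))"
  have each: "\<bar>(\<integral>x. h (G x) \<partial>M) - (\<integral>x. h x \<partial>gauss)\<bar> \<le> L * sqrt (d n) + (2 * \<bar>1 - (\<integral>x. (F n x)\<^sup>2 \<partial>M)\<bar> + C)" for n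
  proof -
    have mb: "\<bar>w n x\<bar> \<le> B n + \<bar>m n\<bar>" "\<bar>p n x\<bar> \<le> B n + \<bar>m n\<bar>" "\<bar>q n x\<bar> \<le> B n + \<bar>m n\<bar>" for x
      using b(1)[of n x] b(2)[of n x] b(3)[of n x] unfolding w_def by linarith+
    have dw: "(w n has_real_derivative p n x) (at x)" for x
      unfolding w_def[abs_def] using u[of n x] by (auto intro!: derivative_eq_intros)
    have w0: "(\<integral>x. w n x \<partial>gauss) = 0" unfolding w_def using iu Ga.prob_space by (simp add: m_def)
    have "\<bar>(\<integral>x. h (F n x) \<partial>M) - (\<integral>x. h x \<partial>gauss)\<bar> \<le> 2 * \<bar>1 - (\<integral>x. (F n x)\<^sup>2 \<partial>M)\<bar>
        + 2 * pi * a\<^sup>2 * sqrt (2 * pi * S ^ 3 * card I * (((\<integral>x. (q n x) ^ 4 \<partial>gauss) + (\<integral>x. (p n x) ^ 4 \<partial>gauss)) / 2))"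
      unfolding F_def by (rule stein_bound_smooth[OF V v r S dw p q mb w0 ch h(2,3)])
    also have "\<dots> \<le> 2 * \<bar>1 - (\<integral>x. (F n x)\<^sup>2 \<partial>M)\<bar> + C"
      unfolding C_def using K[of n] S(2)
      by (intro add_left_mono mult_left_mono real_sqrt_le_mono) auto
    finally have A: "\<bar>(\<integral>x. h (F n x) \<partial>M) - (\<integral>x. h x \<partial>gauss)\<bar> \<le> 2 * \<bar>1 - (\<integral>x. (F n x)\<^sup>2 \<partial>M)\<bar> + C" .
    have [measurable]: "F n \<in> borel_measurable M" "G \<in> borel_measurable M" using sF sG by (auto simp: square_integrable_def)
    have ihF: "integrable M (\<lambda>x. h (F n x))" "integrable M (\<lambda>x. h (G x))"
      by (rule M.integrable_const_bound[where B=1]; use h in auto)+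
    note sd = square_integrable_diff[OF sF[of n] sG]
    have s1M: "square_integrable M (\<lambda>x. 1)" by (simp add: square_integrable_def)
    have sabs: "square_integrable M (\<lambda>x. \<bar>F n x - G x\<bar>)" using sd by (auto simp: square_integrable_def)
    have "\<bar>(\<integral>x. h (G x) \<partial>M) - (\<integral>x. h (F n x) \<partial>M)\<bar> = \<bar>\<integral>x. h (G x) - h (F n x) \<partial>M\<bar>" using ihF by simp
    also have "\<dots> \<le> (\<integral>x. L * \<bar>F n x - G x\<bar> \<partial>M)"
    proof (rule abs_integral_le)
      show "integrable M (\<lambda>x. L * \<bar>F n x - G x\<bar>)" using square_integrable_mult[OF sabs s1M] by simp
      show "\<bar>h (G x) - h (F n x)\<bar> \<le> L * \<bar>F n x - G x\<bar>" for x using h(1)[of "G x" "F n x"] by (simp add: abs_minus_commute)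
    qed (use ihF in simp)
    also have "\<dots> \<le> L * sqrt (d n)"
      using integral_Cauchy_Schwarz[OF sabs s1M] L0 by (auto simp: M.prob_space d_def intro!: mult_left_mono)
    finally show ?thesis using A by linarith
  qed
  have "(\<lambda>n. L * sqrt (d n) + (2 * \<bar>1 - (\<integral>x. (F n x)\<^sup>2 \<partial>M)\<bar> + C)) \<longlonglongrightarrow> L * sqrt 0 + (2 * \<bar>1 - 1\<bar> + C)"
    by (intro tendsto_intros dl F2)
  then have "(\<lambda>n. L * sqrt (d n) + (2 * \<bar>1 - (\<integral>x. (F n x)\<^sup>2 \<partial>M)\<bar> + C)) \<longlonglongrightarrow> C" by simp
  then have "\<bar>(\<integral>x. h (G x) \<partial>M) - (\<integral>x. h x \<partial>gauss)\<bar> \<le> C"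
    by (rule LIMSEQ_le_const) (use each in auto)
  then show ?thesis unfolding G_def C_def .
qed

section \<open>Hermite polynomials\<close>

text \<open>The recursion is the one that the product rule gives for the derivatives of
  \<open>exp (- t\<^sup>2 / 2)\<close>.\<close>

fun hermite_poly :: "nat \<Rightarrow> real poly" where
  "hermite_poly 0 = 1"
| "hermite_poly (Suc m) = pCons 0 (hermite_poly m) - pderiv (hermite_poly m)"

lemma hermite_eq_poly: "hermite m x = poly (hermite_poly m) x"
proof -
  have "(deriv ^^ m) (\<lambda>t::real. exp (- (t\<^sup>2) / 2)) = (\<lambda>x. (-1) ^ m * poly (hermite_poly m) x * exp (- (x\<^sup>2) / 2))"
  proof (induction m)
    case (Suc m)
    have "((\<lambda>x. (-1) ^ m * poly (hermite_poly m) x * exp (- (x\<^sup>2) / 2)) has_real_derivative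
        (-1) ^ Suc m * poly (hermite_poly (Suc m)) x * exp (- (x\<^sup>2) / 2)) (at x)" for x :: real
      by (auto intro!: derivative_eq_intros simp: power2_eq_square algebra_simps)
    then show ?case unfolding funpow.simps o_apply Suc by (intro ext DERIV_imp_deriv)
  qed simp
  then have "hermite m x = ((-1) ^ m * (-1) ^ m) * (exp (x\<^sup>2 / 2) * exp (- (x\<^sup>2) / 2)) * poly (hermite_poly m) x"
    by (simp add: hermite_def mult_ac)
  also have "((-1) ^ m * (-1) ^ m :: real) = 1" by (simp flip: power_mult_distrib)
  also have "exp (x\<^sup>2 / 2) * exp (- (x\<^sup>2) / 2) = 1" by (simp flip: exp_add)
  finally show ?thesis by simp
qed

lemma pderiv_hermite_poly: "pderiv (hermite_poly (Suc m)) = smult (real (Suc m)) (hermite_poly m)"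
proof (induction m)
  case 0
  then show ?case by (simp add: pderiv_pCons)
next
  case (Suc m)
  have "pderiv (hermite_poly (Suc (Suc m))) = hermite_poly (Suc m) + (pCons 0 (pderiv (hermite_poly (Suc m))) - pderiv (pderiv (hermite_poly (Suc m))))"
    by (subst hermite_poly.simps(2)) (simp add: pderiv_pCons pderiv_diff del: hermite_poly.simps(2))
  also have "\<dots> = hermite_poly (Suc m) + smult (real (Suc m)) (hermite_poly (Suc m))"
    unfolding Suc.IH by (simp add: pderiv_smult smult_diff_right)
  finally show ?case by (simp only: of_nat_Suc[of "Suc m"] smult_add_left smult_1_left)
qed

lemma borel_measurable_poly: "poly (p :: real poly) \<in> borel_measurable borel"
  by (intro borel_measurable_continuous_onI continuous_intros)

lemma integrable_gauss_poly: "integrable gauss (poly p)"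
proof -
  have "poly p = (\<lambda>x. \<Sum>i\<le>degree p. coeff p i * x ^ i)" by (auto simp: poly_altdef)
  then show ?thesis using integrable_gauss_power by simp
qed

lemma square_integrable_gauss_poly: "square_integrable gauss (poly p)"
  using integrable_gauss_poly[of "p ^ 2"] borel_measurable_poly[of p] unfolding square_integrable_def
  by (simp add: poly_power[abs_def])

lemma poly_std_normal_density_tendsto_0:
  "((\<lambda>x. poly p x * std_normal_density x) \<longlongrightarrow> 0) at_top" "((\<lambda>x. poly p x * std_normal_density x) \<longlongrightarrow> 0) at_bot"
proof -
  have top: "((\<lambda>x. x ^ k * std_normal_density x) \<longlongrightarrow> 0) at_top" for k
  proof -
    have "((\<lambda>x::real. x ^ k * exp (- x\<^sup>2 / 2)) \<longlongrightarrow> 0) at_top" by real_asymp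
    from tendsto_mult_right_zero[OF this, of "1 / sqrt (2*pi)"] show ?thesis by (simp add: std_normal_density_def mult_ac)
  qed
  have bot: "((\<lambda>x. x ^ k * std_normal_density x) \<longlongrightarrow> 0) at_bot" for k
  proof -
    have "((\<lambda>x. (-1)^k * (x ^ k * std_normal_density x)) \<longlongrightarrow> 0) at_top" by (rule tendsto_mult_right_zero[OF top])
    moreover have "(-1)^k * (x ^ k * std_normal_density x) = (-x) ^ k * std_normal_density (-x)" for x :: real
      by (simp add: std_normal_density_def power_minus[of x] mult.assoc)
    ultimately show ?thesis by (simp add: filterlim_at_bot_mirror)
  qed
  have e: "(\<lambda>x. poly p x * std_normal_density x) = (\<lambda>x. \<Sum>i\<le>degree p. coeff p i * (x ^ i * std_normal_density x))"
    by (auto simp: poly_altdef sum_distrib_right mult.assoc)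
  show "((\<lambda>x. poly p x * std_normal_density x) \<longlongrightarrow> 0) at_top" "((\<lambda>x. poly p x * std_normal_density x) \<longlongrightarrow> 0) at_bot"
    unfolding e by (intro tendsto_null_sum tendsto_mult_right_zero top bot)+
qed

lemma square_integrable_component:
  assumes V: "gaussian_vector M I V" and i: "i \<in> I" and v: "(\<integral>x. (V i x)\<^sup>2 \<partial>M) = 1" and f: "square_integrable gauss f"
  shows "square_integrable M (\<lambda>x. f (V i x))" "(\<integral>x. (f (V i x))\<^sup>2 \<partial>M) = (\<integral>x. (f x)\<^sup>2 \<partial>gauss)"
proof -
  have [measurable]: "f \<in> borel_measurable borel" using f by (simp add: square_integrable_def measurable_def)
  have [measurable]: "V i \<in> borel_measurable M" by (rule gaussian_vectorD(5)[OF V i])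
  note law = gauss_law_integral[OF gaussian_vector_std_normal[OF V i v], of "\<lambda>x. (f x)\<^sup>2"]
  show "square_integrable M (\<lambda>x. f (V i x))" "(\<integral>x. (f (V i x))\<^sup>2 \<partial>M) = (\<integral>x. (f x)\<^sup>2 \<partial>gauss)"
    using law f by (simp_all add: square_integrable_def)
qed

lemma poly_component_integrable:
  assumes V: "gaussian_vector M I V" and v: "\<And>i. i \<in> I \<Longrightarrow> (\<integral>x. (V i x)\<^sup>2 \<partial>M) = 1" and "i \<in> I" "j \<in> I"
  shows "integrable M (\<lambda>x. poly a (V i x) * poly b (V j x))"
  by (intro square_integrable_mult square_integrable_component[OF V] square_integrable_gauss_poly v assms)

text \<open>The function \<open>poly a (V i) * poly b (V j)\<close> moves in both factors when the vector moves in
  the direction of the covariances with \<open>V i\<close>: with speed 1 in the first and with speed the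
  covariance of \<open>V i\<close> and \<open>V j\<close> in the second.\<close>

lemma poly_ibp:
  assumes V: "gaussian_vector M I V" and v: "\<And>i. i \<in> I \<Longrightarrow> (\<integral>x. (V i x)\<^sup>2 \<partial>M) = 1"
    and i: "i \<in> I" and j: "j \<in> I"
  shows "(\<integral>x. V i x * (poly a (V i x) * poly b (V j x)) \<partial>M)
     = (\<integral>x. poly (pderiv a) (V i x) * poly b (V j x) \<partial>M) + (\<integral>x. V i x * V j x \<partial>M) * (\<integral>x. poly a (V i x) * poly (pderiv b) (V j x) \<partial>M)"
proof -
  define r where "r k = (\<integral>x. V i x * V k x \<partial>M)" for k
  have ri: "r i = 1" using v[OF i] by (simp add: r_def power2_eq_square)
  define \<Phi> where "\<Phi> w = poly a (w i) * poly b (w j)" for w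
  define \<Phi>' where "\<Phi>' w = poly (pderiv a) (w i) * poly b (w j) + r j * (poly a (w i) * poly (pderiv b) (w j))" for w
  note mp = borel_measurable_poly
  have int: "integrable M (\<lambda>x. poly a (V i x) * poly b (V j x))" if "i \<in> I" "j \<in> I" for a b i j
    by (rule poly_component_integrable[OF V]) (use v that in auto)
  have "(\<integral>x. V i x * \<Phi> (\<lambda>k. V k x) \<partial>M) = (\<integral>x. \<Phi>' (\<lambda>k. V k x) \<partial>M)"
  proof (rule gaussian_vector_ibp[where r=r and \<Phi>=\<Phi> and \<Phi>'=\<Phi>', OF V i v[OF i]])
    show "r k = (\<integral>x. V i x * V k x \<partial>M)" for k by (rule r_def)
    show "cylindrical I \<Phi>" unfolding \<Phi>_def[abs_def]
      by (intro cylindrical_intros cylindrical_coordinate mp i j)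
    show "cylindrical I \<Phi>'" unfolding \<Phi>'_def[abs_def]
      by (intro cylindrical_intros cylindrical_coordinate mp i j)
    show "((\<lambda>t. \<Phi> (\<lambda>k. w k + t * r k)) has_real_derivative \<Phi>' (\<lambda>k. w k + x * r k)) (at x)" for w x
      unfolding \<Phi>_def \<Phi>'_def using ri by (auto intro!: derivative_eq_intros simp: algebra_simps)
    show "continuous_on UNIV (\<lambda>x. \<Phi>' (\<lambda>k. w k + x * r k))" for w
      unfolding \<Phi>'_def by (intro continuous_intros)
    have line: "\<Phi> (\<lambda>k. w k + x * r k) = poly (pcompose a [:w i, r i:] * pcompose b [:w j, r j:]) x" for w x
      by (simp add: \<Phi>_def poly_pcompose mult_ac)
    show "((\<lambda>x. \<Phi> (\<lambda>k. w k + x * r k) * std_normal_density x) \<longlongrightarrow> 0) at_top"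
      "((\<lambda>x. \<Phi> (\<lambda>k. w k + x * r k) * std_normal_density x) \<longlongrightarrow> 0) at_bot" for w
      unfolding line by (rule poly_std_normal_density_tendsto_0)+
    show "integrable M (\<lambda>x. V i x * \<Phi> (\<lambda>k. V k x))"
      using int[OF i j, of "pCons 0 a" b] by (simp add: \<Phi>_def mult.assoc)
    show "integrable M (\<lambda>x. \<Phi>' (\<lambda>k. V k x))"
      using int[OF i j, of "pderiv a" b] int[OF i j, of a "pderiv b"] by (simp add: \<Phi>'_def)
  qed
  then show ?thesis
    using int[OF i j, of "pderiv a" b] int[OF i j, of a "pderiv b"] by (simp add: \<Phi>_def \<Phi>'_def r_def)
qed

text \<open>In the recursion for Hermite polynomials the derivative term cancels the first term of the
  integration by parts. Each step lowers both degrees by one and produces a factor of covariance.\<close>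

lemma hermite_product_step:
  assumes V: "gaussian_vector M I V" and v: "\<And>i. i \<in> I \<Longrightarrow> (\<integral>x. (V i x)\<^sup>2 \<partial>M) = 1"
    and i: "i \<in> I" and j: "j \<in> I"
  shows "(\<integral>x. poly (hermite_poly (Suc m)) (V i x) * poly b (V j x) \<partial>M)
    = (\<integral>x. V i x * V j x \<partial>M) * (\<integral>x. poly (hermite_poly m) (V i x) * poly (pderiv b) (V j x) \<partial>M)"
proof -
  have int: "integrable M (\<lambda>x. poly a (V i x) * poly b (V j x))" for a b
    by (rule poly_component_integrable[OF V]) (use v i j in auto)
  have iV: "integrable M (\<lambda>x. V i x * (poly (hermite_poly m) (V i x) * poly b (V j x)))"
    using int[of "pCons 0 (hermite_poly m)" b] by (simp add: mult.assoc)
  have "(\<integral>x. poly (hermite_poly (Suc m)) (V i x) * poly b (V j x) \<partial>M)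
     = (\<integral>x. V i x * (poly (hermite_poly m) (V i x) * poly b (V j x)) - poly (pderiv (hermite_poly m)) (V i x) * poly b (V j x) \<partial>M)"
    by (simp add: algebra_simps)
  also have "\<dots> = (\<integral>x. V i x * (poly (hermite_poly m) (V i x) * poly b (V j x)) \<partial>M) - (\<integral>x. poly (pderiv (hermite_poly m)) (V i x) * poly b (V j x) \<partial>M)"
    by (rule Bochner_Integration.integral_diff[OF iV int])
  also have "(\<integral>x. V i x * (poly (hermite_poly m) (V i x) * poly b (V j x)) \<partial>M)
     = (\<integral>x. poly (pderiv (hermite_poly m)) (V i x) * poly b (V j x) \<partial>M) + (\<integral>x. V i x * V j x \<partial>M) * (\<integral>x. poly (hermite_poly m) (V i x) * poly (pderiv b) (V j x) \<partial>M)"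
    by (rule poly_ibp[OF V _ i j]) (rule v)
  finally show ?thesis by simp
qed

lemma hermite_product_expectation:
  assumes V: "gaussian_vector M I V" and v: "\<And>i. i \<in> I \<Longrightarrow> (\<integral>x. (V i x)\<^sup>2 \<partial>M) = 1"
    and i: "i \<in> I" and j: "j \<in> I"
  shows "(\<integral>x. hermite m (V i x) * hermite l (V j x) \<partial>M) = (if m = l then fact m * (\<integral>x. V i x * V j x \<partial>M) ^ m else 0)"
proof -
  interpret prob_space M using V by (rule gaussian_vectorD)
  have zero: "(\<integral>x. poly (hermite_poly (Suc k)) (V i x) * poly (hermite_poly 0) (V j x) \<partial>M) = 0" if "i \<in> I" "j \<in> I" for i j k
    using hermite_product_step[OF V _ that, of k "hermite_poly 0"] v by simp
  have "(\<integral>x. poly (hermite_poly m) (V i x) * poly (hermite_poly l) (V j x) \<partial>M) = (if m = l then fact m * (\<integral>x. V i x * V j x \<partial>M) ^ m else 0)"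
  proof (induction m arbitrary: l)
    case 0
    show ?case
    proof (cases l)
      case (Suc k)
      then show ?thesis using zero[OF j i, of k] by (simp add: mult.commute del: hermite_poly.simps(2))
    qed (simp add: prob_space)
  next
    case (Suc m)
    show ?case
    proof (cases l)
      case 0
      then show ?thesis using zero[OF i j, of m] by (simp del: hermite_poly.simps)
    next
      case l: (Suc k)
      have "(\<integral>x. poly (hermite_poly (Suc m)) (V i x) * poly (hermite_poly (Suc k)) (V j x) \<partial>M)
        = (\<integral>x. V i x * V j x \<partial>M) * (real (Suc k) * (\<integral>x. poly (hermite_poly m) (V i x) * poly (hermite_poly k) (V j x) \<partial>M))"
        using hermite_product_step[OF V _ i j, of m "hermite_poly (Suc k)"] v unfolding pderiv_hermite_poly
        by (simp add: mult_ac del: hermite_poly.simps(2))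
      then show ?thesis unfolding l Suc.IH by (simp add: mult_ac del: hermite_poly.simps(2))
    qed
  qed
  then show ?thesis by (simp only: hermite_eq_poly)
qed

section \<open>Gaussian families and the asymptotic variance\<close>

text \<open>A mean-zero point mass sits at 0 and also satisfies the definition, with variance 0.\<close>

lemma gaussian_law_centred:
  assumes M: "prob_space M" and Y[measurable]: "Y \<in> borel_measurable M" and law: "gaussian_law (distr M borel Y)"
    and mean: "(\<integral>x. Y x \<partial>M) = 0"
  shows "centred_gaussian M Y"
proof -
  interpret prob_space M by fact
  from law consider (nd) m s where "s > 0" "distr M borel Y = density lborel (normal_density m s)" | (pt) m where "distr M borel Y = return borel m"
    unfolding gaussian_law_def by blast
  then show ?thesis
  proof cases
    case (nd m s)
    have dl: "distr M lborel Z = distr M borel Z" for Z :: "_ \<Rightarrow> real" by (rule distr_cong) auto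
    have d: "distributed M lborel Y (normal_density m s)"
      using nd by (simp add: distributed_def dl)
    have m: "m = 0" using normal_distributed_expectation[OF nd(1) d] mean by simp
    have "distributed M lborel (\<lambda>x. Y x / s) std_normal_density"
      using d normal_standard_normal_convert[OF nd(1), of Y 0] m by simp
    then have g: "distr M borel (\<lambda>x. Y x / s) = gauss" unfolding gauss_def distributed_def dl by simp
    have sq: "integrable M (\<lambda>x. (Y x / s)\<^sup>2)" "(\<integral>x. (Y x / s)\<^sup>2 \<partial>M) = 1"
      using gauss_law_integral[OF g, of "\<lambda>x. x\<^sup>2"] integrable_gauss_power[of 2] integral_std_normal_moment_even[of 1]
      by (simp_all add: integral_gauss)
    have Ys: "(Y x)\<^sup>2 = s\<^sup>2 * (Y x / s)\<^sup>2" for x using nd(1) by (simp add: power_divide)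
    have i2: "integrable M (\<lambda>x. (Y x)\<^sup>2)" unfolding Ys by (intro Bochner_Integration.integrable_mult_right impI sq(1))
    have e2: "(\<integral>x. (Y x)\<^sup>2 \<partial>M) = s\<^sup>2" unfolding Ys integral_mult_right_zero sq(2) by simp
    have "(\<integral>x. iexp (Y x) \<partial>M) = (\<integral>x. iexp (s * (Y x / s)) \<partial>M)" using nd(1) by simp
    also have "\<dots> = char (distr M borel (\<lambda>x. Y x / s)) s" unfolding char_def by (subst integral_distr) auto
    also have "\<dots> = exp (- s\<^sup>2 / 2)" unfolding g using fun_cong[OF char_std_normal_distribution, of s] by (simp add: gauss_def)
    finally show ?thesis unfolding centred_gaussian_def e2 using i2 mean by simp
  next
    case (pt m)
    have e: "(\<integral>x. f (Y x) \<partial>M) = f m" "integrable M (\<lambda>x. f (Y x))" if "f \<in> borel_measurable borel" for f :: "real \<Rightarrow> 'b::{banach,second_countable_topology}"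
    proof -
      show "(\<integral>x. f (Y x) \<partial>M) = f m" using integral_distr[OF Y that] that by (simp add: pt integral_return)
      interpret R: prob_space "return borel m" by (rule prob_space_return) simp
      have "AE x in return borel m. norm (f x) \<le> norm (f m)" using that by (subst AE_return) auto
      then have "integrable (return borel m) f" using that by (intro R.integrable_const_bound) auto
      then show "integrable M (\<lambda>x. f (Y x))" using integrable_distr_eq[OF Y that] by (simp add: pt)
    qed
    have "m = 0" using e(1)[of "\<lambda>x. x"] mean by simp
    then show ?thesis unfolding centred_gaussian_def using e(1)[of "\<lambda>x. x\<^sup>2"] e(2)[of "\<lambda>x. x\<^sup>2"] e(1)[of iexp] mean by simp
  qed
qed

lemma gaussian_family_vector:
  assumes M: "prob_space M" and X: "gaussian_family M X" and mean: "\<And>n. (\<integral>x. X n x \<partial>M) = 0" and I: "finite I"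
  shows "gaussian_vector M I X"
  unfolding gaussian_vector_def
proof (intro conjI allI M I)
  have [measurable]: "X i \<in> borel_measurable M" for i using X by (simp add: gaussian_family_def)
  have law: "gaussian_law (distr M borel (\<lambda>\<omega>. \<Sum>i\<in>J. a i * X i \<omega>))" if "finite J" for J a
    using X that by (simp add: gaussian_family_def)
  interpret prob_space M by fact
  have "centred_gaussian M (X i)" for i
    by (rule gaussian_law_centred[OF M]) (use law[of "{i}" "\<lambda>_. 1"] mean in auto)
  then have int: "integrable M (X i)" for i
    by (auto simp: centred_gaussian_def intro: square_integrable_imp_integrable)
  show "centred_gaussian M (\<lambda>x. \<Sum>i\<in>I. a i * X i x)" for a
  proof (rule gaussian_law_centred[OF M _ law[OF I]])
    show "(\<integral>x. (\<Sum>i\<in>I. a i * X i x) \<partial>M) = 0" using int mean by (simp add: Bochner_Integration.integral_sum)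
  qed measurable
qed

text \<open>Shift by \<open>i\<close> and evaluate the two-coordinate functional on the path space.\<close>

lemma stationary_covariance:
  fixes X :: "int \<Rightarrow> 'a \<Rightarrow> real"
  assumes st: "stationary_family M X" and X: "\<And>n. X n \<in> borel_measurable M"
  shows "(\<integral>x. X i x * X j x \<partial>M) = (\<integral>x. X 0 x * X (j - i) x \<partial>M)"
proof -
  have m: "(\<lambda>\<omega> n. X (n + h) \<omega>) \<in> M \<rightarrow>\<^sub>M (Pi\<^sub>M UNIV (\<lambda>_. borel))" for h
    by (rule measurable_PiM_single') (use X in auto)
  have f: "(\<lambda>w. w 0 * w (j - i)) \<in> borel_measurable (Pi\<^sub>M UNIV (\<lambda>_. borel :: real measure))" by measurable
  have "distr M (Pi\<^sub>M UNIV (\<lambda>_. borel)) (\<lambda>\<omega> n. X (n + i) \<omega>) = distr M (Pi\<^sub>M UNIV (\<lambda>_. borel)) (\<lambda>\<omega> n. X (n + 0) \<omega>)"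
    using st by (simp add: stationary_family_def)
  then show ?thesis using integral_distr[OF m f, of i] integral_distr[OF m f, of 0] by simp
qed

lemma hermite_expansion_L2:
  assumes "hermite_expansion 1 c g"
  shows "square_integrable gauss g" "(\<lambda>n. \<integral>x. ((\<Sum>m=1..n. c m * hermite m x) - g x)\<^sup>2 \<partial>gauss) \<longlonglongrightarrow> 0"
proof -
  show "square_integrable gauss g" using assms by (simp add: hermite_expansion_def Lp_fun_def square_integrable_def)
  have "(\<lambda>n. (Lp_norm gauss 2 (\<lambda>x. g x - (\<Sum>m=1..n. c m * hermite m x)))\<^sup>2) \<longlonglongrightarrow> 0\<^sup>2"
    using assms by (intro tendsto_power) (simp add: hermite_expansion_def)
  moreover have "(Lp_norm gauss 2 f)\<^sup>2 = (\<integral>x. (f x)\<^sup>2 \<partial>gauss)" for f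
    by (simp add: Lp_norm_def powr_half_sqrt)
  ultimately show "(\<lambda>n. \<integral>x. ((\<Sum>m=1..n. c m * hermite m x) - g x)\<^sup>2 \<partial>gauss) \<longlonglongrightarrow> 0"
    by (simp add: power2_commute)
qed

lemma square_integrable_hermite_sum: "square_integrable gauss (\<lambda>x. \<Sum>m=1..n. c m * hermite m x)"
  unfolding hermite_eq_poly by (intro square_integrable_sum square_integrable_cmult square_integrable_gauss_poly)

lemma hermite_expansion_covariance:
  assumes V: "gaussian_vector M I V" and v: "\<And>i. i \<in> I \<Longrightarrow> (\<integral>x. (V i x)\<^sup>2 \<partial>M) = 1"
    and i: "i \<in> I" and j: "j \<in> I" and g: "hermite_expansion 1 c g"
  shows "(\<lambda>n. \<Sum>m=1..n. fact m * (c m)\<^sup>2 * (\<integral>x. V i x * V j x \<partial>M) ^ m) \<longlonglongrightarrow> (\<integral>x. g (V i x) * g (V j x) \<partial>M)"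
proof -
  define S where "S n x = (\<Sum>m=1..n. c m * hermite m x)" for n x
  have sS: "square_integrable gauss (S n)" for n unfolding S_def[abs_def] by (rule square_integrable_hermite_sum)
  note sg = hermite_expansion_L2(1)[OF g]
  note comp = square_integrable_component[OF V _ v]
  have lim: "(\<lambda>n. \<integral>x. (S n (V k x) - g (V k x))\<^sup>2 \<partial>M) \<longlonglongrightarrow> 0" if "k \<in> I" for k
    using comp(2)[OF that that square_integrable_diff[OF sS sg]] hermite_expansion_L2(2)[OF g] by (simp add: S_def)
  have "(\<lambda>n. \<integral>x. S n (V i x) * S n (V j x) \<partial>M) \<longlonglongrightarrow> (\<integral>x. g (V i x) * g (V j x) \<partial>M)"
    by (intro L2_product_tendsto comp(1) sS sg i j lim)
  moreover have "(\<integral>x. S n (V i x) * S n (V j x) \<partial>M) = (\<Sum>m=1..n. fact m * (c m)\<^sup>2 * (\<integral>x. V i x * V j x \<partial>M) ^ m)" for n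
  proof -
    have hi: "integrable M (\<lambda>x. hermite m (V i x) * hermite l (V j x))" for m l
      unfolding hermite_eq_poly by (rule poly_component_integrable[OF V]) (use v i j in auto)
    have "(\<integral>x. S n (V i x) * S n (V j x) \<partial>M) = (\<integral>x. (\<Sum>m=1..n. \<Sum>l=1..n. (c m * c l) * (hermite m (V i x) * hermite l (V j x))) \<partial>M)"
      unfolding S_def sum_product by (simp only: mult_ac)
    also have "\<dots> = (\<Sum>m=1..n. \<Sum>l=1..n. (c m * c l) * (\<integral>x. hermite m (V i x) * hermite l (V j x) \<partial>M))"
      using hi by (simp add: Bochner_Integration.integral_sum Bochner_Integration.integrable_sum)
    also have "\<dots> = (\<Sum>m=1..n. \<Sum>l=1..n. if m = l then fact m * (c m)\<^sup>2 * (\<integral>x. V i x * V j x \<partial>M) ^ m else 0)"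
    proof (intro sum.cong refl)
      fix m l
      have "(\<integral>x. hermite m (V i x) * hermite l (V j x) \<partial>M) = (if m = l then fact m * (\<integral>x. V i x * V j x \<partial>M) ^ m else 0)"
        by (rule hermite_product_expectation[OF V v i j])
      then show "(c m * c l) * (\<integral>x. hermite m (V i x) * hermite l (V j x) \<partial>M) = (if m = l then fact m * (c m)\<^sup>2 * (\<integral>x. V i x * V j x \<partial>M) ^ m else 0)"
        by (simp add: power2_eq_square mult_ac)
    qed
    also have "\<dots> = (\<Sum>m=1..n. fact m * (c m)\<^sup>2 * (\<integral>x. V i x * V j x \<partial>M) ^ m)"
      by (intro sum.cong refl) simp
    finally show ?thesis .
  qed
  ultimately show ?thesis by simp
qed

lemma hermite_expansion_mean:
  assumes g: "hermite_expansion 1 c g"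
  shows "(\<integral>x. g x \<partial>gauss) = 0"
proof -
  interpret prob_space gauss by (rule prob_space_gauss)
  note sg = hermite_expansion_L2[OF g]
  have s1: "square_integrable gauss (\<lambda>x. 1)" by (simp add: square_integrable_def)
  have "(\<lambda>n. \<integral>x. (\<Sum>m=1..n. c m * hermite m x) * 1 \<partial>gauss) \<longlonglongrightarrow> (\<integral>x. g x * 1 \<partial>gauss)"
    by (rule L2_product_tendsto[OF square_integrable_hermite_sum s1 sg(1) s1 sg(2)]) simp
  moreover have "(\<integral>x. (\<Sum>m=1..n. c m * hermite m x) * 1 \<partial>gauss) = 0" for n
  proof -
    have u: "(\<integral>x. x\<^sup>2 \<partial>gauss) = 1" using integral_std_normal_moment_even[of 1] by (simp add: integral_gauss)
    have h0: "hermite 0 x = 1" for x by (simp add: hermite_eq_poly)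
    have "(\<integral>x. hermite m x \<partial>gauss) = 0" if "m \<ge> 1" for m
      using hermite_product_expectation[OF gaussian_vector_gauss, of "()" "()" m 0] u that by (simp add: h0)
    moreover have "integrable gauss (hermite m)" for m
      unfolding hermite_eq_poly[abs_def] using integrable_gauss_poly by simp
    ultimately show ?thesis by (simp add: Bochner_Integration.integral_sum)
  qed
  ultimately have "(\<lambda>n. 0) \<longlonglongrightarrow> (\<integral>x. g x \<partial>gauss)" by simp
  then show ?thesis by (simp add: LIMSEQ_const_iff)
qed

lemma integral_count_space_finite:
  assumes "finite T"
  shows "integrable (count_space UNIV) (\<lambda>k. indicator T k * (f k :: real))" "(\<integral>k. indicator T k * f k \<partial>count_space UNIV) = (\<Sum>k\<in>T. f k)"
proof -
  have e: "indicator T k * f k = (\<Sum>t\<in>T. indicator {t} k * f t)" for k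
  proof -
    have "(\<Sum>t\<in>T. indicator {t} k * f t) = (\<Sum>t\<in>T. if t = k then f t else 0)" by (intro sum.cong) (auto simp: indicator_def)
    then show ?thesis using assms by (simp add: indicator_def)
  qed
  have i: "integrable (count_space UNIV) (\<lambda>k. indicator {t} k * f t)" for t
    by (intro integrable_mult_left impI integrable_real_indicator) auto
  show "integrable (count_space UNIV) (\<lambda>k. indicator T k * f k)" unfolding e using i by (intro Bochner_Integration.integrable_sum) auto
  show "(\<integral>k. indicator T k * f k \<partial>count_space UNIV) = (\<Sum>k\<in>T. f k)" unfolding e using i by (simp add: Bochner_Integration.integral_sum measure_count_space)
qed

text \<open>The average is the sum of \<open>w n k * R k\<close> over all \<open>k\<close>, where \<open>w n k\<close> is the proportion of
  those \<open>i\<close> in \<open>{1..n}\<close> for which \<open>k + i\<close> is again in \<open>{1..n}\<close>. These weights lie between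
  0 and 1 and tend to 1, so dominated convergence for the counting measure applies.\<close>

lemma toeplitz_average_tendsto:
  fixes R :: "int \<Rightarrow> real"
  assumes R: "(\<lambda>k. \<bar>R k\<bar>) summable_on UNIV"
  shows "(\<lambda>n. (\<Sum>i=1..int n. \<Sum>j=1..int n. R (j - i)) / real n) \<longlonglongrightarrow> (\<Sum>\<^sub>\<infinity>k. R k)"
proof -
  have iR: "integrable (count_space UNIV) R"
    using R abs_summable_equivalent[of R UNIV] by (simp add: Infinite_Set_Sum.abs_summable_on_def)
  have eR: "(\<Sum>\<^sub>\<infinity>k. R k) = (\<integral>k. R k \<partial>count_space UNIV)"
    using infsetsum_infsum[of R UNIV] R abs_summable_equivalent[of R UNIV] by (simp add: infsetsum_def)
  define w where "w n k = (\<Sum>i=1..int n. indicator {1..int n} (k + i)) / real n" for n and k :: int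
  have s: "(\<Sum>i=1..int n. \<Sum>j=1..int n. R (j - i)) / real n = (\<integral>k. w n k * R k \<partial>count_space UNIV)" for n
  proof -
    have each: "(\<Sum>j=1..int n. R (j - i)) = (\<integral>k. indicator {1..int n} (k + i) * R k \<partial>count_space UNIV)"
      "integrable (count_space UNIV) (\<lambda>k. indicator {1..int n} (k + i) * R k)" for i
    proof -
      have "(\<Sum>j=1..int n. R (j - i)) = (\<Sum>k\<in>{1 - i..int n - i}. R k)"
        by (rule sum.reindex_bij_witness[of _ "\<lambda>k. k + i" "\<lambda>j. j - i"]) auto
      moreover have "indicator {1..int n} (k + i) = (indicator {1 - i..int n - i} k :: real)" for k
        by (auto simp: indicator_def)
      ultimately show "(\<Sum>j=1..int n. R (j - i)) = (\<integral>k. indicator {1..int n} (k + i) * R k \<partial>count_space UNIV)"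
        "integrable (count_space UNIV) (\<lambda>k. indicator {1..int n} (k + i) * R k)"
        using integral_count_space_finite[of "{1 - i..int n - i}" R] by simp_all
    qed
    have "(\<Sum>i=1..int n. \<Sum>j=1..int n. R (j - i)) = (\<integral>k. (\<Sum>i=1..int n. indicator {1..int n} (k + i) * R k) \<partial>count_space UNIV)"
      unfolding each(1) using each(2) by (intro Bochner_Integration.integral_sum[symmetric]) auto
    also have "\<dots> = (\<integral>k. real n * (w n k * R k) \<partial>count_space UNIV)"
      by (cases "n = 0") (simp_all add: w_def sum_distrib_right)
    finally show ?thesis by (cases "n = 0") (simp_all add: w_def)
  qed
  have w01: "0 \<le> w n k" "w n k \<le> 1" for n k
  proof -
    show "0 \<le> w n k" unfolding w_def by (auto intro!: sum_nonneg divide_nonneg_nonneg)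
    have "(\<Sum>i=1..int n. indicator {1..int n} (k + i)) \<le> (\<Sum>i=1..int n. 1::real)"
      by (intro sum_mono) (auto simp: indicator_def)
    then show "w n k \<le> 1" unfolding w_def by (cases "n = 0") (simp_all add: divide_le_eq_1)
  qed
  have wl: "(\<lambda>n. w n k) \<longlonglongrightarrow> 1" for k
  proof (rule tendsto_sandwich[OF _ _ _ tendsto_const])
    show "(\<lambda>n. 1 - 2 * real_of_int \<bar>k\<bar> / real n) \<longlonglongrightarrow> 1"
      using tendsto_diff[OF tendsto_const lim_const_over_n[of "2 * real_of_int \<bar>k\<bar>"], of 1] by simp
    show "\<forall>\<^sub>F n in sequentially. 1 - 2 * real_of_int \<bar>k\<bar> / real n \<le> w n k"
    proof (rule eventually_sequentiallyI[of "Suc (nat (2 * \<bar>k\<bar>))"])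
      fix n assume n: "Suc (nat (2 * \<bar>k\<bar>)) \<le> n"
      (* all i with distance at least |k| from both ends are counted *)
      have "real n - 2 * real_of_int \<bar>k\<bar> = (\<Sum>i\<in>{1 + \<bar>k\<bar>..int n - \<bar>k\<bar>}. 1)" using n by simp
      also have "\<dots> \<le> (\<Sum>i\<in>{1 + \<bar>k\<bar>..int n - \<bar>k\<bar>}. indicator {1..int n} (k + i))"
        by (intro sum_mono) (auto simp: indicator_def)
      also have "\<dots> \<le> (\<Sum>i=1..int n. indicator {1..int n} (k + i))"
        by (intro sum_mono2) auto
      finally have "(real n - 2 * real_of_int \<bar>k\<bar>) / real n \<le> w n k"
        unfolding w_def by (rule divide_right_mono) simp
      moreover have "(real n - 2 * real_of_int \<bar>k\<bar>) / real n = 1 - 2 * real_of_int \<bar>k\<bar> / real n"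
        using n by (simp add: diff_divide_distrib)
      ultimately show "1 - 2 * real_of_int \<bar>k\<bar> / real n \<le> w n k" by simp
    qed
    show "\<forall>\<^sub>F n in sequentially. w n k \<le> 1" using w01 by simp
  qed
  have "(\<lambda>n. \<integral>k. w n k * R k \<partial>count_space UNIV) \<longlonglongrightarrow> (\<integral>k. R k \<partial>count_space UNIV)"
  proof (rule integral_dominated_convergence[where w="\<lambda>k. \<bar>R k\<bar>"])
    show "AE k in count_space UNIV. (\<lambda>n. w n k * R k) \<longlonglongrightarrow> R k"
      using tendsto_mult_right[OF wl] by (intro AE_I2) (metis mult_1)
    show "AE k in count_space UNIV. norm (w n k * R k) \<le> \<bar>R k\<bar>" for n
      using w01 by (intro AE_I2) (simp add: abs_mult mult_left_le_one_le)
  qed (use iR in auto)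
  then show ?thesis unfolding s eR .
qed

text \<open>The double series is dominated by \<open>b m * \<bar>\<rho> k\<bar>\<close>, because \<open>\<bar>\<rho> k\<bar> \<le> 1\<close> and \<open>m \<ge> 1\<close>; without
  a term for \<open>m = 0\<close> it converges absolutely.\<close>

lemma infsum_power_series_swap:
  fixes b :: "nat \<Rightarrow> real" and \<rho> R :: "int \<Rightarrow> real"
  assumes b: "\<And>m. 0 \<le> b m" and A: "(\<lambda>n. \<Sum>m=1..n. b m) \<longlonglongrightarrow> A"
    and \<rho>: "\<And>k. \<bar>\<rho> k\<bar> \<le> 1" "(\<lambda>k. \<bar>\<rho> k\<bar>) summable_on UNIV"
    and R: "\<And>k. (\<lambda>n. \<Sum>m=1..n. b m * \<rho> k ^ m) \<longlonglongrightarrow> R k"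
  shows "(\<lambda>k. \<bar>R k\<bar>) summable_on UNIV" "(\<Sum>\<^sub>\<infinity>k. R k) = (\<Sum>\<^sub>\<infinity>m\<in>{1..}. b m * (\<Sum>\<^sub>\<infinity>k. \<rho> k ^ m))"
proof -
  have pw: "\<bar>\<rho> k ^ m\<bar> \<le> \<bar>\<rho> k\<bar>" if "m \<ge> 1" for k m
  proof -
    have "\<bar>\<rho> k\<bar> ^ m \<le> \<bar>\<rho> k\<bar> ^ 1" using \<rho>(1) that by (intro power_decreasing) auto
    then show ?thesis by (simp add: power_abs)
  qed
  have hs: "(f has_sum l) {1..}" if n: "(\<lambda>n. \<Sum>m=1..n. f m) \<longlonglongrightarrow> l" and fb: "\<And>m. m \<ge> 1 \<Longrightarrow> \<bar>f m\<bar> \<le> b m" for f :: "nat \<Rightarrow> real" and l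
  proof -
    (* series are indexed from 0, so the missing term is filled with 0 *)
    define f0 where "f0 m = (if m = 0 then 0 else f m)" for m
    have part: "(\<Sum>m<Suc n. h m) = (\<Sum>m=1..n. h m)" if "h 0 = 0" for h :: "nat \<Rightarrow> real" and n
    proof -
      have "{..<Suc n} = insert 0 {1..n}" by auto
      then show ?thesis using that by simp
    qed
    have f0_part: "(\<Sum>m<Suc n. f0 m) = (\<Sum>m=1..n. f m)" for n
      by (rule trans[OF part sum.cong]) (auto simp: f0_def)
    have s0: "f0 sums l"
    proof -
      have "(\<lambda>n. \<Sum>m<Suc n. f0 m) \<longlonglongrightarrow> l"
        using n unfolding f0_part .
      then show ?thesis unfolding sums_def by (rule filterlim_sequentially_Suc[THEN iffD1])
    qed
    define b0 where "b0 m = (if m = 0 then 0 else b m)" for m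
    have b0_part: "(\<Sum>m<Suc n. b0 m) = (\<Sum>m=1..n. b m)" for n
      by (rule trans[OF part sum.cong]) (auto simp: b0_def)
    have bA: "b0 sums A"
    proof -
      have "(\<lambda>n. \<Sum>m<Suc n. b0 m) \<longlonglongrightarrow> A"
        using A unfolding b0_part .
      then show ?thesis unfolding sums_def by (rule filterlim_sequentially_Suc[THEN iffD1])
    qed
    have "summable (\<lambda>m. norm (f0 m))"
    proof (rule summable_comparison_test'[OF sums_summable[OF bA], of 0])
      show "norm (norm (f0 m)) \<le> b0 m" for m using fb[of m] by (cases "m = 0") (simp_all add: f0_def b0_def)
    qed
    then have "(f0 has_sum l) UNIV" using s0 by (rule norm_summable_imp_has_sum)
    moreover have "(f has_sum l) {1..} \<longleftrightarrow> (f0 has_sum l) UNIV"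
      by (rule has_sum_cong_neutral) (auto simp: f0_def)
    ultimately show ?thesis by blast
  qed
  have hb: "(b has_sum A) {1..}" by (rule hs[OF A]) (use b in auto)
  then have sb: "b summable_on {1..}" by (rule has_sum_imp_summable)
  have hR: "((\<lambda>m. b m * \<rho> k ^ m) has_sum R k) {1..}" for k
  proof (rule hs[OF R])
    fix m :: nat assume "m \<ge> 1"
    then have "\<bar>\<rho> k ^ m\<bar> \<le> 1" using pw[of m k] \<rho>(1)[of k] by linarith
    then show "\<bar>b m * \<rho> k ^ m\<bar> \<le> b m" using b[of m] by (simp add: abs_mult mult_left_le)
  qed
  have spw: "(\<lambda>k. \<bar>\<rho> k ^ m\<bar>) summable_on UNIV" if "m \<ge> 1" for m
    by (rule summable_on_comparison_test[OF \<rho>(2)]) (use pw[OF that] in auto)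
  define P where "P = (\<Sum>\<^sub>\<infinity>k. \<bar>\<rho> k\<bar>)"
  have Pm: "(\<Sum>\<^sub>\<infinity>k. \<bar>\<rho> k ^ m\<bar>) \<le> P" if "m \<ge> 1" for m
    unfolding P_def using spw[OF that] \<rho>(2) pw[OF that] by (intro infsum_mono) auto
  define F where "F = (\<lambda>(m, k). b m * \<rho> k ^ m)"
  have "(\<lambda>x. norm (F x)) summable_on (Sigma {1..} (\<lambda>_. UNIV))"
  proof (rule Infinite_Sum.abs_summable_on_Sigma_iff[THEN iffD2], intro conjI ballI)
    fix m :: nat assume m: "m \<in> {1..}"
    show "(\<lambda>k. norm (F (m, k))) summable_on UNIV"
      using summable_on_cmult_right[OF spw, of m "b m"] m b[of m] by (simp add: F_def abs_mult)
  next
    show "(\<lambda>m. norm (\<Sum>\<^sub>\<infinity>k. norm (F (m, k)))) summable_on {1..}"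
    proof (rule summable_on_comparison_test[of "\<lambda>m. b m * P"])
      show "(\<lambda>m. b m * P) summable_on {1..}" using sb by (rule summable_on_cmult_left)
      fix m :: nat assume m: "m \<in> {1..}"
      have "(\<Sum>\<^sub>\<infinity>k. norm (F (m, k))) = b m * (\<Sum>\<^sub>\<infinity>k. \<bar>\<rho> k ^ m\<bar>)"
        unfolding F_def using b[of m] by (simp add: abs_mult infsum_cmult_right')
      moreover have "0 \<le> (\<Sum>\<^sub>\<infinity>k. \<bar>\<rho> k ^ m\<bar>)" by (rule infsum_nonneg) simp
      ultimately show "norm (\<Sum>\<^sub>\<infinity>k. norm (F (m, k))) \<le> b m * P"
        using Pm[of m] m b[of m] by (auto simp: abs_mult intro!: mult_left_mono)
    qed simp
  qed
  then have "F summable_on ({1..} \<times> UNIV)" by (rule abs_summable_summable)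
  then have "(\<Sum>\<^sub>\<infinity>m\<in>{1..}. \<Sum>\<^sub>\<infinity>k. b m * \<rho> k ^ m) = (\<Sum>\<^sub>\<infinity>k. \<Sum>\<^sub>\<infinity>m\<in>{1..}. b m * \<rho> k ^ m)"
    unfolding F_def by (rule infsum_swap_banach)
  moreover have "(\<Sum>\<^sub>\<infinity>m\<in>{1..}. b m * \<rho> k ^ m) = R k" for k using hR by (rule infsumI)
  ultimately show "(\<Sum>\<^sub>\<infinity>k. R k) = (\<Sum>\<^sub>\<infinity>m\<in>{1..}. b m * (\<Sum>\<^sub>\<infinity>k. \<rho> k ^ m))"
    by (simp add: infsum_cmult_right')
  have Rb: "\<bar>R k\<bar> \<le> A * \<bar>\<rho> k\<bar>" for k
  proof (rule tendsto_le[OF _ tendsto_mult_right[OF A] tendsto_rabs[OF R]])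
    show "\<forall>\<^sub>F n in sequentially. \<bar>\<Sum>m=1..n. b m * \<rho> k ^ m\<bar> \<le> (\<Sum>m=1..n. b m) * \<bar>\<rho> k\<bar>"
      unfolding sum_distrib_right
      by (intro always_eventually allI order_trans[OF sum_abs] sum_mono) (auto simp: abs_mult b intro!: mult_left_mono pw)
  qed simp
  show "(\<lambda>k. \<bar>R k\<bar>) summable_on UNIV"
    by (rule summable_on_comparison_test[OF summable_on_cmult_right[OF \<rho>(2), of A]]) (use Rb in auto)
qed

section \<open>The rate of convergence\<close>

lemma tv_dist_le:
  assumes M: "prob_space M" and N: "prob_space N" and F: "F \<in> borel_measurable M" and Z: "Z \<in> borel_measurable N"
    and law: "distr N borel Z = gauss"
    and L: "\<And>h L. (\<And>x y. \<bar>h x - h y\<bar> \<le> L * \<bar>x - y\<bar>) \<Longrightarrow> (\<And>x. 0 \<le> h x) \<Longrightarrow> (\<And>x. h x \<le> 1) \<Longrightarrow>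
       \<bar>(\<integral>x. h (F x) \<partial>M) - (\<integral>x. h x \<partial>gauss)\<bar> \<le> K"
  shows "tv_dist M F N Z \<le> K"
  unfolding tv_dist_def
proof (rule cSUP_least)
  fix B :: "real set" assume B: "B \<in> sets borel"
  interpret M: prob_space M by fact
  have "\<bar>measure (distr M borel F) B - measure gauss B\<bar> \<le> K"
  proof (rule tv_from_lipschitz[OF M.prob_space_distr[OF F] prob_space_gauss _ _ _ B])
    fix h :: "real \<Rightarrow> real" and L
    assume h: "\<And>x y. \<bar>h x - h y\<bar> \<le> L * \<bar>x - y\<bar>" "\<And>x. 0 \<le> h x" "\<And>x. h x \<le> 1"
    have "L-lipschitz_on UNIV h" using h(1) h(1)[of 1 0] by (auto simp: lipschitz_on_def dist_real_def)
    then have "h \<in> borel_measurable borel"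
      by (intro borel_measurable_continuous_onI lipschitz_on_continuous_on)
    then show "\<bar>(\<integral>x. h x \<partial>distr M borel F) - (\<integral>x. h x \<partial>gauss)\<bar> \<le> K"
      using L[OF h] by (simp add: integral_distr[OF F])
  qed simp_all
  moreover have "measure (distr M borel F) B = measure M {\<omega> \<in> space M. F \<omega> \<in> B}"
    using measure_distr[OF F B] by (simp add: vimage_def Int_def conj_commute)
  moreover have "measure gauss B = measure N {\<omega> \<in> space N. Z \<omega> \<in> B}"
    unfolding law[symmetric] using measure_distr[OF Z B] by (simp add: vimage_def Int_def conj_commute)
  ultimately show "\<bar>measure M {\<omega> \<in> space M. F \<omega> \<in> B} - measure N {\<omega> \<in> space N. Z \<omega> \<in> B}\<bar> \<le> K" by simp
qed (use sets.top in blast)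

lemma tv_dist_le_1:
  assumes M: "prob_space M" and N: "prob_space N"
  shows "tv_dist M F N Z \<le> 1"
  unfolding tv_dist_def
proof (rule cSUP_least)
  fix B :: "real set"
  have "measure M A \<le> 1" "measure N C \<le> 1" "0 \<le> measure M A" "0 \<le> measure N C" for A C
    using prob_space.prob_le_1[OF M] prob_space.prob_le_1[OF N] by auto
  then show "\<bar>measure M {\<omega> \<in> space M. F \<omega> \<in> B} - measure N {\<omega> \<in> space N. Z \<omega> \<in> B}\<bar> \<le> 1"
    by (smt (verit))
qed (use sets.top in blast)

theorem theorem4p2:
  fixes M :: "'a measure" and X :: "int \<Rightarrow> 'a \<Rightarrow> real" and \<rho> :: "int \<Rightarrow> real"
    and g :: "real \<Rightarrow> real" and c :: "nat \<Rightarrow> real"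
    and Y :: "nat \<Rightarrow> 'a \<Rightarrow> real" and \<sigma> :: "nat \<Rightarrow> real"
    and N :: "'b measure" and Z :: "'b \<Rightarrow> real"
  assumes "prob_space M"
    and "gaussian_family M X"
    and "stationary_family M X"
    and "\<And>n. prob_space.expectation M (X n) = 0"
    and "\<And>n. prob_space.variance M (X n) = 1"
    and "\<And>k. \<rho> k = prob_space.expectation M (\<lambda>\<omega>. X 0 \<omega> * X k \<omega>)"
    and "g \<in> gauss_sobolev 2 4"
    and "has_hermite_rank g 1"
    and "hermite_expansion 1 c g"
    and "(\<lambda>j. \<bar>\<rho> j\<bar>) summable_on UNIV"
    and "(\<Sum>\<^sub>\<infinity>m\<in>{1..}. fact m * (c m)\<^sup>2 * (\<Sum>\<^sub>\<infinity>k\<in>UNIV. \<rho> k ^ m)) > 0"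
    and "\<And>n \<omega>. Y n \<omega> = 1 / sqrt (real n) * (\<Sum>j=1..n. g (X (int j) \<omega>))"
    and "\<And>n. \<sigma> n = sqrt (prob_space.expectation M (\<lambda>\<omega>. (Y n \<omega>)\<^sup>2))"
    and "prob_space N"
    and "distributed N lborel Z std_normal_density"
  shows "\<exists>C::real. \<forall>n\<ge>1. tv_dist M (\<lambda>\<omega>. Y n \<omega> / \<sigma> n) N Z \<le> C * real n powr (-1/2)"
proof -
  interpret M: prob_space M by fact
  have X[measurable]: "X n \<in> borel_measurable M" for n using assms(2) by (simp add: gaussian_family_def)
  note gv = gaussian_family_vector[OF assms(1,2,4)]
  have v: "(\<integral>x. (X n x)\<^sup>2 \<partial>M) = 1" for n using assms(5)[of n] unfolding assms(4) by simp
  have cov: "(\<integral>x. X i x * X j x \<partial>M) = \<rho> (j - i)" for i j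
    unfolding assms(6) by (rule stationary_covariance[OF assms(3) X])
  have sqX: "square_integrable M (X n)" for n
    using gaussian_vectorD(6)[OF gv[of "{n}"], of n] by (simp add: square_integrable_def)
  have \<rho>1: "\<bar>\<rho> k\<bar> \<le> 1" for k
    unfolding assms(6) using integral_Cauchy_Schwarz[OF sqX[of 0] sqX[of k]] by (simp add: v)
  note sg = hermite_expansion_L2(1)[OF assms(9)]
  have [measurable]: "g \<in> borel_measurable borel" using sg by (simp add: square_integrable_def measurable_def)
  have sgX: "square_integrable M (\<lambda>x. g (X n x))" for n
    by (rule square_integrable_component(1)[OF gv[of "{n}"] _ v sg]) auto
  define b where "b m = fact m * (c m)\<^sup>2" for m
  define R where "R k = (\<integral>x. g (X 0 x) * g (X k x) \<partial>M)" for k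
  have series: "(\<lambda>n. \<Sum>m=1..n. b m * \<rho> (j - i) ^ m) \<longlonglongrightarrow> (\<integral>x. g (X i x) * g (X j x) \<partial>M)" for i j
    using hermite_expansion_covariance[OF gv[of "{i,j}"] v _ _ assms(9), of i j] by (simp add: cov b_def)
  have Rser: "(\<lambda>n. \<Sum>m=1..n. b m * \<rho> k ^ m) \<longlonglongrightarrow> R k" for k
    using series[of k 0] by (simp add: R_def)
  have gR: "(\<integral>x. g (X i x) * g (X j x) \<partial>M) = R (j - i)" for i j
    by (rule LIMSEQ_unique[OF series Rser])
  have \<rho>0: "\<rho> 0 = 1" using cov[of 0 0] v[of 0] by (simp add: power2_eq_square)
  have A: "(\<lambda>n. \<Sum>m=1..n. b m) \<longlonglongrightarrow> R 0" using Rser[of 0] by (simp add: \<rho>0)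
  have b0: "0 \<le> b m" for m by (simp add: b_def)
  note swap = infsum_power_series_swap[OF b0 A \<rho>1 assms(10) Rser]
  (* the limit of the variances of the normalised sums *)
  define s where "s = (\<Sum>\<^sub>\<infinity>k. R k)"
  have s0: "s > 0" using assms(11) unfolding s_def swap(2) b_def .
  have Yint: "Y n x = 1 / sqrt (real n) * (\<Sum>j\<in>{1..int n}. g (X j x))" for n x
  proof -
    have "(\<Sum>j=1..n. g (X (int j) x)) = (\<Sum>j\<in>{1..int n}. g (X j x))"
      by (rule sum.reindex_bij_witness[of _ nat int]) auto
    then show ?thesis by (simp add: assms(12))
  qed
  have EY: "(\<integral>x. (Y n x)\<^sup>2 \<partial>M) = (\<Sum>i=1..int n. \<Sum>j=1..int n. R (j - i)) / real n" for n
  proof -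
    have ii: "integrable M (\<lambda>x. g (X i x) * g (X j x))" for i j by (rule square_integrable_mult[OF sgX sgX])
    have "(Y n x)\<^sup>2 = (\<Sum>i\<in>{1..int n}. \<Sum>j\<in>{1..int n}. g (X i x) * g (X j x)) / real n" for x
      unfolding Yint power_mult_distrib power2_eq_square[of "sum _ _"] sum_product by (simp add: power_divide)
    then have "(\<integral>x. (Y n x)\<^sup>2 \<partial>M) = (\<integral>x. (\<Sum>i\<in>{1..int n}. \<Sum>j\<in>{1..int n}. g (X i x) * g (X j x)) \<partial>M) / real n" by simp
    also have "(\<integral>x. (\<Sum>i\<in>{1..int n}. \<Sum>j\<in>{1..int n}. g (X i x) * g (X j x)) \<partial>M) = (\<Sum>i=1..int n. \<Sum>j=1..int n. R (j - i))"
      using ii by (simp add: Bochner_Integration.integral_sum Bochner_Integration.integrable_sum gR)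
    finally show ?thesis .
  qed
  have "(\<lambda>n. \<integral>x. (Y n x)\<^sup>2 \<partial>M) \<longlonglongrightarrow> s" unfolding EY s_def by (rule toeplitz_average_tendsto[OF swap(1)])
  then have "\<forall>\<^sub>F n in sequentially. s / 2 < (\<integral>x. (Y n x)\<^sup>2 \<partial>M)" using s0 by (intro order_tendstoD(1)) auto
  then obtain n0 where n0: "\<And>n. n \<ge> n0 \<Longrightarrow> s / 2 < (\<integral>x. (Y n x)\<^sup>2 \<partial>M)" by (auto simp: eventually_sequentially)
  obtain u p q :: "nat \<Rightarrow> real \<Rightarrow> real" and B :: "nat \<Rightarrow> real" and K where
    u: "\<And>n x. (u n has_real_derivative p n x) (at x)" "\<And>n x. (p n has_real_derivative q n x) (at x)"
    "\<And>n. continuous_on UNIV (q n)"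
    "\<And>n x. \<bar>u n x\<bar> \<le> B n" "\<And>n x. \<bar>p n x\<bar> \<le> B n" "\<And>n x. \<bar>q n x\<bar> \<le> B n"
    "\<And>n. (\<integral>x. (q n x) ^ 4 \<partial>gauss) + (\<integral>x. (p n x) ^ 4 \<partial>gauss) \<le> K"
    and "square_integrable gauss g" and ul: "(\<lambda>n. \<integral>x. (u n x - g x)\<^sup>2 \<partial>gauss) \<longlonglongrightarrow> 0"
    by (rule gauss_sobolev_approximation[OF assms(7)]) (rule that; assumption)
  define S where "S = (\<Sum>\<^sub>\<infinity>k. \<bar>\<rho> k\<bar>)"
  have S0: "0 \<le> S" unfolding S_def by (rule infsum_nonneg) simp
  have row: "(\<Sum>j\<in>I. \<bar>\<rho> (j - i)\<bar>) \<le> S" if "finite I" for I i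
  proof -
    have "(\<Sum>j\<in>I. \<bar>\<rho> (j - i)\<bar>) = (\<Sum>k\<in>(\<lambda>j. j - i) ` I. \<bar>\<rho> k\<bar>)" by (subst sum.reindex) (auto simp: inj_on_def)
    also have "\<dots> \<le> S" unfolding S_def using that by (intro finite_sum_le_infsum assms(10)) auto
    finally show ?thesis .
  qed
  define D where "D = 4 * pi / s * sqrt (pi * S ^ 3 * K)"
  have K0: "0 \<le> K" by (rule order_trans[OF _ u(7)[of 0]]) simp
  have D0: "0 \<le> D" unfolding D_def using s0 S0 K0 by simp
  have mY[measurable]: "Y n \<in> borel_measurable M" for n unfolding assms(12)[abs_def] by measurable
  have lawZ: "distr N borel Z = gauss" "Z \<in> borel_measurable N"
  proof -
    show "distr N borel Z = gauss"
      using assms(15) unfolding distributed_def gauss_def by (metis distr_cong sets_lborel)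
    show "Z \<in> borel_measurable N" using assms(15) by (simp add: distributed_def)
  qed
  have large: "tv_dist M (\<lambda>\<omega>. Y n \<omega> / \<sigma> n) N Z \<le> D * real n powr (-1/2)" if n: "n \<ge> 1" "n \<ge> n0" for n
  proof (rule tv_dist_le[OF assms(1) assms(14) _ lawZ(2,1)])
    show "(\<lambda>\<omega>. Y n \<omega> / \<sigma> n) \<in> borel_measurable M" by measurable
    fix h :: "real \<Rightarrow> real" and L
    assume h: "\<And>x y. \<bar>h x - h y\<bar> \<le> L * \<bar>x - y\<bar>" "\<And>x. 0 \<le> h x" "\<And>x. h x \<le> 1"
    have \<sigma>2: "(\<sigma> n)\<^sup>2 = (\<integral>x. (Y n x)\<^sup>2 \<partial>M)" unfolding assms(13) by simp
    have \<sigma>pos: "(\<sigma> n)\<^sup>2 > s / 2" unfolding \<sigma>2 by (rule n0[OF n(2)])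
    then have \<sigma>n0: "\<sigma> n \<noteq> 0" using s0 by auto
    define a where "a = 1 / (sqrt (real n) * \<sigma> n)"
    have F: "Y n x / \<sigma> n = a * (\<Sum>j\<in>{1..int n}. g (X j x))" for x by (simp add: Yint a_def)
    have norm: "(\<integral>x. (a * (\<Sum>j\<in>{1..int n}. g (X j x)))\<^sup>2 \<partial>M) = 1"
      unfolding F[symmetric] power_divide using \<sigma>n0 by (simp add: \<sigma>2[symmetric])
    have "\<bar>(\<integral>x. h (Y n x / \<sigma> n) \<partial>M) - (\<integral>x. h x \<partial>gauss)\<bar> \<le> 2 * pi * a\<^sup>2 * sqrt (2 * pi * S ^ 3 * card {1..int n} * (K / 2))"
      unfolding F
      by (rule stein_bound_limit[OF gv v cov[symmetric] _ S0 u sg hermite_expansion_mean[OF assms(9)] ul norm h])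
         (auto intro!: row)
    also have "\<dots> = 2 * pi * a\<^sup>2 * (sqrt n * sqrt (pi * S ^ 3 * K))"
      by (simp add: real_sqrt_mult[symmetric] mult_ac)
    also have "\<dots> = 2 * pi * sqrt (pi * S ^ 3 * K) * (1 / (\<sigma> n)\<^sup>2) * (sqrt n / n)"
      using n(1) by (simp add: a_def power_divide power_mult_distrib mult_ac)
    also have "\<dots> \<le> 2 * pi * sqrt (pi * S ^ 3 * K) * (2 / s) * (sqrt n / n)"
    proof -
      have "1 / (\<sigma> n)\<^sup>2 \<le> 1 / (s / 2)" using \<sigma>pos s0 by (intro frac_le) auto
      then show ?thesis using S0 K0 by (intro mult_right_mono mult_left_mono) auto
    qed
    also have "sqrt n / n = real n powr (-1/2)"
      using n(1) by (simp add: powr_minus powr_half_sqrt real_div_sqrt field_simps)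
    finally show "\<bar>(\<integral>x. h (Y n x / \<sigma> n) \<partial>M) - (\<integral>x. h x \<partial>gauss)\<bar> \<le> D * real n powr (-1/2)"
      by (simp add: D_def mult_ac)
  qed
  show ?thesis
  (* for n < n0 the distance is at most 1, which is at most sqrt n0 / sqrt n *)
  proof (intro exI[of _ "D + sqrt (real n0)"] allI impI)
    fix n :: nat assume n: "n \<ge> 1"
    have pw: "0 \<le> real n powr (-1/2)" by simp
    have half: "real n powr (-1/2) = 1 / sqrt (real n)"
      using powr_minus_divide[of "real n" "1/2"] powr_half_sqrt[of "real n"] by simp
    show "tv_dist M (\<lambda>\<omega>. Y n \<omega> / \<sigma> n) N Z \<le> (D + sqrt (real n0)) * real n powr (-1/2)"
    proof (cases "n \<ge> n0")
      case True
      have "D * real n powr (-1/2) \<le> (D + sqrt (real n0)) * real n powr (-1/2)" by (intro mult_right_mono pw) simp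
      then show ?thesis using large[OF n True] by linarith
    next
      case False
      have "1 \<le> sqrt (real n0) / sqrt (real n)" using n False by simp
      also have "\<dots> = sqrt (real n0) * real n powr (-1/2)" unfolding half by simp
      also have "\<dots> \<le> (D + sqrt (real n0)) * real n powr (-1/2)" using D0 by (intro mult_right_mono pw) simp
      finally show ?thesis by (rule order_trans[OF tv_dist_le_1[OF assms(1,14)]])
    qed
  qed
qed

end
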